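(* Let $L$ be a $d$-generator generalized Heisenberg Lie algebra of rank $m$. Then: (i) If $m=\frac{1}{2}d(d-1)-1$, then $$L\wedge L\cong A\big(\tfrac{1}{6}(d-1)(2d^2+5d-6)-1\big),$$ $$L\otimes L\cong A\big(\tfrac{1}{3}d(d^2+3d-4)\big),$$ $$J_2(L)\cong A\big(\tfrac{1}{6}d(2d^2+3d-5)+1\big).$$ (ii) If $m=\frac{1}{2}d(d-1)-2$, then $$L\wedge L\cong A\big(\tfrac{1}{6}(d-1)(2d^2+5d-12)-2\big),$$ $$L\otimes L\cong A\big(\tfrac{1}{3}d(d^2+3d-7)\big),$$ $$J_2(L)\cong A\big(\tfrac{1}{6}d(2d^2+3d-11)+2\big).$$
   Context: Lie algebras are over a field. $A(n)$ denotes an abelian Lie algebra of dimension $n$, and $L^2=[L,L]$. A Lie algebra $H$ is called a generalized Heisenberg Lie algebra of rank $n$ if $H^2=Z(H)$ and $\dim H^2=n$. It is $d$-generator if a minimal generating set has $d$ elements, i.e. $\dim H/H^2=d$. $L\otimes L$ is the non-abelian tensor square of $L$ (in the sense of Ellis): the Lie algebra generated by symbols $x\otimes y$ ($x,y\in L$), bilinear in $x,y$, subject to $[x,x']\otimes y=x\otimes[x',y]-x'\otimes[x,y]$, $x\otimes[y,y']=[y',x]\otimes y-[y,x]\otimes y'$, and $[x\otimes y,x'\otimes y']=-[y,x]\otimes[x',y']$. The (non-abelian) exterior square $L\wedge L$ is the quotient of $L\otimes L$ by the ideal generated by all $x\otimes x$, $x\in L$. $J_2(L)$ is the kernel of the commutator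 map $\kappa: L\otimes L\to L^2$, $x\otimes y\mapsto[x,y]$. *)

theory Defs
  imports "HOL-Algebra.AbelCoset" "Jordan_Normal_Form.VS_Connect"
begin

section \<open>Lie algebras over a field\<close>

text \<open>The ground field is a type of class \<open>field\<close>, seen as the ring record \<open>class_ring\<close>,
  so that a Lie algebra is a \<open>vectorspace class_ring\<close> on an explicit carrier with a bracket.
  The record fields \<open>mult\<close> and \<open>one\<close> inherited from \<open>module\<close> are never used.\<close>

record ('k, 'v) lie = "('k, 'v) module" +
  bracket :: "'v \<Rightarrow> 'v \<Rightarrow> 'v" ("\<lblot>_, _\<rblot>\<index>")

locale lie_algebra = vectorspace class_ring L
  for L :: "('k::field, 'v, 'm) lie_scheme" (structure) +
  assumes bracket_closed:
      "\<lbrakk>x \<in> carrier L; y \<in> carrier L\<rbrakk> \<Longrightarrow> \<lblot>x, y\<rblot> \<in> carrier L"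
    and bracket_add_left:
      "\<lbrakk>x \<in> carrier L; y \<in> carrier L; z \<in> carrier L\<rbrakk> \<Longrightarrow> \<lblot>x \<oplus> y, z\<rblot> = \<lblot>x, z\<rblot> \<oplus> \<lblot>y, z\<rblot>"
    and bracket_add_right:
      "\<lbrakk>x \<in> carrier L; y \<in> carrier L; z \<in> carrier L\<rbrakk> \<Longrightarrow> \<lblot>x, y \<oplus> z\<rblot> = \<lblot>x, y\<rblot> \<oplus> \<lblot>x, z\<rblot>"
    and bracket_smult_left:
      "\<lbrakk>x \<in> carrier L; y \<in> carrier L\<rbrakk> \<Longrightarrow> \<lblot>c \<odot> x, y\<rblot> = c \<odot> \<lblot>x, y\<rblot>"
    and bracket_smult_right:
      "\<lbrakk>x \<in> carrier L; y \<in> carrier L\<rbrakk> \<Longrightarrow> \<lblot>x, c \<odot> y\<rblot> = c \<odot> \<lblot>x, y\<rblot>"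
    and bracket_self:
      "x \<in> carrier L \<Longrightarrow> \<lblot>x, x\<rblot> = \<zero>"
    and jacobi:
      "\<lbrakk>x \<in> carrier L; y \<in> carrier L; z \<in> carrier L\<rbrakk>
        \<Longrightarrow> \<lblot>x, \<lblot>y, z\<rblot>\<rblot> \<oplus> \<lblot>y, \<lblot>z, x\<rblot>\<rblot> \<oplus> \<lblot>z, \<lblot>x, y\<rblot>\<rblot> = \<zero>"

text \<open>\<open>vectorspace.dim\<close> is meaningless without \<open>fin_dim\<close>, hence the conjunction.\<close>

definition has_dim :: "('k::field, 'v, 'm) module_scheme \<Rightarrow> nat \<Rightarrow> bool" where
  "has_dim V n \<longleftrightarrow> vectorspace.fin_dim class_ring V \<and> vectorspace.dim class_ring V = n"

definition lie_hom ::
  "('k::field, 'v, 'm) lie_scheme \<Rightarrow> ('k, 'w, 'n) lie_scheme \<Rightarrow> ('v \<Rightarrow> 'w) set" where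
  "lie_hom L M = {f \<in> LinearCombinations.module_hom class_ring L M.
     \<forall>x\<in>carrier L. \<forall>y\<in>carrier L. f \<lblot>x, y\<rblot>\<^bsub>L\<^esub> = \<lblot>f x, f y\<rblot>\<^bsub>M\<^esub>}"

definition lie_isomorphic ::
  "('k::field, 'v, 'm) lie_scheme \<Rightarrow> ('k, 'w, 'n) lie_scheme \<Rightarrow> bool" (infix "\<cong>\<^sub>L" 50) where
  "L \<cong>\<^sub>L M \<longleftrightarrow> (\<exists>f \<in> lie_hom L M. bij_betw f (carrier L) (carrier M))"

definition abelian_lie :: "nat \<Rightarrow> ('k::field, 'k vec) lie" where
  "abelian_lie n = module.extend (module_vec TYPE('k) n) (lie.fields (\<lambda>_ _. 0\<^sub>v n))"

definition lie_derived :: "('k::field, 'v, 'm) lie_scheme \<Rightarrow> 'v set" where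
  "lie_derived L = LinearCombinations.module.span class_ring L {\<lblot>x, y\<rblot>\<^bsub>L\<^esub> | x y. x \<in> carrier L \<and> y \<in> carrier L}"

definition lie_centre :: "('k::field, 'v, 'm) lie_scheme \<Rightarrow> 'v set" where
  "lie_centre L = {z \<in> carrier L. \<forall>x\<in>carrier L. \<lblot>z, x\<rblot>\<^bsub>L\<^esub> = \<zero>\<^bsub>L\<^esub>}"

definition lie_ideal :: "'v set \<Rightarrow> ('k::field, 'v, 'm) lie_scheme \<Rightarrow> bool" where
  "lie_ideal I L \<longleftrightarrow> VectorSpace.subspace class_ring I L \<and> (\<forall>x\<in>carrier L. \<forall>a\<in>I. \<lblot>x, a\<rblot>\<^bsub>L\<^esub> \<in> I)"

definition ideal_generated :: "('k::field, 'v, 'm) lie_scheme \<Rightarrow> 'v set \<Rightarrow> 'v set" where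
  "ideal_generated L S = \<Inter> {I. lie_ideal I L \<and> S \<subseteq> I}"

definition lie_quotient ::
  "('k::field, 'v, 'm) lie_scheme \<Rightarrow> 'v set \<Rightarrow> ('k, 'v set) lie" (infixl "'/\<^sub>L" 65) where
  "L /\<^sub>L I =
    \<lparr>carrier = a_rcosets\<^bsub>L\<^esub> I,
     mult = undefined,
     one = undefined,
     zero = I,
     add = set_add L,
     smult = (\<lambda>c X. \<Union>x\<in>X. I +>\<^bsub>L\<^esub> (c \<odot>\<^bsub>L\<^esub> x)),
     bracket = (\<lambda>X Y. \<Union>x\<in>X. \<Union>y\<in>Y. I +>\<^bsub>L\<^esub> \<lblot>x, y\<rblot>\<^bsub>L\<^esub>)\<rparr>"

definition generalized_heisenberg :: "('k::field, 'v, 'm) lie_scheme \<Rightarrow> nat \<Rightarrow> bool" where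
  "generalized_heisenberg H n \<longleftrightarrow>
     lie_algebra H \<and> lie_derived H = lie_centre H \<and> has_dim (H\<lparr>carrier := lie_derived H\<rparr>) n"

text \<open>For these (nilpotent) algebras \<open>dim H/H\<^sup>2\<close> is the size of a minimal generating set.\<close>

definition generator_number :: "('k::field, 'v, 'm) lie_scheme \<Rightarrow> nat \<Rightarrow> bool" where
  "generator_number H d \<longleftrightarrow> has_dim (H /\<^sub>L lie_derived H) d"


section \<open>Free Lie algebras\<close>

text \<open>The free Lie algebra on a set \<open>X\<close> consists of the formal Lie expressions in the elements
  of \<open>X\<close>, modulo the congruence generated by the axioms of a Lie algebra.\<close>

datatype (dead 'k, gens: 'g) lie_term =
    Gen 'g
  | Zero
  | Add "('k, 'g) lie_term" "('k, 'g) lie_term"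
  | Smult 'k "('k, 'g) lie_term"
  | Bracket "('k, 'g) lie_term" "('k, 'g) lie_term"

inductive lie_eq :: "('k::field, 'g) lie_term \<Rightarrow> ('k, 'g) lie_term \<Rightarrow> bool" where
  refl: "lie_eq s s"
| sym: "lie_eq s t \<Longrightarrow> lie_eq t s"
| trans: "lie_eq s t \<Longrightarrow> lie_eq t u \<Longrightarrow> lie_eq s u"
| add_cong: "lie_eq s s' \<Longrightarrow> lie_eq t t' \<Longrightarrow> lie_eq (Add s t) (Add s' t')"
| smult_cong: "lie_eq s s' \<Longrightarrow> lie_eq (Smult c s) (Smult c s')"
| bracket_cong: "lie_eq s s' \<Longrightarrow> lie_eq t t' \<Longrightarrow> lie_eq (Bracket s t) (Bracket s' t')"
| add_assoc: "lie_eq (Add (Add s t) u) (Add s (Add t u))"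
| add_comm: "lie_eq (Add s t) (Add t s)"
| add_zero: "lie_eq (Add Zero s) s"
| add_neg: "lie_eq (Add (Smult (- 1) s) s) Zero"
| smult_add_right: "lie_eq (Smult c (Add s t)) (Add (Smult c s) (Smult c t))"
| smult_add_left: "lie_eq (Smult (c + c') s) (Add (Smult c s) (Smult c' s))"
| smult_smult: "lie_eq (Smult (c * c') s) (Smult c (Smult c' s))"
| smult_one: "lie_eq (Smult 1 s) s"
| bracket_add_left: "lie_eq (Bracket (Add s t) u) (Add (Bracket s u) (Bracket t u))"
| bracket_add_right: "lie_eq (Bracket s (Add t u)) (Add (Bracket s t) (Bracket s u))"
| bracket_smult_left: "lie_eq (Bracket (Smult c s) t) (Smult c (Bracket s t))"
| bracket_smult_right: "lie_eq (Bracket s (Smult c t)) (Smult c (Bracket s t))"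
| bracket_self: "lie_eq (Bracket s s) Zero"
| jacobi: "lie_eq (Add (Add (Bracket s (Bracket t u)) (Bracket t (Bracket u s)))
    (Bracket u (Bracket s t))) Zero"

definition free_lie_rel :: "'g set \<Rightarrow> ('k::field, 'g) lie_term rel" where
  "free_lie_rel X = {(s, t). gens s \<subseteq> X \<and> gens t \<subseteq> X \<and> lie_eq s t}"

definition free_lie :: "'g set \<Rightarrow> ('k::field, ('k, 'g) lie_term set) lie" where
  "free_lie X =
    \<lparr>carrier = {t. gens t \<subseteq> X} // free_lie_rel X,
     mult = undefined,
     one = undefined,
     zero = free_lie_rel X `` {Zero},
     add = (\<lambda>S T. \<Union>s\<in>S. \<Union>t\<in>T. free_lie_rel X `` {Add s t}),
     smult = (\<lambda>c S. \<Union>s\<in>S. free_lie_rel X `` {Smult c s}),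
     bracket = (\<lambda>S T. \<Union>s\<in>S. \<Union>t\<in>T. free_lie_rel X `` {Bracket s t})\<rparr>"

definition free_gen :: "'g set \<Rightarrow> 'g \<Rightarrow> ('k::field, 'g) lie_term set" where
  "free_gen X g = free_lie_rel X `` {Gen g}"


section \<open>Non-abelian tensor and exterior squares\<close>

text \<open>The relators are differences of the two sides of the defining relations of the
  non-abelian tensor square, in the free Lie algebra on the symbols \<open>x \<otimes> y\<close>.\<close>

definition tensor_relators ::
  "('k::field, 'v, 'm) lie_scheme \<Rightarrow> ('k, 'v \<times> 'v) lie_term set set" where
  "tensor_relators L =
    (let C = carrier L;
         F = free_lie (C \<times> C) :: ('k, ('k, 'v \<times> 'v) lie_term set) lie;
         t = (\<lambda>x y. free_gen (C \<times> C) (x, y))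
     in {t (x \<oplus>\<^bsub>L\<^esub> x') y \<ominus>\<^bsub>F\<^esub> (t x y \<oplus>\<^bsub>F\<^esub> t x' y) | x x' y. x \<in> C \<and> x' \<in> C \<and> y \<in> C}
      \<union> {t x (y \<oplus>\<^bsub>L\<^esub> y') \<ominus>\<^bsub>F\<^esub> (t x y \<oplus>\<^bsub>F\<^esub> t x y') | x y y'. x \<in> C \<and> y \<in> C \<and> y' \<in> C}
      \<union> {t (c \<odot>\<^bsub>L\<^esub> x) y \<ominus>\<^bsub>F\<^esub> c \<odot>\<^bsub>F\<^esub> t x y | c x y. x \<in> C \<and> y \<in> C}
      \<union> {t x (c \<odot>\<^bsub>L\<^esub> y) \<ominus>\<^bsub>F\<^esub> c \<odot>\<^bsub>F\<^esub> t x y | c x y. x \<in> C \<and> y \<in> C}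
      \<union> {t \<lblot>x, x'\<rblot>\<^bsub>L\<^esub> y \<ominus>\<^bsub>F\<^esub> (t x \<lblot>x', y\<rblot>\<^bsub>L\<^esub> \<ominus>\<^bsub>F\<^esub> t x' \<lblot>x, y\<rblot>\<^bsub>L\<^esub>)
          | x x' y. x \<in> C \<and> x' \<in> C \<and> y \<in> C}
      \<union> {t x \<lblot>y, y'\<rblot>\<^bsub>L\<^esub> \<ominus>\<^bsub>F\<^esub> (t \<lblot>y', x\<rblot>\<^bsub>L\<^esub> y \<ominus>\<^bsub>F\<^esub> t \<lblot>y, x\<rblot>\<^bsub>L\<^esub> y')
          | x y y'. x \<in> C \<and> y \<in> C \<and> y' \<in> C}
      \<union> {\<lblot>t x y, t x' y'\<rblot>\<^bsub>F\<^esub> \<ominus>\<^bsub>F\<^esub> (\<ominus>\<^bsub>F\<^esub> t \<lblot>y, x\<rblot>\<^bsub>L\<^esub> \<lblot>x', y'\<rblot>\<^bsub>L\<^esub>)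
          | x y x' y'. x \<in> C \<and> y \<in> C \<and> x' \<in> C \<and> y' \<in> C})"

definition tensor_ideal ::
  "('k::field, 'v, 'm) lie_scheme \<Rightarrow> ('k, 'v \<times> 'v) lie_term set set" where
  "tensor_ideal L = ideal_generated (free_lie (carrier L \<times> carrier L)) (tensor_relators L)"

definition tensor_square ::
  "('k::field, 'v, 'm) lie_scheme \<Rightarrow> ('k, ('k, 'v \<times> 'v) lie_term set set) lie" where
  "tensor_square L = free_lie (carrier L \<times> carrier L) /\<^sub>L tensor_ideal L"

definition tensor ::
  "('k::field, 'v, 'm) lie_scheme \<Rightarrow> 'v \<Rightarrow> 'v \<Rightarrow> ('k, 'v \<times> 'v) lie_term set set" where
  "tensor L x y =
     tensor_ideal L +>\<^bsub>free_lie (carrier L \<times> carrier L)\<^esub>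
       free_gen (carrier L \<times> carrier L) (x, y)"

definition exterior_square ::
  "('k::field, 'v, 'm) lie_scheme \<Rightarrow> ('k, ('k, 'v \<times> 'v) lie_term set set set) lie" where
  "exterior_square L = tensor_square L /\<^sub>L
     ideal_generated (tensor_square L) {tensor L x x | x. x \<in> carrier L}"

text \<open>The commutator map is the unique homomorphism with the prescribed values on the
  generators; \<open>extensional\<close> fixes its (irrelevant) values outside the carrier.\<close>

definition commutator_map ::
  "('k::field, 'v, 'm) lie_scheme \<Rightarrow> ('k, 'v \<times> 'v) lie_term set set \<Rightarrow> 'v" where
  "commutator_map L = (THE f.
     f \<in> lie_hom (tensor_square L) (L\<lparr>carrier := lie_derived L\<rparr>) \<and>
     f \<in> extensional (carrier (tensor_square L)) \<and>
     (\<forall>x\<in>carrier L. \<forall>y\<in>carrier L. f (tensor L x y) = \<lblot>x, y\<rblot>\<^bsub>L\<^esub>))"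

definition J2 ::
  "('k::field, 'v, 'm) lie_scheme \<Rightarrow> ('k, ('k, 'v \<times> 'v) lie_term set set) lie" where
  "J2 L = (tensor_square L)\<lparr>carrier :=
     {u \<in> carrier (tensor_square L). commutator_map L u = \<zero>\<^bsub>L\<^esub>}\<rparr>"

end

theory Submission
  imports Defs
begin

text \<open>A generalized Heisenberg algebra \<open>L\<close> has class two, so \<open>L \<otimes> L\<close> has zero bracket and only its
  dimension is at stake. Let \<open>V\<close>, with basis \<open>e\<^sub>i\<close>, be a complement of \<open>Z = L\<^sup>2\<close>, and let \<open>P\<close> be a set of
  pairs \<open>i < j\<close> whose brackets \<open>z\<^sub>p = [e\<^sub>i, e\<^sub>j]\<close> form a basis of \<open>Z\<close>. The defining relations give
  \<open>Z \<otimes> Z = 0\<close> and \<open>z \<otimes> x = - x \<otimes> z\<close>, and what remains of them is the cyclic relation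
  \<open>x \<otimes> [y, u] + y \<otimes> [u, x] + u \<otimes> [x, y] = 0\<close>. Hence \<open>L \<otimes> L\<close> is \<open>V \<otimes> V\<close> plus the quotient of \<open>V \<otimes> Z\<close> by
  the cyclic relations, which are spanned by those of the triples \<open>e\<^sub>a, e\<^sub>b, e\<^sub>c\<close> with \<open>a < b < c\<close>.

  The crucial point is that these relations are linearly independent when \<open>dim Z\<close> falls short of
  \<open>d(d - 1)/2\<close> by at most two (lemma \<open>jacobi_relations_independent\<close>). A dependency is an alternating
  trilinear form on \<open>V\<close> all of whose contractions are relations among the \<open>[e\<^sub>i, e\<^sub>j]\<close>; the space of such
  relations has dimension at most two, so the form factors through a quotient of \<open>V\<close> of dimension at
  most two and vanishes. Thus the quotient of \<open>V \<otimes> Z\<close> has dimension \<open>dm - d(d - 1)(d - 2)/6\<close>, and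
  a suitable set \<open>B\<close> of the tensors \<open>e\<^sub>i \<otimes> z\<^sub>p\<close> is a basis of it. Passing to \<open>L \<and> L\<close> replaces \<open>V \<otimes> V\<close> by
  its exterior square; the commutator map lives on \<open>V \<otimes> V\<close> and is onto \<open>Z\<close>, which gives \<open>J\<^sub>2(L)\<close>.

  Each of the three algebras is identified by a basis together with its dual basis. The dual forms come
  from the universal properties of the free Lie algebra and of quotients
  (\<open>tensor_square_universal\<close>, \<open>ideal_generated_universal\<close>); that the basis of \<open>L \<otimes> L\<close> spans is shown by checking
  that every subspace containing it contains all tensors (\<open>basis_tensors_span\<close>). The argument is
  independent of the characteristic.\<close>

section \<open>Vector spaces, linear forms and coordinates\<close>

text \<open>In this locale the scalars are the elements of the field type: its first lemmas restate the laws of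
  a module with \<open>0\<close>, \<open>1\<close>, \<open>+\<close> and \<open>*\<close> in place of the operations of the record \<open>class_ring\<close>.\<close>

locale space = vectorspace class_ring V
  for V :: "('k::field, 'v, 'm) module_scheme" (structure)
begin

lemma smult_in [simp, intro]: "x \<in> carrier V \<Longrightarrow> c \<odot> x \<in> carrier V"
  using smult_closed[of c x] by simp

lemma smult_plus: "x \<in> carrier V \<Longrightarrow> (a + b) \<odot> x = a \<odot> x \<oplus> b \<odot> x"
  using smult_l_distr[of a b x] by simp

lemma smult_oplus: "x \<in> carrier V \<Longrightarrow> y \<in> carrier V \<Longrightarrow> c \<odot> (x \<oplus> y) = c \<odot> x \<oplus> c \<odot> y"
  using smult_r_distr[of c x y] by simp

lemma smult_times: "x \<in> carrier V \<Longrightarrow> (a * b) \<odot> x = a \<odot> (b \<odot> x)"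
  using smult_assoc1[of a b x] by simp

lemma smult_1 [simp]: "x \<in> carrier V \<Longrightarrow> 1 \<odot> x = x"
  using smult_one[of x] by simp

lemma smult_0 [simp]: "x \<in> carrier V \<Longrightarrow> 0 \<odot> x = \<zero>"
  using smult_l_null[of x] by simp

lemma smult_zero [simp]: "c \<odot> \<zero> = \<zero>"
  using smult_r_null[of c] by simp

lemma smult_neg1: "x \<in> carrier V \<Longrightarrow> (- 1) \<odot> x = \<ominus> x"
  using smult_minus_1[of x] by (simp add: class_ring_simps)

lemma smult_uminus: "x \<in> carrier V \<Longrightarrow> (- c) \<odot> x = \<ominus> (c \<odot> x)"
  using smult_times[of x "-1" c] smult_neg1[of "c \<odot> x"] by simp

lemma smult_ominus: "x \<in> carrier V \<Longrightarrow> c \<odot> (\<ominus> x) = \<ominus> (c \<odot> x)"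
  using smult_times[of x c "-1"] smult_neg1[of x] smult_uminus[of x c] by simp

lemma subspace_iff:
  "VectorSpace.subspace class_ring S V \<longleftrightarrow> S \<subseteq> carrier V \<and> \<zero> \<in> S \<and>
     (\<forall>x\<in>S. \<forall>y\<in>S. x \<oplus> y \<in> S) \<and> (\<forall>c. \<forall>x\<in>S. c \<odot> x \<in> S)"
  using vectorspace_axioms module_axioms
  by (auto simp: VectorSpace.subspace_def LinearCombinations.submodule_def)

lemma subspace_space: "VectorSpace.subspace class_ring S V \<Longrightarrow> space (V\<lparr>carrier := S\<rparr>)"
  unfolding space_def by (rule subspace_is_vs)

lemma subspace_ominus:
  "VectorSpace.subspace class_ring S V \<Longrightarrow> x \<in> S \<Longrightarrow> \<ominus> x \<in> S"
  using smult_neg1[of x] unfolding subspace_iff by (metis subsetD)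

lemma subspace_minus:
  "VectorSpace.subspace class_ring S V \<Longrightarrow> x \<in> S \<Longrightarrow> y \<in> S \<Longrightarrow> x \<ominus> y \<in> S"
  using subspace_ominus[of S y] unfolding subspace_iff a_minus_def by blast

lemma subspace_finsum:
  assumes S: "VectorSpace.subspace class_ring S V" and w: "\<And>a. a \<in> A \<Longrightarrow> w a \<in> S"
  shows "finsum V w A \<in> S"
  using w
proof (induct A rule: infinite_finite_induct)
  case (infinite A)
  then show ?case using S by (simp add: finsum_infinite subspace_iff)
next
  case empty
  then show ?case using S by (simp add: subspace_iff)
next
  case (insert a A)
  have "finsum V w (insert a A) = w a \<oplus> finsum V w A"
    using insert S by (intro finsum_insert) (auto simp: subspace_iff)
  then show ?case using insert S by (simp add: subspace_iff)
qed

end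

definition linear_form :: "('k::field, 'v, 'm) module_scheme \<Rightarrow> ('v \<Rightarrow> 'k) \<Rightarrow> bool" where
  "linear_form V f \<longleftrightarrow>
     (\<forall>x\<in>carrier V. \<forall>y\<in>carrier V. f (x \<oplus>\<^bsub>V\<^esub> y) = f x + f y) \<and>
     (\<forall>c. \<forall>x\<in>carrier V. f (c \<odot>\<^bsub>V\<^esub> x) = c * f x)"

lemma linear_formI:
  assumes "\<And>x y. x \<in> carrier V \<Longrightarrow> y \<in> carrier V \<Longrightarrow> f (x \<oplus>\<^bsub>V\<^esub> y) = f x + f y"
    and "\<And>c x. x \<in> carrier V \<Longrightarrow> f (c \<odot>\<^bsub>V\<^esub> x) = c * f x"
  shows "linear_form V f"
  using assms by (simp add: linear_form_def)

lemma linear_form_add: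
  "linear_form V f \<Longrightarrow> x \<in> carrier V \<Longrightarrow> y \<in> carrier V \<Longrightarrow> f (x \<oplus>\<^bsub>V\<^esub> y) = f x + f y"
  by (simp add: linear_form_def)

lemma linear_form_smult:
  "linear_form V f \<Longrightarrow> x \<in> carrier V \<Longrightarrow> f (c \<odot>\<^bsub>V\<^esub> x) = c * f x"
  by (simp add: linear_form_def)

lemma linear_form_sum:
  assumes "\<And>a. a \<in> A \<Longrightarrow> linear_form V (f a)"
  shows "linear_form V (\<lambda>x. \<Sum>a\<in>A. g a * f a x)"
  using assms by (intro linear_formI)
    (simp_all add: linear_form_add linear_form_smult sum.distrib sum_distrib_left algebra_simps)

context space
begin

lemma linear_form_zero: "linear_form V f \<Longrightarrow> f \<zero> = 0"
  using linear_form_smult[of V f \<zero> 0] by simp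

lemma linear_form_ominus: "linear_form V f \<Longrightarrow> x \<in> carrier V \<Longrightarrow> f (\<ominus> x) = - f x"
  using linear_form_smult[of V f x "-1"] smult_neg1[of x] by simp

lemma linear_form_minus:
  "linear_form V f \<Longrightarrow> x \<in> carrier V \<Longrightarrow> y \<in> carrier V \<Longrightarrow> f (x \<ominus> y) = f x - f y"
  by (simp add: a_minus_def linear_form_add linear_form_ominus)

lemma linear_form_finsum:
  assumes f: "linear_form V f" and w: "\<And>a. a \<in> A \<Longrightarrow> w a \<in> carrier V"
  shows "f (\<Oplus>a\<in>A. g a \<odot> w a) = (\<Sum>a\<in>A. g a * f (w a))"
  using w
proof (induct A rule: infinite_finite_induct)
  case (infinite A)
  then show ?case by (simp add: finsum_infinite linear_form_zero[OF f])
next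
  case empty
  then show ?case by (simp add: linear_form_zero[OF f])
next
  case (insert a A)
  have "(\<Oplus>a\<in>insert a A. g a \<odot> w a) = g a \<odot> w a \<oplus> (\<Oplus>a\<in>A. g a \<odot> w a)"
    using insert by (intro finsum_insert) auto
  moreover have "(\<Oplus>a\<in>A. g a \<odot> w a) \<in> carrier V"
    using insert by (intro finsum_closed) auto
  ultimately show ?case
    using insert by (simp add: linear_form_add[OF f] linear_form_smult[OF f])
qed

lemma linear_form_kernel_subspace:
  assumes "linear_form V f" and "linear_form V g"
  shows "VectorSpace.subspace class_ring {x \<in> carrier V. f x = g x} V"
  using assms by (auto simp: subspace_iff linear_form_zero linear_form_add linear_form_smult)

end

text \<open>A basis \<open>t\<close> together with its dual basis \<open>c\<close>. The last clause says that the forms separate points;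
  this is equivalent to the vectors spanning, but is easier to check for a subspace cut out by
  equations.\<close>

definition coordinate_system ::
  "('k::field, 'v, 'm) module_scheme \<Rightarrow> 'b set \<Rightarrow> ('b \<Rightarrow> 'v) \<Rightarrow> ('b \<Rightarrow> 'v \<Rightarrow> 'k) \<Rightarrow> bool" where
  "coordinate_system V B t c \<longleftrightarrow>
     finite B \<and> (\<forall>b\<in>B. t b \<in> carrier V) \<and> (\<forall>b\<in>B. linear_form V (c b)) \<and>
     (\<forall>a\<in>B. \<forall>b\<in>B. c a (t b) = (if a = b then 1 else 0)) \<and>
     (\<forall>x\<in>carrier V. (\<forall>b\<in>B. c b x = 0) \<longrightarrow> x = \<zero>\<^bsub>V\<^esub>)"

lemma coordinate_system_reindex:
  assumes "coordinate_system V B t c" and "bij_betw h B' B"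
  shows "coordinate_system V B' (t \<circ> h) (c \<circ> h)"
proof -
  have "finite B'" using assms bij_betw_finite by (auto simp: coordinate_system_def)
  moreover have h: "h b \<in> B" if "b \<in> B'" for b using that assms(2) by (auto simp: bij_betw_def)
  moreover have "h a = h b \<longleftrightarrow> a = b" if "a \<in> B'" "b \<in> B'" for a b
    using that assms(2) by (auto simp: bij_betw_def inj_on_def)
  moreover have "x = \<zero>\<^bsub>V\<^esub>" if x: "x \<in> carrier V" and z: "\<forall>b\<in>B'. c (h b) x = 0" for x
  proof -
    have "c b x = 0" if "b \<in> B" for b
      using that z assms(2) by (auto simp: bij_betw_def)
    then show ?thesis using x assms(1) by (auto simp: coordinate_system_def)
  qed
  ultimately show ?thesis using assms(1) by (simp add: coordinate_system_def)
qed

context space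
begin

lemma coordinate_system_sum:
  assumes B: "coordinate_system V B t c" and x: "x \<in> carrier V"
  shows "x = (\<Oplus>b\<in>B. c b x \<odot> t b)"
proof -
  let ?y = "\<Oplus>b\<in>B. c b x \<odot> t b"
  have t: "t b \<in> carrier V" if "b \<in> B" for b using B that by (auto simp: coordinate_system_def)
  then have y: "?y \<in> carrier V" by (intro finsum_closed) auto
  have "c a (x \<ominus> ?y) = 0" if a: "a \<in> B" for a
  proof -
    have lf: "linear_form V (c a)" using B a by (auto simp: coordinate_system_def)
    have "c a ?y = (\<Sum>b\<in>B. c b x * c a (t b))" using lf t by (rule linear_form_finsum)
    also have "\<dots> = (\<Sum>b\<in>B. if a = b then c b x else 0)"
      using B a by (intro sum.cong) (auto simp: coordinate_system_def)
    also have "\<dots> = c a x" using B a by (simp add: coordinate_system_def)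
    finally show ?thesis using lf x y by (simp add: linear_form_minus)
  qed
  then have "x \<ominus> ?y = \<zero>" using B x y by (auto simp: coordinate_system_def)
  then show ?thesis using x y by simp
qed

lemma coordinate_system_generates:
  assumes B: "coordinate_system V B t c" and S: "VectorSpace.subspace class_ring S V"
    and t: "\<And>b. b \<in> B \<Longrightarrow> t b \<in> S"
  shows "carrier V \<subseteq> S"
proof
  fix x assume "x \<in> carrier V"
  then have "x = (\<Oplus>b\<in>B. c b x \<odot> t b)" by (rule coordinate_system_sum[OF B])
  also have "\<dots> \<in> S" using S t by (intro subspace_finsum) (auto simp: subspace_iff)
  finally show "x \<in> S" .
qed

lemma coordinate_systemI_generates:
  assumes fin: "finite B" and t: "\<And>b. b \<in> B \<Longrightarrow> t b \<in> carrier V"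
    and lf: "\<And>b. b \<in> B \<Longrightarrow> linear_form V (c b)"
    and dual: "\<And>a b. a \<in> B \<Longrightarrow> b \<in> B \<Longrightarrow> c a (t b) = (if a = b then 1 else 0)"
    and gen: "\<And>S. VectorSpace.subspace class_ring S V \<Longrightarrow> (\<And>b. b \<in> B \<Longrightarrow> t b \<in> S) \<Longrightarrow>
      carrier V \<subseteq> S"
  shows "coordinate_system V B t c"
proof -
  \<comment> \<open>the vectors that agree with their expansion form a subspace\<close>
  let ?s = "\<lambda>x. \<Oplus>b\<in>B. c b x \<odot> t b"
  let ?S = "{x \<in> carrier V. x = ?s x}"
  have add: "?s (x \<oplus> y) = ?s x \<oplus> ?s y" if "x \<in> carrier V" "y \<in> carrier V" for x y
  proof -
    have "?s (x \<oplus> y) = (\<Oplus>b\<in>B. c b x \<odot> t b \<oplus> c b y \<odot> t b)"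
      using that t by (intro finsum_cong') (auto simp: linear_form_add[OF lf] smult_plus)
    also have "\<dots> = ?s x \<oplus> ?s y" using t by (intro finsum_addf) auto
    finally show ?thesis .
  qed
  have smult: "?s (a \<odot> x) = a \<odot> ?s x" if "x \<in> carrier V" for a x
  proof -
    have "?s (a \<odot> x) = (\<Oplus>b\<in>B. a \<odot> (c b x \<odot> t b))"
      using that t by (intro finsum_cong') (auto simp: linear_form_smult[OF lf] smult_times)
    also have "\<dots> = a \<odot> ?s x" using t by (intro finsum_smult[symmetric]) auto
    finally show ?thesis .
  qed
  have zero: "?s \<zero> = \<zero>"
    using t by (intro finsum_all0) (simp add: linear_form_zero[OF lf])
  have "VectorSpace.subspace class_ring ?S V"
    unfolding subspace_iff using add smult zero by auto
  moreover have "t a \<in> ?S" if a: "a \<in> B" for a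
  proof -
    have "?s (t a) = (\<Oplus>b\<in>B. if a = b then t b else \<zero>)"
      using t a by (intro finsum_cong') (auto simp: dual)
    also have "\<dots> = t a" using t a fin add.finprod_singleton[OF a fin, of t] by auto
    finally show ?thesis using t a by simp
  qed
  ultimately have S: "carrier V \<subseteq> ?S" by (rule gen)
  have "x = \<zero>" if x: "x \<in> carrier V" and z: "\<forall>b\<in>B. c b x = 0" for x
  proof -
    have "x = ?s x" using S x by blast
    also have "\<dots> = \<zero>" using z t by (intro finsum_all0) simp
    finally show ?thesis .
  qed
  then show ?thesis using fin t lf dual by (auto simp: coordinate_system_def)
qed

text \<open>A minimal generating subset is a basis, and the dual basis reads off the unique coefficients.
  Spanning is expressed by the subspaces containing the family, so that it can be verified without
  exhibiting any linear combination.\<close>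

lemma generating_family_contains_basis:
  assumes dim: "has_dim V n" and fin: "finite I" and w: "\<And>i. i \<in> I \<Longrightarrow> w i \<in> carrier V"
    and gen: "\<And>S. VectorSpace.subspace class_ring S V \<Longrightarrow> (\<And>i. i \<in> I \<Longrightarrow> w i \<in> S) \<Longrightarrow>
      carrier V \<subseteq> S"
  shows "\<exists>P c. P \<subseteq> I \<and> card P = n \<and> coordinate_system V P w c"
proof -
  have wI: "w ` I \<subseteq> carrier V" using w by auto
  have "carrier V \<subseteq> span (w ` I)"
    using in_own_span[OF wI] span_is_subspace[OF wI] by (intro gen) auto
  then have "gen_set (w ` I)" using span_is_subset2[OF wI] by auto
  then obtain \<beta> where \<beta>: "\<beta> \<subseteq> w ` I" "minimal \<beta> (\<lambda>S. S \<subseteq> carrier V \<and> gen_set S)"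
    using minimal_exists[of "w ` I" "\<lambda>S. S \<subseteq> carrier V \<and> gen_set S"] fin wI by auto
  have fb: "finite \<beta>" using \<beta>(1) fin finite_subset by blast
  have bas: "basis \<beta>" using \<beta>(2) by (rule min_gen_is_basis)
  have bV: "\<beta> \<subseteq> carrier V" using \<beta>(1) wI by auto
  define P where "P = inv_into I w ` \<beta>"
  have wP: "inj_on w P" "w ` P = \<beta>" "P \<subseteq> I"
  proof -
    have r: "w (inv_into I w v) = v" if "v \<in> \<beta>" for v
      using that \<beta>(1) by (intro f_inv_into_f) auto
    show "inj_on w P" by (auto simp: P_def inj_on_def r)
    show "w ` P = \<beta>" using r by (force simp: P_def)
    show "P \<subseteq> I" using \<beta>(1) by (auto simp: P_def intro!: inv_into_into)
  qed
  have "card P = card \<beta>" using wP card_image by fastforce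
  also have "\<dots> = n" using dim_basis[OF fb bas] dim by (simp add: has_dim_def)
  finally have card: "card P = n" .
  have ex1: "\<exists>!a. a \<in> \<beta> \<rightarrow>\<^sub>E UNIV \<and> lincomb a \<beta> = v" if "v \<in> carrier V" for v
    using basis_criterion[OF fb bV] bas that by simp
  define a where "a = (\<lambda>v. THE a. a \<in> \<beta> \<rightarrow>\<^sub>E UNIV \<and> lincomb a \<beta> = v)"
  have a: "a v \<in> \<beta> \<rightarrow>\<^sub>E UNIV" "lincomb (a v) \<beta> = v" if "v \<in> carrier V" for v
    using theI'[OF ex1[OF that]] by (auto simp: a_def)
  have a_unique: "a v b = f b" if "v \<in> carrier V" "lincomb f \<beta> = v" "b \<in> \<beta>" for v f b
  proof -
    have "lincomb (restrict f \<beta>) \<beta> = v"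
      using that(2) lincomb_cong[OF HOL.refl bV, of "restrict f \<beta>" f] by simp
    then have "restrict f \<beta> = a v"
      using ex1[OF that(1)] a[OF that(1)] by auto
    then show ?thesis using that(3) by (metis restrict_apply')
  qed
  have "coordinate_system V P w (\<lambda>p v. a v (w p))"
  proof -
    have wb: "w p \<in> \<beta>" if "p \<in> P" for p using wP that by auto
    have "finite P" using fb by (simp add: P_def)
    moreover have "linear_form V (\<lambda>v. a v (w p))" if p: "p \<in> P" for p
    proof (rule linear_formI)
      fix x y assume xy: "x \<in> carrier V" "y \<in> carrier V"
      have "lincomb (\<lambda>b. a x b + a y b) \<beta> = (\<Oplus>b\<in>\<beta>. a x b \<odot> b \<oplus> a y b \<odot> b)"
        unfolding lincomb_def using bV by (intro finsum_cong') (auto simp: smult_plus)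
      also have "\<dots> = lincomb (a x) \<beta> \<oplus> lincomb (a y) \<beta>"
        unfolding lincomb_def using bV by (intro finsum_addf) auto
      finally have "lincomb (\<lambda>b. a x b + a y b) \<beta> = x \<oplus> y" using a xy by simp
      then show "a (x \<oplus> y) (w p) = a x (w p) + a y (w p)"
        using xy wb[OF p] by (intro a_unique) auto
    next
      fix c x assume x: "x \<in> carrier V"
      have "lincomb (\<lambda>b. c * a x b) \<beta> = c \<odot> x"
        using lincomb_smult[OF bV, of "a x" c] a[OF x] by simp
      then show "a (c \<odot> x) (w p) = c * a x (w p)"
        using x wb[OF p] by (intro a_unique) auto
    qed
    moreover have "a (w q) (w p) = (if p = q then 1 else 0)" if pq: "p \<in> P" "q \<in> P" for p q
    proof -
      have wq: "w q \<in> carrier V" "w q \<in> \<beta>" using wb[OF pq(2)] bV by auto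
      have "lincomb (\<lambda>b. if b = w q then 1 else 0) \<beta> = (\<Oplus>b\<in>\<beta>. if w q = b then b else \<zero>)"
        unfolding lincomb_def using bV by (intro finsum_cong') auto
      also have "\<dots> = w q"
        using add.finprod_singleton[OF wq(2) fb, of "\<lambda>b. b"] bV by auto
      finally have "a (w q) (w p) = (if w p = w q then 1 else 0)"
        using wq wb[OF pq(1)] by (intro a_unique) auto
      then show ?thesis using wP(1) pq by (auto simp: inj_on_def)
    qed
    moreover have "x = \<zero>" if x: "x \<in> carrier V" and z: "\<forall>p\<in>P. a x (w p) = 0" for x
    proof -
      have "lincomb (a x) \<beta> = \<zero>"
        unfolding lincomb_def using z wP(2) bV by (intro finsum_all0) auto
      then show ?thesis using a[OF x] by simp
    qed
    ultimately show ?thesis using wb bV by (auto simp: coordinate_system_def)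
  qed
  then show ?thesis using wP(3) card by blast
qed

lemma has_dim_coordinates:
  assumes "has_dim V n"
  shows "\<exists>t c. coordinate_system V {..<n} t c"
proof -
  obtain A where A: "finite A" "A \<subseteq> carrier V" "gen_set A"
    using assms by (auto simp: has_dim_def fin_dim_def)
  have gen: "carrier V \<subseteq> S" if "VectorSpace.subspace class_ring S V" "\<And>i. i \<in> A \<Longrightarrow> i \<in> S" for S
    using span_is_subset[of A S] that A(3) by auto
  obtain P c where P: "card P = n" "coordinate_system V P (\<lambda>v. v) c"
    using generating_family_contains_basis[OF assms A(1), of "\<lambda>v. v"] A(2) gen by auto
  have "finite P" using P(2) by (simp add: coordinate_system_def)
  then obtain h where "bij_betw h {..<n} P" using ex_bij_betw_nat_finite P(1) lessThan_atLeast0 by metis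
  then show ?thesis using coordinate_system_reindex[OF P(2)] by blast
qed

end

section \<open>Homomorphisms, subalgebras and quotients of Lie algebras\<close>

sublocale lie_algebra \<subseteq> space L ..

lemma lie_algebraI:
  fixes L :: "('k::field, 'v, 'm) lie_scheme" (structure)
  assumes zero: "\<zero> \<in> carrier L"
    and add: "\<And>x y. x \<in> carrier L \<Longrightarrow> y \<in> carrier L \<Longrightarrow> x \<oplus> y \<in> carrier L"
    and smult: "\<And>c x. x \<in> carrier L \<Longrightarrow> c \<odot> x \<in> carrier L"
    and bracket: "\<And>x y. x \<in> carrier L \<Longrightarrow> y \<in> carrier L \<Longrightarrow> \<lblot>x, y\<rblot> \<in> carrier L"
    and a_assoc: "\<And>x y z. x \<in> carrier L \<Longrightarrow> y \<in> carrier L \<Longrightarrow> z \<in> carrier L \<Longrightarrow>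
      x \<oplus> y \<oplus> z = x \<oplus> (y \<oplus> z)"
    and a_comm: "\<And>x y. x \<in> carrier L \<Longrightarrow> y \<in> carrier L \<Longrightarrow> x \<oplus> y = y \<oplus> x"
    and l_zero: "\<And>x. x \<in> carrier L \<Longrightarrow> \<zero> \<oplus> x = x"
    and l_neg: "\<And>x. x \<in> carrier L \<Longrightarrow> (- 1) \<odot> x \<oplus> x = \<zero>"
    and smult_r: "\<And>c x y. x \<in> carrier L \<Longrightarrow> y \<in> carrier L \<Longrightarrow> c \<odot> (x \<oplus> y) = c \<odot> x \<oplus> c \<odot> y"
    and smult_l: "\<And>a b x. x \<in> carrier L \<Longrightarrow> (a + b) \<odot> x = a \<odot> x \<oplus> b \<odot> x"
    and smult_m: "\<And>a b x. x \<in> carrier L \<Longrightarrow> (a * b) \<odot> x = a \<odot> (b \<odot> x)"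
    and smult_1: "\<And>x. x \<in> carrier L \<Longrightarrow> 1 \<odot> x = x"
    and br: "lie_algebra_axioms L"
  shows "lie_algebra L"
proof -
  have "abelian_group L"
  proof (rule abelian_groupI)
    show "\<exists>y\<in>carrier L. y \<oplus> x = \<zero>" if "x \<in> carrier L" for x
      using l_neg[OF that] smult[OF that] by blast
  qed (fact zero add a_assoc a_comm l_zero)+
  moreover have "cring (class_ring :: 'k ring)" "field (class_ring :: 'k ring)"
    using class_field fieldE(1) by blast+
  ultimately have "vectorspace class_ring L"
    using smult smult_r smult_l smult_m smult_1
    by (intro vectorspace.intro moduleI) auto
  then show ?thesis using br by (rule lie_algebra.intro)
qed

lemma lie_homI:
  assumes "\<And>x. x \<in> carrier L \<Longrightarrow> f x \<in> carrier M"
    and "\<And>x y. x \<in> carrier L \<Longrightarrow> y \<in> carrier L \<Longrightarrow> f (x \<oplus>\<^bsub>L\<^esub> y) = f x \<oplus>\<^bsub>M\<^esub> f y"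
    and "\<And>c x. x \<in> carrier L \<Longrightarrow> f (c \<odot>\<^bsub>L\<^esub> x) = c \<odot>\<^bsub>M\<^esub> f x"
    and "\<And>x y. x \<in> carrier L \<Longrightarrow> y \<in> carrier L \<Longrightarrow> f \<lblot>x, y\<rblot>\<^bsub>L\<^esub> = \<lblot>f x, f y\<rblot>\<^bsub>M\<^esub>"
  shows "f \<in> lie_hom L M"
  using assms by (auto simp: lie_hom_def LinearCombinations.module_hom_def)

lemma lie_homD:
  assumes "f \<in> lie_hom L M"
  shows "\<And>x. x \<in> carrier L \<Longrightarrow> f x \<in> carrier M"
    and "\<And>x y. x \<in> carrier L \<Longrightarrow> y \<in> carrier L \<Longrightarrow> f (x \<oplus>\<^bsub>L\<^esub> y) = f x \<oplus>\<^bsub>M\<^esub> f y"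
    and "\<And>c x. x \<in> carrier L \<Longrightarrow> f (c \<odot>\<^bsub>L\<^esub> x) = c \<odot>\<^bsub>M\<^esub> f x"
    and "\<And>x y. x \<in> carrier L \<Longrightarrow> y \<in> carrier L \<Longrightarrow> f \<lblot>x, y\<rblot>\<^bsub>L\<^esub> = \<lblot>f x, f y\<rblot>\<^bsub>M\<^esub>"
  using assms by (auto simp: lie_hom_def LinearCombinations.module_hom_def)

context lie_algebra
begin

lemma bracket_zero_left [simp]: "x \<in> carrier L \<Longrightarrow> \<lblot>\<zero>, x\<rblot> = \<zero>"
  using bracket_smult_left[of \<zero> x 0] bracket_closed[of \<zero> x] by simp

lemma bracket_zero_right [simp]: "x \<in> carrier L \<Longrightarrow> \<lblot>x, \<zero>\<rblot> = \<zero>"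
  using bracket_smult_right[of x \<zero> 0] bracket_closed[of x \<zero>] by simp

lemma bracket_anticomm:
  assumes x: "x \<in> carrier L" and y: "y \<in> carrier L"
  shows "\<lblot>y, x\<rblot> = \<ominus> \<lblot>x, y\<rblot>"
proof -
  have "\<zero> = \<lblot>x \<oplus> y, x \<oplus> y\<rblot>" using x y by (simp add: bracket_self)
  also have "\<dots> = \<lblot>y, x\<rblot> \<oplus> \<lblot>x, y\<rblot>"
    using x y bracket_self[OF x] bracket_self[OF y]
    by (simp add: bracket_add_left bracket_add_right bracket_closed)
  finally have "\<lblot>y, x\<rblot> \<oplus> \<lblot>x, y\<rblot> = \<zero>" by (rule HOL.sym)
  then show ?thesis using x y M.minus_equality[of "\<lblot>y, x\<rblot>" "\<lblot>x, y\<rblot>"] bracket_closed by simp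
qed

lemma bracket_ominus_left: "x \<in> carrier L \<Longrightarrow> y \<in> carrier L \<Longrightarrow> \<lblot>\<ominus> x, y\<rblot> = \<ominus> \<lblot>x, y\<rblot>"
  using bracket_smult_left[of x y "-1"] by (simp add: smult_neg1 bracket_closed)

lemma bracket_ominus_right: "x \<in> carrier L \<Longrightarrow> y \<in> carrier L \<Longrightarrow> \<lblot>x, \<ominus> y\<rblot> = \<ominus> \<lblot>x, y\<rblot>"
  using bracket_smult_right[of x y "-1"] by (simp add: smult_neg1 bracket_closed)

lemma subalgebra:
  assumes S: "VectorSpace.subspace class_ring S L"
    and br: "\<And>x y. x \<in> S \<Longrightarrow> y \<in> S \<Longrightarrow> \<lblot>x, y\<rblot> \<in> S"
  shows "lie_algebra (L\<lparr>carrier := S\<rparr>)"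
proof -
  have S': "x \<in> carrier L" if "x \<in> S" for x using S that by (auto simp: subspace_iff)
  have "lie_algebra_axioms (L\<lparr>carrier := S\<rparr>)"
    by unfold_locales
      (simp_all add: bracket_add_left bracket_add_right bracket_smult_left bracket_smult_right
        bracket_self jacobi S' br)
  then show ?thesis using subspace_is_vs[OF S] by (simp add: lie_algebra_def)
qed

lemma subspace_abelian_subgroup:
  assumes S: "VectorSpace.subspace class_ring S L"
  shows "abelian_subgroup S L"
proof -
  have "subgroup S (add_monoid L)"
  proof (rule add.subgroupI)
    show "\<ominus> a \<in> S" if "a \<in> S" for a using subspace_ominus[OF S that] .
  qed (use S in \<open>auto simp: subspace_iff\<close>)
  then show ?thesis
    by (intro abelian_subgroupI3 additive_subgroupI M.abelian_group_axioms)
qed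

end

lemma lie_hom_linear:
  assumes "lie_algebra L" "lie_algebra M" "f \<in> lie_hom L M"
  shows "f \<zero>\<^bsub>L\<^esub> = \<zero>\<^bsub>M\<^esub>"
    and "\<And>x. x \<in> carrier L \<Longrightarrow> f (\<ominus>\<^bsub>L\<^esub> x) = \<ominus>\<^bsub>M\<^esub> f x"
    and "\<And>x y. x \<in> carrier L \<Longrightarrow> y \<in> carrier L \<Longrightarrow> f (x \<ominus>\<^bsub>L\<^esub> y) = f x \<ominus>\<^bsub>M\<^esub> f y"
proof -
  interpret L: lie_algebra L by fact
  interpret M: lie_algebra M by fact
  note f = lie_homD[OF assms(3)]
  show "f \<zero>\<^bsub>L\<^esub> = \<zero>\<^bsub>M\<^esub>" using f(3)[of "\<zero>\<^bsub>L\<^esub>" 0] f(1)[of "\<zero>\<^bsub>L\<^esub>"] by simp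
  show neg: "f (\<ominus>\<^bsub>L\<^esub> x) = \<ominus>\<^bsub>M\<^esub> f x" if "x \<in> carrier L" for x
    using that f(3)[of x "-1"] f(1)[of x] by (simp add: L.smult_neg1 M.smult_neg1)
  show "f (x \<ominus>\<^bsub>L\<^esub> y) = f x \<ominus>\<^bsub>M\<^esub> f y" if "x \<in> carrier L" "y \<in> carrier L" for x y
    using that by (simp add: a_minus_def f(2) neg)
qed

locale lie_algebra_ideal = lie_algebra L
  for L :: "('k::field, 'v, 'm) lie_scheme" (structure) and I :: "'v set" +
  assumes ideal: "lie_ideal I L"
begin

lemma ideal_subspace: "VectorSpace.subspace class_ring I L"
  using ideal by (simp add: lie_ideal_def)

sublocale abelian_subgroup I L
  using ideal_subspace by (rule subspace_abelian_subgroup)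

lemma bracket_ideal_right: "x \<in> carrier L \<Longrightarrow> a \<in> I \<Longrightarrow> \<lblot>x, a\<rblot> \<in> I"
  using ideal by (simp add: lie_ideal_def)

lemma bracket_ideal_left: "x \<in> carrier L \<Longrightarrow> a \<in> I \<Longrightarrow> \<lblot>a, x\<rblot> \<in> I"
  using bracket_ideal_right[of x a] bracket_anticomm[of x a] subspace_ominus[OF ideal_subspace]
    a_subset by auto

lemma coset_eq_iff: "x \<in> carrier L \<Longrightarrow> y \<in> carrier L \<Longrightarrow> I +> x = I +> y \<longleftrightarrow> x \<ominus> y \<in> I"
  using a_rcos_module[of y x] a_rcos_self[of x] a_repr_independence[OF _ _ a_subgroup, of x y]
  by (auto simp: a_minus_def)

lemma coset_zero_iff: "x \<in> carrier L \<Longrightarrow> I +> x = I \<longleftrightarrow> x \<in> I"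
  using a_coset_join1[OF _ _ a_subgroup] a_coset_join2[OF _ a_subgroup] by blast

lemma mem_cosetD:
  assumes "y \<in> I +> x" "x \<in> carrier L"
  shows "y \<in> carrier L" "y \<ominus> x \<in> I"
proof -
  have 1: "I +> x = I +> y" using a_repr_independence[OF assms a_subgroup] .
  show 2: "y \<in> carrier L" using a_r_coset_subset_G[OF a_subset assms(2)] assms(1) by auto
  show "y \<ominus> x \<in> I" using 1 coset_eq_iff[OF 2 assms(2)] by auto
qed

lemma quotient_carrier: "carrier (L /\<^sub>L I) = (\<lambda>x. I +> x) ` carrier L"
  by (auto simp: lie_quotient_def A_RCOSETS_def')

lemma quotient_zero: "\<zero>\<^bsub>L /\<^sub>L I\<^esub> = I"
  by (simp add: lie_quotient_def)

lemma quotient_add: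
  "x \<in> carrier L \<Longrightarrow> y \<in> carrier L \<Longrightarrow> (I +> x) \<oplus>\<^bsub>L /\<^sub>L I\<^esub> (I +> y) = I +> (x \<oplus> y)"
  by (simp add: lie_quotient_def a_rcos_sum)

text \<open>The operations of the quotient are unions over representatives; they are single cosets because all
  representatives give the same one.\<close>

lemma quotient_smult:
  assumes x: "x \<in> carrier L"
  shows "c \<odot>\<^bsub>L /\<^sub>L I\<^esub> (I +> x) = I +> (c \<odot> x)"
proof -
  have "I +> (c \<odot> y) = I +> (c \<odot> x)" if "y \<in> I +> x" for y
  proof -
    note y = mem_cosetD[OF that x]
    have "c \<odot> y \<ominus> c \<odot> x = c \<odot> (y \<ominus> x)"
      using x y by (simp add: a_minus_def smult_oplus smult_ominus)
    also have "\<dots> \<in> I" using y ideal_subspace by (auto simp: subspace_iff)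
    finally show ?thesis using x y by (simp add: coset_eq_iff)
  qed
  then have "(\<Union>y\<in>I +> x. I +> (c \<odot> y)) = I +> (c \<odot> x)"
    by (intro UN_constant_eq[OF a_rcos_self[OF x]] ballI)
  then show ?thesis by (simp add: lie_quotient_def)
qed

lemma quotient_bracket:
  assumes x: "x \<in> carrier L" and y: "y \<in> carrier L"
  shows "\<lblot>I +> x, I +> y\<rblot>\<^bsub>L /\<^sub>L I\<^esub> = I +> \<lblot>x, y\<rblot>"
proof -
  have "I +> \<lblot>x', y'\<rblot> = I +> \<lblot>x, y\<rblot>" if "x' \<in> I +> x" "y' \<in> I +> y" for x' y'
  proof -
    note x' = mem_cosetD[OF that(1) x]
    note y' = mem_cosetD[OF that(2) y]
    have "\<lblot>x', y'\<rblot> \<ominus> \<lblot>x, y'\<rblot> = \<lblot>x' \<ominus> x, y'\<rblot>"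
      using x x' y' by (simp add: a_minus_def bracket_add_left bracket_ominus_left)
    then have 1: "I +> \<lblot>x', y'\<rblot> = I +> \<lblot>x, y'\<rblot>"
      using x x' y' by (simp add: coset_eq_iff bracket_closed bracket_ideal_left)
    have "\<lblot>x, y'\<rblot> \<ominus> \<lblot>x, y\<rblot> = \<lblot>x, y' \<ominus> y\<rblot>"
      using x y y' by (simp add: a_minus_def bracket_add_right bracket_ominus_right)
    then have "I +> \<lblot>x, y'\<rblot> = I +> \<lblot>x, y\<rblot>"
      using x y y' by (simp add: coset_eq_iff bracket_closed bracket_ideal_right)
    with 1 show ?thesis by simp
  qed
  then have "(\<Union>x'\<in>I +> x. \<Union>y'\<in>I +> y. I +> \<lblot>x', y'\<rblot>) = I +> \<lblot>x, y\<rblot>"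
    by (intro UN_constant_eq[OF a_rcos_self[OF x]] UN_constant_eq[OF a_rcos_self[OF y]] ballI)
  then show ?thesis by (simp add: lie_quotient_def)
qed

lemma quotient_lie_algebra: "lie_algebra (L /\<^sub>L I)"
proof (rule lie_algebraI)
  have zero: "\<zero>\<^bsub>L /\<^sub>L I\<^esub> = I +> \<zero>" by (simp add: quotient_zero a_subset)
  have neg: "(- 1) \<odot> x \<oplus> x = \<zero>" if "x \<in> carrier L" for x
    using that by (simp add: smult_neg1 M.l_neg)
  note s = quotient_carrier quotient_add quotient_smult quotient_bracket bracket_closed zero
  show "lie_algebra_axioms (L /\<^sub>L I)"
  proof
  qed (auto simp: s bracket_add_left bracket_add_right bracket_smult_left
      bracket_smult_right bracket_self jacobi)
  show "\<zero>\<^bsub>L /\<^sub>L I\<^esub> \<in> carrier (L /\<^sub>L I)" by (auto simp: s)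
  show "\<zero>\<^bsub>L /\<^sub>L I\<^esub> \<oplus>\<^bsub>L /\<^sub>L I\<^esub> X = X" if "X \<in> carrier (L /\<^sub>L I)" for X
    using that by (auto simp: s)
  show "(- 1) \<odot>\<^bsub>L /\<^sub>L I\<^esub> X \<oplus>\<^bsub>L /\<^sub>L I\<^esub> X = \<zero>\<^bsub>L /\<^sub>L I\<^esub>"
    if "X \<in> carrier (L /\<^sub>L I)" for X
    using that by (auto simp: s neg)
  show "X \<oplus>\<^bsub>L /\<^sub>L I\<^esub> Y = Y \<oplus>\<^bsub>L /\<^sub>L I\<^esub> X"
    if "X \<in> carrier (L /\<^sub>L I)" "Y \<in> carrier (L /\<^sub>L I)" for X Y
    using that M.a_comm by (auto simp: s)
qed (auto simp: quotient_carrier quotient_add quotient_smult quotient_bracket bracket_closed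
    M.a_assoc smult_oplus smult_plus smult_times)

lemma quotient_hom: "(\<lambda>x. I +> x) \<in> lie_hom L (L /\<^sub>L I)"
  by (rule lie_homI) (auto simp: quotient_add quotient_smult quotient_bracket quotient_carrier)

text \<open>A homomorphism that kills the ideal takes one value on each coset.\<close>

lemma quotient_universal:
  assumes M: "lie_algebra M" and f: "f \<in> lie_hom L M" and kill: "\<And>a. a \<in> I \<Longrightarrow> f a = \<zero>\<^bsub>M\<^esub>"
  shows "\<exists>g\<in>lie_hom (L /\<^sub>L I) M. \<forall>x\<in>carrier L. g (I +> x) = f x"
proof -
  interpret M: lie_algebra M by fact
  note fD = lie_homD[OF f]
  have eq: "f y = f x" if "x \<in> carrier L" "y \<in> carrier L" "I +> y = I +> x" for x y
    using that kill[of "y \<ominus> x"] lie_hom_linear(3)[OF lie_algebra_axioms M f, of y x]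
    by (simp add: coset_eq_iff fD(1))
  define g where "g = (\<lambda>X. f (SOME x. x \<in> carrier L \<and> X = I +> x))"
  have g: "g (I +> x) = f x" if x: "x \<in> carrier L" for x
  proof -
    define y where "y = (SOME y. y \<in> carrier L \<and> I +> x = I +> y)"
    have "y \<in> carrier L \<and> I +> x = I +> y"
      unfolding y_def by (rule someI[of _ x]) (simp add: x)
    then have "f y = f x" by (intro eq x) auto
    then show ?thesis by (simp add: g_def y_def)
  qed
  have "g \<in> lie_hom (L /\<^sub>L I) M"
    by (rule lie_homI) (auto simp: quotient_carrier quotient_add quotient_smult quotient_bracket g
      fD bracket_closed)
  with g show ?thesis by blast
qed

end

lemma lie_ideal_ideal_generated:
  fixes L :: "('k::field, 'v, 'm) lie_scheme" (structure)
  assumes "lie_algebra L" "S \<subseteq> carrier L"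
  shows "lie_ideal (ideal_generated L S) L" "S \<subseteq> ideal_generated L S"
proof -
  interpret lie_algebra L by fact
  let ?F = "{I. lie_ideal I L \<and> S \<subseteq> I}"
  have "carrier L \<in> ?F"
    using assms(2) by (auto simp: lie_ideal_def subspace_iff bracket_closed)
  then have "\<Inter>?F \<subseteq> carrier L" by (rule Inter_lower)
  moreover have cl: "\<zero> \<in> I" "\<And>x y. x \<in> I \<Longrightarrow> y \<in> I \<Longrightarrow> x \<oplus> y \<in> I"
    "\<And>c x. x \<in> I \<Longrightarrow> c \<odot> x \<in> I" "\<And>x y. x \<in> carrier L \<Longrightarrow> y \<in> I \<Longrightarrow> \<lblot>x, y\<rblot> \<in> I" if "I \<in> ?F" for I
    using that by (simp_all add: lie_ideal_def subspace_iff)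
  have "\<zero> \<in> \<Inter>?F" by (intro InterI cl)
  moreover have "x \<oplus> y \<in> \<Inter>?F" if "x \<in> \<Inter>?F" "y \<in> \<Inter>?F" for x y
    by (rule InterI, rule cl(2)) (use that in \<open>blast+\<close>)
  moreover have "c \<odot> x \<in> \<Inter>?F" if "x \<in> \<Inter>?F" for c x
    by (rule InterI, rule cl(3)) (use that in \<open>blast+\<close>)
  moreover have "\<lblot>x, y\<rblot> \<in> \<Inter>?F" if "x \<in> carrier L" "y \<in> \<Inter>?F" for x y
    by (rule InterI, rule cl(4)) (use that in \<open>blast+\<close>)
  ultimately show "lie_ideal (ideal_generated L S) L"
    unfolding lie_ideal_def ideal_generated_def subspace_iff by (intro conjI ballI allI)
  show "S \<subseteq> ideal_generated L S" by (auto simp: ideal_generated_def)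
qed

lemma kernel_lie_ideal:
  assumes "lie_algebra L" "lie_algebra M" "f \<in> lie_hom L M"
  shows "lie_ideal {x \<in> carrier L. f x = \<zero>\<^bsub>M\<^esub>} L"
proof -
  interpret L: lie_algebra L by fact
  interpret M: lie_algebra M by fact
  show ?thesis
    by (auto simp: lie_ideal_def L.subspace_iff L.bracket_closed lie_homD[OF assms(3)]
      lie_hom_linear(1)[OF assms])
qed

text \<open>The kernel of a homomorphism is an ideal, so it contains the ideal generated by any subset of it.\<close>

lemma ideal_generated_universal:
  assumes L: "lie_algebra L" and M: "lie_algebra M" and S: "S \<subseteq> carrier L"
    and f: "f \<in> lie_hom L M" and kill: "\<And>a. a \<in> S \<Longrightarrow> f a = \<zero>\<^bsub>M\<^esub>"
  shows "\<exists>g\<in>lie_hom (L /\<^sub>L ideal_generated L S) M.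
    \<forall>x\<in>carrier L. g (ideal_generated L S +>\<^bsub>L\<^esub> x) = f x"
proof -
  interpret lie_algebra_ideal L "ideal_generated L S"
    by (intro lie_algebra_ideal.intro L lie_algebra_ideal_axioms.intro
      lie_ideal_ideal_generated(1)[OF L S])
  let ?K = "{x \<in> carrier L. f x = \<zero>\<^bsub>M\<^esub>}"
  have "S \<subseteq> ?K" using S kill by auto
  then have "?K \<in> {I. lie_ideal I L \<and> S \<subseteq> I}"
    by (intro CollectI conjI kernel_lie_ideal[OF L M f])
  then have "ideal_generated L S \<subseteq> ?K" unfolding ideal_generated_def by (rule Inter_lower)
  then have "f a = \<zero>\<^bsub>M\<^esub>" if "a \<in> ideal_generated L S" for a using that by auto
  then show ?thesis by (rule quotient_universal[OF M f])
qed

section \<open>Free Lie algebras\<close>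

definition free_class :: "'g set \<Rightarrow> ('k::field, 'g) lie_term \<Rightarrow> ('k, 'g) lie_term set" where
  "free_class X t = free_lie_rel X `` {t}"

lemma equiv_free_lie_rel: "equiv {t. gens t \<subseteq> X} (free_lie_rel X)"
proof (rule equivI)
  show "free_lie_rel X \<subseteq> {t. gens t \<subseteq> X} \<times> {t. gens t \<subseteq> X}"
    by (auto simp: free_lie_rel_def)
  show "refl_on {t. gens t \<subseteq> X} (free_lie_rel X)"
    by (rule refl_onI) (auto simp: free_lie_rel_def intro: lie_eq.refl)
  show "Relation.sym (free_lie_rel X)"
    by (rule symI) (auto simp: free_lie_rel_def intro: lie_eq.sym)
  show "Relation.trans (free_lie_rel X)"
    by (rule transI) (auto simp: free_lie_rel_def intro: lie_eq.trans)
qed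

lemma free_class_eq_iff:
  "gens s \<subseteq> X \<Longrightarrow> gens t \<subseteq> X \<Longrightarrow> free_class X s = free_class X t \<longleftrightarrow> lie_eq s t"
  unfolding free_class_def
  by (subst eq_equiv_class_iff[OF equiv_free_lie_rel]) (auto simp: free_lie_rel_def)

lemma free_lie_carrier: "carrier (free_lie X) = free_class X ` {t. gens t \<subseteq> X}"
  by (auto simp: free_lie_def free_class_def Equiv_Relations.quotient_def)

lemma free_lie_zero: "\<zero>\<^bsub>free_lie X\<^esub> = free_class X Zero"
  by (simp add: free_lie_def free_class_def)

lemma free_lie_add:
  assumes "gens s \<subseteq> X" "gens t \<subseteq> X"
  shows "free_class X s \<oplus>\<^bsub>free_lie X\<^esub> free_class X t = free_class X (Add s t)"
proof -
  have "congruent2 (free_lie_rel X) (free_lie_rel X) (\<lambda>s t. free_lie_rel X `` {Add s t})"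
    unfolding congruent2_def free_class_def[symmetric]
    by (auto simp: free_lie_rel_def free_class_eq_iff lie_eq.add_cong
      del: equalityI)
  from UN_equiv_class2[OF equiv_free_lie_rel equiv_free_lie_rel this] assms
  show ?thesis by (simp add: free_lie_def free_class_def)
qed

lemma free_lie_smult:
  assumes "gens s \<subseteq> X"
  shows "c \<odot>\<^bsub>free_lie X\<^esub> free_class X s = free_class X (Smult c s)"
proof -
  have "congruent (free_lie_rel X) (\<lambda>s. free_lie_rel X `` {Smult c s})"
    unfolding congruent_def free_class_def[symmetric]
    by (auto simp: free_lie_rel_def free_class_eq_iff lie_eq.smult_cong del: equalityI)
  from UN_equiv_class[OF equiv_free_lie_rel this] assms
  show ?thesis by (simp add: free_lie_def free_class_def)
qed

lemma free_lie_bracket: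
  assumes "gens s \<subseteq> X" "gens t \<subseteq> X"
  shows "\<lblot>free_class X s, free_class X t\<rblot>\<^bsub>free_lie X\<^esub> = free_class X (Bracket s t)"
proof -
  have "congruent2 (free_lie_rel X) (free_lie_rel X) (\<lambda>s t. free_lie_rel X `` {Bracket s t})"
    unfolding congruent2_def free_class_def[symmetric]
    by (auto simp: free_lie_rel_def free_class_eq_iff lie_eq.bracket_cong
      del: equalityI)
  from UN_equiv_class2[OF equiv_free_lie_rel equiv_free_lie_rel this] assms
  show ?thesis by (simp add: free_lie_def free_class_def)
qed

lemmas free_lie_simps = free_lie_zero free_lie_add free_lie_smult free_lie_bracket

lemma free_lie_algebra: "lie_algebra (free_lie X :: ('k::field, ('k, 'g) lie_term set) lie)"
proof (rule lie_algebraI)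
  note s = free_lie_carrier free_lie_simps free_class_eq_iff
  show "lie_algebra_axioms (free_lie X :: ('k, ('k, 'g) lie_term set) lie)"
    by (unfold_locales; clarsimp simp: s)
      (rule lie_eq.bracket_add_left lie_eq.bracket_add_right lie_eq.bracket_smult_left
        lie_eq.bracket_smult_right lie_eq.bracket_self lie_eq.jacobi)+
qed (auto simp: free_lie_carrier free_lie_simps free_class_eq_iff
    intro: lie_eq.add_assoc lie_eq.add_comm lie_eq.add_zero lie_eq.add_neg lie_eq.smult_add_right
      lie_eq.smult_add_left lie_eq.smult_smult lie_eq.smult_one del: equalityI)

lemma free_gen_class: "free_gen X x = free_class X (Gen x)"
  by (simp add: free_gen_def free_class_def)

lemma free_gen_closed: "x \<in> X \<Longrightarrow> free_gen X x \<in> carrier (free_lie X)"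
  by (auto simp: free_gen_class free_lie_carrier)

lemma free_lie_generated:
  assumes S: "VectorSpace.subspace class_ring S (free_lie X)"
    and br: "\<And>u v. u \<in> S \<Longrightarrow> v \<in> S \<Longrightarrow> \<lblot>u, v\<rblot>\<^bsub>free_lie X\<^esub> \<in> S"
    and gen: "\<And>x. x \<in> X \<Longrightarrow> free_gen X x \<in> S"
  shows "carrier (free_lie X) \<subseteq> S"
proof -
  interpret F: lie_algebra "free_lie X" by (rule free_lie_algebra)
  note S' = S[unfolded F.subspace_iff]
  have "gens t \<subseteq> X \<Longrightarrow> free_class X t \<in> S" for t
  proof (induct t)
    case (Gen x)
    then show ?case using gen by (simp add: free_gen_class)
  next
    case Zero
    then show ?case using S' by (simp add: free_lie_zero)
  next
    case (Add s t)
    then show ?case using S' free_lie_add[of s X t] by (metis Un_subset_iff lie_term.set(3))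
  next
    case (Smult c t)
    then show ?case using S' free_lie_smult[of t X c] by (metis lie_term.set(4))
  next
    case (Bracket s t)
    then show ?case using br free_lie_bracket[of s X t] by (metis Un_subset_iff lie_term.set(5))
  qed
  then show ?thesis by (auto simp: free_lie_carrier)
qed

primrec lie_eval :: "('k::field, 'v, 'm) lie_scheme \<Rightarrow> ('g \<Rightarrow> 'v) \<Rightarrow> ('k, 'g) lie_term \<Rightarrow> 'v" where
  "lie_eval M g (Gen x) = g x"
| "lie_eval M g Zero = \<zero>\<^bsub>M\<^esub>"
| "lie_eval M g (Add s t) = lie_eval M g s \<oplus>\<^bsub>M\<^esub> lie_eval M g t"
| "lie_eval M g (Smult c t) = c \<odot>\<^bsub>M\<^esub> lie_eval M g t"
| "lie_eval M g (Bracket s t) = \<lblot>lie_eval M g s, lie_eval M g t\<rblot>\<^bsub>M\<^esub>"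

context lie_algebra
begin

lemma lie_eval_closed:
  assumes "\<And>x. g x \<in> carrier L"
  shows "lie_eval L g t \<in> carrier L"
  by (induct t) (auto simp: assms bracket_closed)

text \<open>The congruence defining the free Lie algebra is generated by laws valid in every Lie algebra.\<close>

lemma lie_eval_cong:
  assumes g: "\<And>x. g x \<in> carrier L" and "lie_eq s t"
  shows "lie_eval L g s = lie_eval L g t"
  using assms(2)
proof induct
  case (add_comm s t)
  then show ?case by (simp add: M.a_comm lie_eval_closed[OF g])
next
  case (add_neg s)
  then show ?case by (simp add: smult_neg1 M.l_neg lie_eval_closed[OF g])
next
  case (jacobi s t u)
  then show ?case by (simp add: lie_algebra.jacobi[OF lie_algebra_axioms] lie_eval_closed[OF g])
qed (simp_all add: lie_eval_closed[OF g] bracket_closed M.a_assoc smult_oplus smult_plus smult_times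
    bracket_add_left bracket_add_right bracket_smult_left bracket_smult_right bracket_self)

lemma free_lie_universal:
  assumes g: "\<And>x. x \<in> X \<Longrightarrow> g x \<in> carrier L"
  shows "\<exists>f\<in>lie_hom (free_lie X) L. \<forall>x\<in>X. f (free_gen X x) = g x"
proof -
  define g' where "g' = (\<lambda>x. if x \<in> X then g x else \<zero>)"
  have g': "g' x \<in> carrier L" for x using g by (simp add: g'_def)
  define f where "f = (\<lambda>u. lie_eval L g' (SOME t. gens t \<subseteq> X \<and> u = free_class X t))"
  have f: "f (free_class X t) = lie_eval L g' t" if t: "gens t \<subseteq> X" for t
  proof -
    define s where "s = (SOME s. gens s \<subseteq> X \<and> free_class X t = free_class X s)"
    have s: "gens s \<subseteq> X \<and> free_class X t = free_class X s"
      unfolding s_def by (rule someI[of _ t]) (simp add: t)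
    then have "lie_eq t s" using free_class_eq_iff[OF t, of s] by simp
    then have "lie_eval L g' t = lie_eval L g' s" by (rule lie_eval_cong[OF g'])
    then show ?thesis by (simp add: f_def s_def)
  qed
  have "f \<in> lie_hom (free_lie X) L"
    by (rule lie_homI) (auto simp: free_lie_carrier free_lie_simps f lie_eval_closed[OF g'])
  moreover have "f (free_gen X x) = g x" if "x \<in> X" for x
    using that f[of "Gen x"] by (simp add: free_gen_class g'_def)
  ultimately show ?thesis by blast
qed

end

section \<open>The non-abelian tensor square\<close>

context lie_algebra
begin

abbreviation free_tensors :: "('k, ('k, 'v \<times> 'v) lie_term set) lie" where
  "free_tensors \<equiv> free_lie (carrier L \<times> carrier L)"

abbreviation free_tensor :: "'v \<Rightarrow> 'v \<Rightarrow> ('k, 'v \<times> 'v) lie_term set" where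
  "free_tensor x y \<equiv> free_gen (carrier L \<times> carrier L) (x, y)"

lemma free_tensor_closed:
  "x \<in> carrier L \<Longrightarrow> y \<in> carrier L \<Longrightarrow> free_tensor x y \<in> carrier free_tensors"
  by (rule free_gen_closed) simp

lemma tensor_relators_closed: "tensor_relators L \<subseteq> carrier free_tensors"
proof -
  interpret F: lie_algebra free_tensors by (rule free_lie_algebra)
  show ?thesis
    unfolding tensor_relators_def Let_def
    by (auto simp: free_tensor_closed bracket_closed F.bracket_closed)
qed

lemma tensor_lie_ideal: "lie_algebra_ideal free_tensors (tensor_ideal L)"
  unfolding tensor_ideal_def
  by (intro lie_algebra_ideal.intro lie_algebra_ideal_axioms.intro free_lie_algebra
    lie_ideal_ideal_generated(1) tensor_relators_closed)

abbreviation T :: "('k, ('k, 'v \<times> 'v) lie_term set set) lie" where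
  "T \<equiv> tensor_square L"

lemma tensor_square_lie_algebra: "lie_algebra T"
  unfolding tensor_square_def by (rule lie_algebra_ideal.quotient_lie_algebra[OF tensor_lie_ideal])

lemma tensor_projection:
  "(\<lambda>u. tensor_ideal L +>\<^bsub>free_tensors\<^esub> u) \<in> lie_hom free_tensors T"
  unfolding tensor_square_def by (rule lie_algebra_ideal.quotient_hom[OF tensor_lie_ideal])

lemma tensor_closed:
  "x \<in> carrier L \<Longrightarrow> y \<in> carrier L \<Longrightarrow> tensor L x y \<in> carrier T"
  unfolding tensor_def by (rule lie_homD(1)[OF tensor_projection free_tensor_closed])

lemma relator_eq:
  assumes "u \<ominus>\<^bsub>free_tensors\<^esub> v \<in> tensor_relators L"
    and "u \<in> carrier free_tensors" "v \<in> carrier free_tensors"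
  shows "tensor_ideal L +>\<^bsub>free_tensors\<^esub> u = tensor_ideal L +>\<^bsub>free_tensors\<^esub> v"
proof -
  interpret I: lie_algebra_ideal free_tensors "tensor_ideal L" by (rule tensor_lie_ideal)
  have "tensor_relators L \<subseteq> tensor_ideal L"
    unfolding tensor_ideal_def
    by (rule lie_ideal_ideal_generated(2)[OF free_lie_algebra tensor_relators_closed])
  then show ?thesis using assms I.coset_eq_iff[of u v] by blast
qed

lemma tensor_relations:
  shows tensor_add_left: "\<And>x x' y. x \<in> carrier L \<Longrightarrow> x' \<in> carrier L \<Longrightarrow> y \<in> carrier L \<Longrightarrow>
      tensor L (x \<oplus> x') y = tensor L x y \<oplus>\<^bsub>T\<^esub> tensor L x' y"
    and tensor_add_right: "\<And>x y y'. x \<in> carrier L \<Longrightarrow> y \<in> carrier L \<Longrightarrow> y' \<in> carrier L \<Longrightarrow>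
      tensor L x (y \<oplus> y') = tensor L x y \<oplus>\<^bsub>T\<^esub> tensor L x y'"
    and tensor_smult_left: "\<And>c x y. x \<in> carrier L \<Longrightarrow> y \<in> carrier L \<Longrightarrow>
      tensor L (c \<odot> x) y = c \<odot>\<^bsub>T\<^esub> tensor L x y"
    and tensor_smult_right: "\<And>c x y. x \<in> carrier L \<Longrightarrow> y \<in> carrier L \<Longrightarrow>
      tensor L x (c \<odot> y) = c \<odot>\<^bsub>T\<^esub> tensor L x y"
    and tensor_bracket_left: "\<And>x x' y. x \<in> carrier L \<Longrightarrow> x' \<in> carrier L \<Longrightarrow> y \<in> carrier L \<Longrightarrow>
      tensor L \<lblot>x, x'\<rblot> y = tensor L x \<lblot>x', y\<rblot> \<ominus>\<^bsub>T\<^esub> tensor L x' \<lblot>x, y\<rblot>"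
    and tensor_bracket_right: "\<And>x y y'. x \<in> carrier L \<Longrightarrow> y \<in> carrier L \<Longrightarrow> y' \<in> carrier L \<Longrightarrow>
      tensor L x \<lblot>y, y'\<rblot> = tensor L \<lblot>y', x\<rblot> y \<ominus>\<^bsub>T\<^esub> tensor L \<lblot>y, x\<rblot> y'"
    and bracket_tensor: "\<And>x y x' y'. x \<in> carrier L \<Longrightarrow> y \<in> carrier L \<Longrightarrow> x' \<in> carrier L \<Longrightarrow>
      y' \<in> carrier L \<Longrightarrow>
      \<lblot>tensor L x y, tensor L x' y'\<rblot>\<^bsub>T\<^esub> = \<ominus>\<^bsub>T\<^esub> tensor L \<lblot>y, x\<rblot> \<lblot>x', y'\<rblot>"
proof -
  interpret F: lie_algebra free_tensors by (rule free_lie_algebra)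
  note p = lie_homD(2-4)[OF tensor_projection]
    lie_hom_linear(2,3)[OF free_lie_algebra tensor_square_lie_algebra tensor_projection]
  note c = free_tensor_closed bracket_closed F.bracket_closed
  show "tensor L (x \<oplus> x') y = tensor L x y \<oplus>\<^bsub>T\<^esub> tensor L x' y"
    if "x \<in> carrier L" "x' \<in> carrier L" "y \<in> carrier L" for x x' y
  proof -
    have "free_tensor (x \<oplus> x') y \<ominus>\<^bsub>free_tensors\<^esub>
        (free_tensor x y \<oplus>\<^bsub>free_tensors\<^esub> free_tensor x' y) \<in> tensor_relators L"
      unfolding tensor_relators_def Let_def Un_iff 
      by (intro disjI1, rule CollectI, rule exI[of _ x], rule exI[of _ x'], rule exI[of _ y])
        (simp add: that)
    from relator_eq[OF this] show ?thesis using that by (simp add: tensor_def p c)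
  qed
  show "tensor L x (y \<oplus> y') = tensor L x y \<oplus>\<^bsub>T\<^esub> tensor L x y'"
    if "x \<in> carrier L" "y \<in> carrier L" "y' \<in> carrier L" for x y y'
  proof -
    have "free_tensor x (y \<oplus> y') \<ominus>\<^bsub>free_tensors\<^esub>
        (free_tensor x y \<oplus>\<^bsub>free_tensors\<^esub> free_tensor x y') \<in> tensor_relators L"
      unfolding tensor_relators_def Let_def Un_iff using that by blast
    from relator_eq[OF this] show ?thesis using that by (simp add: tensor_def p c)
  qed
  show "tensor L (a \<odot> x) y = a \<odot>\<^bsub>T\<^esub> tensor L x y"
    if "x \<in> carrier L" "y \<in> carrier L" for a x y
  proof -
    have "free_tensor (a \<odot> x) y \<ominus>\<^bsub>free_tensors\<^esub> a \<odot>\<^bsub>free_tensors\<^esub> free_tensor x y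
        \<in> tensor_relators L"
      unfolding tensor_relators_def Let_def Un_iff using that by blast
    from relator_eq[OF this] show ?thesis using that by (simp add: tensor_def p c)
  qed
  show "tensor L x (a \<odot> y) = a \<odot>\<^bsub>T\<^esub> tensor L x y"
    if "x \<in> carrier L" "y \<in> carrier L" for a x y
  proof -
    have "free_tensor x (a \<odot> y) \<ominus>\<^bsub>free_tensors\<^esub> a \<odot>\<^bsub>free_tensors\<^esub> free_tensor x y
        \<in> tensor_relators L"
      unfolding tensor_relators_def Let_def Un_iff using that by blast
    from relator_eq[OF this] show ?thesis using that by (simp add: tensor_def p c)
  qed
  show "tensor L \<lblot>x, x'\<rblot> y = tensor L x \<lblot>x', y\<rblot> \<ominus>\<^bsub>T\<^esub> tensor L x' \<lblot>x, y\<rblot>"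
    if "x \<in> carrier L" "x' \<in> carrier L" "y \<in> carrier L" for x x' y
  proof -
    have "free_tensor \<lblot>x, x'\<rblot> y \<ominus>\<^bsub>free_tensors\<^esub>
        (free_tensor x \<lblot>x', y\<rblot> \<ominus>\<^bsub>free_tensors\<^esub> free_tensor x' \<lblot>x, y\<rblot>) \<in> tensor_relators L"
      unfolding tensor_relators_def Let_def Un_iff using that by blast
    from relator_eq[OF this] show ?thesis using that by (simp add: tensor_def p c)
  qed
  show "tensor L x \<lblot>y, y'\<rblot> = tensor L \<lblot>y', x\<rblot> y \<ominus>\<^bsub>T\<^esub> tensor L \<lblot>y, x\<rblot> y'"
    if "x \<in> carrier L" "y \<in> carrier L" "y' \<in> carrier L" for x y y'
  proof -
    have "free_tensor x \<lblot>y, y'\<rblot> \<ominus>\<^bsub>free_tensors\<^esub>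
        (free_tensor \<lblot>y', x\<rblot> y \<ominus>\<^bsub>free_tensors\<^esub> free_tensor \<lblot>y, x\<rblot> y') \<in> tensor_relators L"
      unfolding tensor_relators_def Let_def Un_iff using that by blast
    from relator_eq[OF this] show ?thesis using that by (simp add: tensor_def p c)
  qed
  show "\<lblot>tensor L x y, tensor L x' y'\<rblot>\<^bsub>T\<^esub> = \<ominus>\<^bsub>T\<^esub> tensor L \<lblot>y, x\<rblot> \<lblot>x', y'\<rblot>"
    if "x \<in> carrier L" "y \<in> carrier L" "x' \<in> carrier L" "y' \<in> carrier L" for x y x' y'
  proof -
    have "\<lblot>free_tensor x y, free_tensor x' y'\<rblot>\<^bsub>free_tensors\<^esub> \<ominus>\<^bsub>free_tensors\<^esub>
        (\<ominus>\<^bsub>free_tensors\<^esub> free_tensor \<lblot>y, x\<rblot> \<lblot>x', y'\<rblot>) \<in> tensor_relators L"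
      unfolding tensor_relators_def Let_def Un_iff using that by blast
    from relator_eq[OF this] show ?thesis using that by (simp add: tensor_def p c)
  qed
qed

text \<open>The conditions on \<open>h\<close> say precisely that the homomorphism from the free Lie algebra extending \<open>h\<close>
  kills every relator.\<close>

lemma tensor_square_universal:
  fixes M :: "('k, 'w, 'n) lie_scheme"
  assumes M: "lie_algebra M"
    and h: "\<And>x y. x \<in> carrier L \<Longrightarrow> y \<in> carrier L \<Longrightarrow> h x y \<in> carrier M"
    and add_l: "\<And>x x' y. x \<in> carrier L \<Longrightarrow> x' \<in> carrier L \<Longrightarrow> y \<in> carrier L \<Longrightarrow>
      h (x \<oplus> x') y = h x y \<oplus>\<^bsub>M\<^esub> h x' y"
    and add_r: "\<And>x y y'. x \<in> carrier L \<Longrightarrow> y \<in> carrier L \<Longrightarrow> y' \<in> carrier L \<Longrightarrow>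
      h x (y \<oplus> y') = h x y \<oplus>\<^bsub>M\<^esub> h x y'"
    and smult_l: "\<And>c x y. x \<in> carrier L \<Longrightarrow> y \<in> carrier L \<Longrightarrow> h (c \<odot> x) y = c \<odot>\<^bsub>M\<^esub> h x y"
    and smult_r: "\<And>c x y. x \<in> carrier L \<Longrightarrow> y \<in> carrier L \<Longrightarrow> h x (c \<odot> y) = c \<odot>\<^bsub>M\<^esub> h x y"
    and bracket_l: "\<And>x x' y. x \<in> carrier L \<Longrightarrow> x' \<in> carrier L \<Longrightarrow> y \<in> carrier L \<Longrightarrow>
      h \<lblot>x, x'\<rblot> y = h x \<lblot>x', y\<rblot> \<ominus>\<^bsub>M\<^esub> h x' \<lblot>x, y\<rblot>"
    and bracket_r: "\<And>x y y'. x \<in> carrier L \<Longrightarrow> y \<in> carrier L \<Longrightarrow> y' \<in> carrier L \<Longrightarrow>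
      h x \<lblot>y, y'\<rblot> = h \<lblot>y', x\<rblot> y \<ominus>\<^bsub>M\<^esub> h \<lblot>y, x\<rblot> y'"
    and bracket_h: "\<And>x y x' y'. x \<in> carrier L \<Longrightarrow> y \<in> carrier L \<Longrightarrow> x' \<in> carrier L \<Longrightarrow>
      y' \<in> carrier L \<Longrightarrow> \<lblot>h x y, h x' y'\<rblot>\<^bsub>M\<^esub> = \<ominus>\<^bsub>M\<^esub> h \<lblot>y, x\<rblot> \<lblot>x', y'\<rblot>"
  shows "\<exists>f\<in>lie_hom T M. \<forall>x\<in>carrier L. \<forall>y\<in>carrier L. f (tensor L x y) = h x y"
proof -
  interpret F: lie_algebra free_tensors by (rule free_lie_algebra)
  interpret M: lie_algebra M by (rule M)
  obtain f where f: "f \<in> lie_hom free_tensors M"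
      "\<And>x y. x \<in> carrier L \<Longrightarrow> y \<in> carrier L \<Longrightarrow> f (free_tensor x y) = h x y"
    using M.free_lie_universal[of "carrier L \<times> carrier L" "\<lambda>(x, y). h x y"] h by auto
  note p = lie_homD(2-4)[OF f(1)] lie_hom_linear(2,3)[OF free_lie_algebra M f(1)] f(2)
  note c = free_tensor_closed bracket_closed F.bracket_closed
  have minus: "f (u \<ominus>\<^bsub>free_tensors\<^esub> v) = \<zero>\<^bsub>M\<^esub>"
    if "u \<in> carrier free_tensors" "v \<in> carrier free_tensors" "f u = f v" for u v
    using that lie_homD(1)[OF f(1)] by (simp add: p)
  have "f r = \<zero>\<^bsub>M\<^esub>" if "r \<in> tensor_relators L" for r
    using that unfolding tensor_relators_def Let_def
    by (elim UnE CollectE exE conjE; hypsubst; intro minus)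
      (simp_all add: p c add_l add_r smult_l smult_r bracket_l[symmetric] bracket_r[symmetric]
        bracket_h M.bracket_closed)
  from ideal_generated_universal[OF free_lie_algebra M tensor_relators_closed f(1) this]
  obtain g where "g \<in> lie_hom T M"
    "\<forall>u\<in>carrier free_tensors. g (tensor_ideal L +>\<^bsub>free_tensors\<^esub> u) = f u"
    unfolding tensor_square_def tensor_ideal_def by blast
  then show ?thesis using f(2) free_tensor_closed unfolding tensor_def by metis
qed

text \<open>The bracket of two tensors is minus a tensor, so the linear span of the tensors is already
  closed under brackets.\<close>

lemma tensor_square_spanned:
  assumes S: "VectorSpace.subspace class_ring S T"
    and gen: "\<And>x y. x \<in> carrier L \<Longrightarrow> y \<in> carrier L \<Longrightarrow> tensor L x y \<in> S"
  shows "carrier T \<subseteq> S"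
proof -
  interpret T: lie_algebra T by (rule tensor_square_lie_algebra)
  interpret F: lie_algebra free_tensors by (rule free_lie_algebra)
  define G where "G = {tensor L x y | x y. x \<in> carrier L \<and> y \<in> carrier L}"
  have G: "G \<subseteq> carrier T" by (auto simp: G_def tensor_closed)
  let ?D = "T.span G"
  have D: "VectorSpace.subspace class_ring ?D T" by (rule T.span_is_subspace[OF G])
  note D' = D[unfolded T.subspace_iff]
  have GD: "G \<subseteq> ?D" by (rule T.in_own_span[OF G])
  have least: "?D \<subseteq> S'" if "VectorSpace.subspace class_ring S' T" "G \<subseteq> S'" for S'
    using T.span_is_subset[OF that(2)] that(1) by simp
  have 1: "?D \<subseteq> {u \<in> carrier T. \<lblot>u, g\<rblot>\<^bsub>T\<^esub> \<in> ?D}" if g: "g \<in> G" for g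
  proof (rule least)
    have gT: "g \<in> carrier T" using G g by auto
    show "VectorSpace.subspace class_ring
        {u \<in> carrier T. \<lblot>u, g\<rblot>\<^bsub>T\<^esub> \<in> ?D} T"
      unfolding T.subspace_iff using D' gT
      by (simp add: T.bracket_add_left T.bracket_smult_left)
    have "\<lblot>u, g\<rblot>\<^bsub>T\<^esub> \<in> ?D" if u: "u \<in> G" for u
    proof -
      obtain x y where xy: "x \<in> carrier L" "y \<in> carrier L" "u = tensor L x y"
        using u by (auto simp: G_def)
      obtain x' y' where xy': "x' \<in> carrier L" "y' \<in> carrier L" "g = tensor L x' y'"
        using g by (auto simp: G_def)
      have "tensor L \<lblot>y, x\<rblot> \<lblot>x', y'\<rblot> \<in> G"
        using bracket_closed[OF xy(2,1)] bracket_closed[OF xy'(1,2)] unfolding G_def by blast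
      then have "tensor L \<lblot>y, x\<rblot> \<lblot>x', y'\<rblot> \<in> ?D" using GD by (rule rev_subsetD)
      then show ?thesis using xy xy' by (simp add: bracket_tensor T.subspace_ominus[OF D])
    qed
    then show "G \<subseteq> {u \<in> carrier T. \<lblot>u, g\<rblot>\<^bsub>T\<^esub> \<in> ?D}"
      using G by auto
  qed
  have 2: "?D \<subseteq> {v \<in> carrier T. \<lblot>u, v\<rblot>\<^bsub>T\<^esub> \<in> ?D}"
    if u: "u \<in> ?D" for u
  proof (rule least)
    have uT: "u \<in> carrier T" using D' u by auto
    show "VectorSpace.subspace class_ring
        {v \<in> carrier T. \<lblot>u, v\<rblot>\<^bsub>T\<^esub> \<in> ?D} T"
      unfolding T.subspace_iff using D' uT
      by (simp add: T.bracket_add_right T.bracket_smult_right)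
    show "G \<subseteq> {v \<in> carrier T. \<lblot>u, v\<rblot>\<^bsub>T\<^esub> \<in> ?D}"
      using 1 u G by blast
  qed
  let ?p = "\<lambda>u. tensor_ideal L +>\<^bsub>free_tensors\<^esub> u"
  let ?E = "{u \<in> carrier free_tensors. ?p u \<in> ?D}"
  note p = lie_homD[OF tensor_projection]
  have "carrier free_tensors \<subseteq> ?E"
  proof (rule free_lie_generated)
    have "?p \<zero>\<^bsub>free_tensors\<^esub> = \<zero>\<^bsub>T\<^esub>"
      by (rule lie_hom_linear(1)[OF free_lie_algebra tensor_square_lie_algebra tensor_projection])
    then show "VectorSpace.subspace class_ring ?E free_tensors"
      unfolding F.subspace_iff using D' by (simp add: p)
    show "\<lblot>u, v\<rblot>\<^bsub>free_tensors\<^esub> \<in> ?E" if "u \<in> ?E" "v \<in> ?E" for u v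
      using that 2 by (auto simp: p F.bracket_closed)
    show "free_gen (carrier L \<times> carrier L) xy \<in> ?E" if "xy \<in> carrier L \<times> carrier L" for xy
      using that GD free_tensor_closed by (auto simp: G_def tensor_def)
  qed
  moreover have "carrier T = ?p ` carrier free_tensors"
    unfolding tensor_square_def by (rule lie_algebra_ideal.quotient_carrier[OF tensor_lie_ideal])
  ultimately have "carrier T \<subseteq> ?D" by auto
  also have "?D \<subseteq> S" using gen by (intro least[OF S]) (auto simp: G_def)
  finally show ?thesis .
qed

end

section \<open>Derived algebra, commutator map and abelian Lie algebras\<close>

context lie_algebra
begin

lemma derived_subspace: "VectorSpace.subspace class_ring (lie_derived L) L"
  unfolding lie_derived_def by (rule span_is_subspace) (auto simp: bracket_closed)

lemma bracket_in_derived: "x \<in> carrier L \<Longrightarrow> y \<in> carrier L \<Longrightarrow> \<lblot>x, y\<rblot> \<in> lie_derived L"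
proof -
  assume "x \<in> carrier L" "y \<in> carrier L"
  moreover have "{\<lblot>x, y\<rblot> | x y. x \<in> carrier L \<and> y \<in> carrier L} \<subseteq> lie_derived L"
    unfolding lie_derived_def by (rule in_own_span) (auto simp: bracket_closed)
  ultimately show "\<lblot>x, y\<rblot> \<in> lie_derived L" by blast
qed

lemma derived_least:
  assumes "VectorSpace.subspace class_ring S L"
    and "\<And>x y. x \<in> carrier L \<Longrightarrow> y \<in> carrier L \<Longrightarrow> \<lblot>x, y\<rblot> \<in> S"
  shows "lie_derived L \<subseteq> S"
  unfolding lie_derived_def by (rule span_is_subset) (use assms in auto)

lemma derived_closed: "x \<in> lie_derived L \<Longrightarrow> x \<in> carrier L"
  using derived_subspace by (auto simp: subspace_iff)

lemma derived_lie_algebra: "lie_algebra (L\<lparr>carrier := lie_derived L\<rparr>)"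
  by (rule subalgebra[OF derived_subspace]) (auto intro: bracket_in_derived derived_closed)

lemma subspace_a_inv:
  assumes "VectorSpace.subspace class_ring S L" "x \<in> S"
  shows "\<ominus>\<^bsub>L\<lparr>carrier := S\<rparr>\<^esub> x = \<ominus> x"
proof -
  interpret S: space "L\<lparr>carrier := S\<rparr>" by (rule subspace_space[OF assms(1)])
  have "x \<in> carrier L" using assms by (auto simp: subspace_iff)
  then show ?thesis using S.smult_neg1[of x] smult_neg1[of x] assms(2) by simp
qed

text \<open>For \<open>h x y = [x, y]\<close> the two bracket relations of the tensor square are forms of the Jacobi
  identity, and the relation for brackets of tensors is antisymmetry.\<close>

lemma commutator_map_exists:
  "\<exists>f\<in>lie_hom T (L\<lparr>carrier := lie_derived L\<rparr>).
     \<forall>x\<in>carrier L. \<forall>y\<in>carrier L. f (tensor L x y) = \<lblot>x, y\<rblot>"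
proof (rule tensor_square_universal[OF derived_lie_algebra])
  note inv = subspace_a_inv[OF derived_subspace bracket_in_derived]
  note c = bracket_closed bracket_in_derived
  show "\<lblot>\<lblot>x, x'\<rblot>, y\<rblot> = \<lblot>x, \<lblot>x', y\<rblot>\<rblot> \<ominus>\<^bsub>L\<lparr>carrier := lie_derived L\<rparr>\<^esub> \<lblot>x', \<lblot>x, y\<rblot>\<rblot>"
    if "x \<in> carrier L" "x' \<in> carrier L" "y \<in> carrier L" for x x' y
  proof -
    have "\<lblot>x, \<lblot>x', y\<rblot>\<rblot> \<ominus> \<lblot>x', \<lblot>x, y\<rblot>\<rblot> \<ominus> \<lblot>\<lblot>x, x'\<rblot>, y\<rblot> = \<zero>"
      using jacobi[of x x' y] bracket_anticomm[of x y] bracket_anticomm[of "\<lblot>x, x'\<rblot>" y] that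
      by (simp add: c bracket_ominus_right a_minus_def)
    then have "\<lblot>x, \<lblot>x', y\<rblot>\<rblot> \<ominus> \<lblot>x', \<lblot>x, y\<rblot>\<rblot> = \<lblot>\<lblot>x, x'\<rblot>, y\<rblot>"
      by (subst (asm) minus_other_side) (simp_all add: c that)
    then show ?thesis using that by (simp add: c a_minus_def inv)
  qed
  show "\<lblot>x, \<lblot>y, y'\<rblot>\<rblot> = \<lblot>\<lblot>y', x\<rblot>, y\<rblot> \<ominus>\<^bsub>L\<lparr>carrier := lie_derived L\<rparr>\<^esub> \<lblot>\<lblot>y, x\<rblot>, y'\<rblot>"
    if "x \<in> carrier L" "y \<in> carrier L" "y' \<in> carrier L" for x y y'
  proof -
    have "\<lblot>x, \<lblot>y, y'\<rblot>\<rblot> \<oplus> \<ominus> \<lblot>\<lblot>y', x\<rblot>, y\<rblot> \<oplus> \<lblot>\<lblot>y, x\<rblot>, y'\<rblot> = \<zero>"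
      using jacobi[of x y y'] bracket_anticomm[of y x] bracket_anticomm[of "\<lblot>y', x\<rblot>" y]
        bracket_anticomm[of "\<lblot>y, x\<rblot>" y'] that
      by (simp add: c bracket_ominus_right)
    then have "\<lblot>x, \<lblot>y, y'\<rblot>\<rblot> \<ominus> (\<lblot>\<lblot>y', x\<rblot>, y\<rblot> \<ominus> \<lblot>\<lblot>y, x\<rblot>, y'\<rblot>) = \<zero>"
      using that by (simp add: c a_minus_def M.minus_add M.a_assoc)
    then have "\<lblot>x, \<lblot>y, y'\<rblot>\<rblot> = \<lblot>\<lblot>y', x\<rblot>, y\<rblot> \<ominus> \<lblot>\<lblot>y, x\<rblot>, y'\<rblot>"
      by (subst (asm) minus_other_side) (simp_all add: c that)
    then show ?thesis using that by (simp add: c a_minus_def inv)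
  qed
  show "\<lblot>\<lblot>x, y\<rblot>, \<lblot>x', y'\<rblot>\<rblot>\<^bsub>L\<lparr>carrier := lie_derived L\<rparr>\<^esub> =
      \<ominus>\<^bsub>L\<lparr>carrier := lie_derived L\<rparr>\<^esub> \<lblot>\<lblot>y, x\<rblot>, \<lblot>x', y'\<rblot>\<rblot>"
    if "x \<in> carrier L" "y \<in> carrier L" "x' \<in> carrier L" "y' \<in> carrier L" for x y x' y'
    using that bracket_anticomm[of y x] by (simp add: c inv bracket_ominus_left)
qed (simp_all add: bracket_in_derived bracket_add_left bracket_add_right bracket_smult_left
    bracket_smult_right)

text \<open>The definite description in the definition of the commutator map is justified by uniqueness, which
  holds because the tensors span.\<close>

lemma commutator_map:
  shows commutator_map_hom:
      "commutator_map L \<in> lie_hom T (L\<lparr>carrier := lie_derived L\<rparr>)"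
    and commutator_map_tensor:
      "\<And>x y. x \<in> carrier L \<Longrightarrow> y \<in> carrier L \<Longrightarrow> commutator_map L (tensor L x y) = \<lblot>x, y\<rblot>"
proof -
  let ?D = "L\<lparr>carrier := lie_derived L\<rparr>"
  interpret T: lie_algebra T by (rule tensor_square_lie_algebra)
  let ?P = "\<lambda>f. f \<in> lie_hom T ?D \<and> f \<in> extensional (carrier T) \<and>
    (\<forall>x\<in>carrier L. \<forall>y\<in>carrier L. f (tensor L x y) = \<lblot>x, y\<rblot>)"
  obtain f where f: "f \<in> lie_hom T ?D"
    "\<And>x y. x \<in> carrier L \<Longrightarrow> y \<in> carrier L \<Longrightarrow> f (tensor L x y) = \<lblot>x, y\<rblot>"
    using commutator_map_exists by blast
  let ?f = "restrict f (carrier T)"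
  have "?f \<in> lie_hom T ?D"
    by (rule lie_homI) (use lie_homD[OF f(1)] T.bracket_closed in auto)
  then have ex: "?P ?f" using f(2) by (auto simp: tensor_closed)
  moreover have "g = ?f" if g: "?P g" for g
  proof (rule extensionalityI[of _ "carrier T"])
    have hom: "g \<in> lie_hom T ?D" "f \<in> lie_hom T ?D" using g f by auto
    have "g \<zero>\<^bsub>T\<^esub> = f \<zero>\<^bsub>T\<^esub>"
      using lie_hom_linear(1)[OF T.lie_algebra_axioms derived_lie_algebra] hom by metis
    then have "VectorSpace.subspace class_ring {u \<in> carrier T. g u = f u}
        T"
      unfolding T.subspace_iff by (simp add: lie_homD[OF hom(1)] lie_homD[OF hom(2)])
    then have "carrier T \<subseteq> {u \<in> carrier T. g u = f u}"
      by (rule tensor_square_spanned) (use g f(2) tensor_closed in auto)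
    then show "g u = ?f u" if "u \<in> carrier T" for u using that by auto
  qed (use g in auto)
  ultimately have "\<exists>!f. ?P f" by blast
  then have "?P (commutator_map L)" unfolding commutator_map_def by (rule theI')
  then show "commutator_map L \<in> lie_hom T ?D"
    "\<And>x y. x \<in> carrier L \<Longrightarrow> y \<in> carrier L \<Longrightarrow> commutator_map L (tensor L x y) = \<lblot>x, y\<rblot>"
    by blast+
qed

end

text \<open>The field as an abelian Lie algebra of dimension one. Homomorphisms into it are the linear forms
  vanishing on brackets, so the universal properties yield coordinate functions.\<close>

definition scalar_lie :: "('k::field, 'k) lie" where
  "scalar_lie = \<lparr>carrier = UNIV, mult = undefined, one = undefined, zero = 0, add = (+),
     smult = (*), bracket = (\<lambda>_ _. 0)\<rparr>"

lemma scalar_lie_simps [simp]: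
  "carrier scalar_lie = UNIV" "zero scalar_lie = 0" "add scalar_lie = (+)"
  "smult scalar_lie = (*)" "bracket scalar_lie = (\<lambda>_ _. 0)"
  by (simp_all add: scalar_lie_def)

lemma scalar_lie_algebra: "lie_algebra (scalar_lie :: ('k::field, 'k) lie)"
proof (rule lie_algebraI)
  show "lie_algebra_axioms (scalar_lie :: ('k, 'k) lie)" by unfold_locales auto
qed (auto simp: algebra_simps)

lemma scalar_lie_a_inv [simp]: "a_inv scalar_lie = uminus" "a_minus scalar_lie = (-)"
proof -
  interpret lie_algebra scalar_lie by (rule scalar_lie_algebra)
  show 1: "a_inv scalar_lie = uminus" 
  proof
    show "\<ominus>\<^bsub>scalar_lie\<^esub> x = - x" for x using smult_neg1[of x] by simp
  qed
  show "a_minus scalar_lie = (-)" by (auto simp: fun_eq_iff a_minus_def 1)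
qed

lemma lie_hom_scalar_iff:
  "f \<in> lie_hom L scalar_lie \<longleftrightarrow>
     linear_form L f \<and> (\<forall>x\<in>carrier L. \<forall>y\<in>carrier L. f \<lblot>x, y\<rblot>\<^bsub>L\<^esub> = 0)"
  by (auto simp: lie_hom_def LinearCombinations.module_hom_def linear_form_def)

lemma abelian_lie_simps:
  "carrier (abelian_lie n) = carrier_vec n" "add (abelian_lie n) = (+)"
  "smult (abelian_lie n) = (\<cdot>\<^sub>v)" "bracket (abelian_lie n) = (\<lambda>_ _. 0\<^sub>v n)"
  by (simp_all add: abelian_lie_def module.extend_def lie.fields_def module_vec_def)

lemma (in lie_algebra) isomorphic_abelian_lie:
  assumes B: "coordinate_system L B t c"
    and ab: "\<And>x y. x \<in> carrier L \<Longrightarrow> y \<in> carrier L \<Longrightarrow> \<lblot>x, y\<rblot> = \<zero>"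
  shows "L \<cong>\<^sub>L abelian_lie (card B)"
proof -
  let ?n = "card B"
  have "finite B" using B by (simp add: coordinate_system_def)
  then obtain h where "bij_betw h {..<?n} B"
    using ex_bij_betw_nat_finite lessThan_atLeast0 by metis
  from coordinate_system_reindex[OF B this]
  obtain t' c' where C: "coordinate_system L {..<?n} t' c'" by blast
  then have t: "t' i \<in> carrier L" and c: "linear_form L (c' i)" if "i < ?n" for i
    using that by (auto simp: coordinate_system_def)
  define f where "f = (\<lambda>x. vec ?n (\<lambda>i. c' i x))"
  have "f \<in> lie_hom L (abelian_lie ?n)"
    by (rule lie_homI)
      (auto simp: f_def abelian_lie_simps ab linear_form_add[OF c] linear_form_smult[OF c]
        linear_form_zero[OF c])
  moreover have "bij_betw f (carrier L) (carrier_vec ?n)"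
    unfolding bij_betw_def
  proof
    show "inj_on f (carrier L)"
    proof (rule inj_onI)
      fix x y assume xy: "x \<in> carrier L" "y \<in> carrier L" "f x = f y"
      have "c' i (x \<ominus> y) = 0" if i: "i < ?n" for i
      proof -
        have "f x $ i = f y $ i" using xy(3) by simp
        then show ?thesis using i xy linear_form_minus[OF c[OF i]] by (simp add: f_def)
      qed
      then have "x \<ominus> y = \<zero>" using C xy by (auto simp: coordinate_system_def)
      then show "x = y" using xy by simp
    qed
    have "v \<in> f ` carrier L" if v: "v \<in> carrier_vec ?n" for v
    proof -
      let ?x = "\<Oplus>i\<in>{..<?n}. v $ i \<odot> t' i"
      have "c' i ?x = v $ i" if i: "i < ?n" for i
      proof -
        have "c' i ?x = (\<Sum>j<?n. v $ j * c' i (t' j))"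
          by (rule linear_form_finsum[OF c[OF i]]) (use t in auto)
        also have "\<dots> = (\<Sum>j<?n. if i = j then v $ j else 0)"
          using C i by (intro sum.cong) (auto simp: coordinate_system_def)
        also have "\<dots> = v $ i" using i by simp
        finally show ?thesis .
      qed
      then have "f ?x = v" using v by (intro eq_vecI) (auto simp: f_def)
      moreover have "?x \<in> carrier L" using t by (intro finsum_closed) auto
      ultimately show ?thesis by (metis image_eqI)
    qed
    then show "f ` carrier L = carrier_vec ?n" by (auto simp: f_def)
  qed
  ultimately show ?thesis unfolding lie_isomorphic_def abelian_lie_simps(1) by blast
qed

section \<open>Tensor squares of Lie algebras of class two\<close>

locale class_two = lie_algebra L for L :: "('k::field, 'v, 'm) lie_scheme" (structure) +
  assumes bracket_bracket:
    "x \<in> carrier L \<Longrightarrow> y \<in> carrier L \<Longrightarrow> z \<in> carrier L \<Longrightarrow> \<lblot>\<lblot>x, y\<rblot>, z\<rblot> = \<zero>"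
begin

lemma bracket_bracket_right:
  "x \<in> carrier L \<Longrightarrow> y \<in> carrier L \<Longrightarrow> z \<in> carrier L \<Longrightarrow> \<lblot>z, \<lblot>x, y\<rblot>\<rblot> = \<zero>"
  using bracket_anticomm[of "\<lblot>x, y\<rblot>" z] by (simp add: bracket_bracket bracket_closed)

lemma tensor_zero_left: "x \<in> carrier L \<Longrightarrow> tensor L \<zero> x = \<zero>\<^bsub>T\<^esub>"
proof -
  interpret T: lie_algebra T by (rule tensor_square_lie_algebra)
  show "x \<in> carrier L \<Longrightarrow> tensor L \<zero> x = \<zero>\<^bsub>T\<^esub>"
    using tensor_smult_left[of \<zero> x 0] tensor_closed[of \<zero> x] by simp
qed

lemma tensor_zero_right: "x \<in> carrier L \<Longrightarrow> tensor L x \<zero> = \<zero>\<^bsub>T\<^esub>"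
proof -
  interpret T: lie_algebra T by (rule tensor_square_lie_algebra)
  show "x \<in> carrier L \<Longrightarrow> tensor L x \<zero> = \<zero>\<^bsub>T\<^esub>"
    using tensor_smult_right[of x \<zero> 0] tensor_closed[of x \<zero>] by simp
qed

lemma tensor_ominus_right:
  "x \<in> carrier L \<Longrightarrow> y \<in> carrier L \<Longrightarrow> tensor L x (\<ominus> y) = \<ominus>\<^bsub>T\<^esub> tensor L x y"
proof -
  interpret T: lie_algebra T by (rule tensor_square_lie_algebra)
  show "x \<in> carrier L \<Longrightarrow> y \<in> carrier L \<Longrightarrow> tensor L x (\<ominus> y) = \<ominus>\<^bsub>T\<^esub> tensor L x y"
    using tensor_smult_right[of x y "-1"] by (simp add: smult_neg1 T.smult_neg1 tensor_closed)
qed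

text \<open>Expanding the left factor by the first bracket relation brackets the right factor, which is
  central.\<close>

lemma tensor_bracket_bracket:
  assumes "x \<in> carrier L" "y \<in> carrier L" "x' \<in> carrier L" "y' \<in> carrier L"
  shows "tensor L \<lblot>x, y\<rblot> \<lblot>x', y'\<rblot> = \<zero>\<^bsub>T\<^esub>"
proof -
  interpret T: lie_algebra T by (rule tensor_square_lie_algebra)
  show ?thesis
    using tensor_bracket_left[of x y "\<lblot>x', y'\<rblot>"] assms
    by (simp add: bracket_closed bracket_bracket_right tensor_zero_right)
qed

text \<open>The bracket of two tensors is minus a tensor of two brackets, hence zero.\<close>

lemma tensor_square_abelian:
  assumes u: "u \<in> carrier T" and v: "v \<in> carrier T"
  shows "\<lblot>u, v\<rblot>\<^bsub>T\<^esub> = \<zero>\<^bsub>T\<^esub>"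
proof -
  interpret T: lie_algebra T by (rule tensor_square_lie_algebra)
  let ?K = "\<lambda>v. {u \<in> carrier T. \<lblot>u, v\<rblot>\<^bsub>T\<^esub> = \<zero>\<^bsub>T\<^esub>}"
  have K: "VectorSpace.subspace class_ring (?K v) T"
    if "v \<in> carrier T" for v
    using that unfolding T.subspace_iff by (simp add: T.bracket_add_left T.bracket_smult_left)
  have 1: "\<lblot>u, tensor L x y\<rblot>\<^bsub>T\<^esub> = \<zero>\<^bsub>T\<^esub>"
    if "u \<in> carrier T" "x \<in> carrier L" "y \<in> carrier L" for u x y
  proof -
    have "carrier T \<subseteq> ?K (tensor L x y)"
      by (rule tensor_square_spanned[OF K])
        (use that in \<open>auto simp: tensor_closed bracket_tensor tensor_bracket_bracket\<close>)
    then show ?thesis using that by auto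
  qed
  have "carrier T \<subseteq> ?K u"
    by (rule tensor_square_spanned[OF K[OF u]])
      (use u 1 T.bracket_anticomm[of u] in \<open>auto simp: tensor_closed\<close>)
  then have "\<lblot>v, u\<rblot>\<^bsub>T\<^esub> = \<zero>\<^bsub>T\<^esub>" using v by auto
  then show ?thesis using T.bracket_anticomm[of v u] u v by simp
qed

text \<open>Rewriting \<open>x \<otimes> [a, b]\<close> with the second bracket relation and the result with the first one
  gives \<open>x \<otimes> [a, b]\<close> back, plus the cyclic sum, which therefore vanishes in every characteristic.\<close>

lemma tensor_jacobi:
  assumes "x \<in> carrier L" "a \<in> carrier L" "b \<in> carrier L"
  shows "tensor L x \<lblot>a, b\<rblot> \<oplus>\<^bsub>T\<^esub> tensor L a \<lblot>b, x\<rblot> \<oplus>\<^bsub>T\<^esub>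
    tensor L b \<lblot>x, a\<rblot> = \<zero>\<^bsub>T\<^esub>"
proof -
  interpret T: lie_algebra T by (rule tensor_square_lie_algebra)
  let ?X = "tensor L x \<lblot>a, b\<rblot>" and ?A = "tensor L a \<lblot>b, x\<rblot>" and ?B = "tensor L b \<lblot>x, a\<rblot>"
  have c: "?X \<in> carrier T" "?A \<in> carrier T"
    "?B \<in> carrier T"
    using assms by (auto simp: tensor_closed bracket_closed)
  have 1: "tensor L \<lblot>b, x\<rblot> a = ?B \<oplus>\<^bsub>T\<^esub> ?X"
    using tensor_bracket_left[of b x a] assms bracket_anticomm[of a b]
    by (simp add: bracket_closed tensor_ominus_right tensor_closed a_minus_def)
  have 2: "tensor L \<lblot>a, x\<rblot> b = \<ominus>\<^bsub>T\<^esub> (?A \<oplus>\<^bsub>T\<^esub> ?X)"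
    using tensor_bracket_left[of a x b] assms bracket_anticomm[of b x] c
    by (simp add: bracket_closed tensor_ominus_right tensor_closed a_minus_def T.M.minus_add)
  have "?X = (?B \<oplus>\<^bsub>T\<^esub> ?X) \<oplus>\<^bsub>T\<^esub> (?A \<oplus>\<^bsub>T\<^esub> ?X)"
    using tensor_bracket_right[of x a b] assms c by (simp add: 1 2 a_minus_def)
  also have "\<dots> = ?X \<oplus>\<^bsub>T\<^esub> (?X \<oplus>\<^bsub>T\<^esub> ?A \<oplus>\<^bsub>T\<^esub> ?B)"
    using c by (simp add: T.M.a_ac)
  finally show ?thesis using c T.M.add.r_cancel_one'[of ?X] by simp
qed

text \<open>The first bracket relation expresses \<open>[a, b] \<otimes> x\<close> by the other two terms of the cyclic sum.\<close>

lemma tensor_bracket_swap: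
  assumes "x \<in> carrier L" "a \<in> carrier L" "b \<in> carrier L"
  shows "tensor L \<lblot>a, b\<rblot> x = \<ominus>\<^bsub>T\<^esub> tensor L x \<lblot>a, b\<rblot>"
proof -
  interpret T: lie_algebra T by (rule tensor_square_lie_algebra)
  let ?X = "tensor L x \<lblot>a, b\<rblot>" and ?A = "tensor L a \<lblot>b, x\<rblot>" and ?B = "tensor L b \<lblot>x, a\<rblot>"
  have c: "?X \<in> carrier T" "?A \<in> carrier T"
    "?B \<in> carrier T"
    using assms by (auto simp: tensor_closed bracket_closed)
  have "tensor L \<lblot>a, b\<rblot> x = ?A \<oplus>\<^bsub>T\<^esub> ?B"
    using tensor_bracket_left[of a b x] assms bracket_anticomm[of x a]
    by (simp add: bracket_closed tensor_ominus_right tensor_closed a_minus_def)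
  then show ?thesis
    using tensor_jacobi[OF assms] c T.M.minus_equality[of "?A \<oplus>\<^bsub>T\<^esub> ?B" ?X]
    by (simp add: T.M.a_ac)
qed

end

section \<open>Linear algebra of the Jacobi relations\<close>

abbreviation (input) delta :: "'a \<Rightarrow> 'a \<Rightarrow> 'k::zero_neq_one" where
  "delta x y \<equiv> (if x = y then 1 else 0)"

text \<open>Gaussian elimination. For independent vectors \<open>J a\<close> in the space of functions on \<open>I\<close>, the unit
  vectors indexed by a set \<open>B\<close> complete them to a basis; \<open>coef b\<close> and \<open>\<mu>\<close> are the coordinates with respect
  to this basis, so that \<open>coef b\<close> annihilates every \<open>J a\<close>. Adding one more vector \<open>J a\<close> removes from \<open>B\<close> an
  index \<open>b0\<close> at which \<open>J a\<close> has a nonzero coordinate \<open>r b0\<close>, and such a pivot exists by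
  independence.\<close>

lemma complement_of_independent:
  fixes J :: "'a \<Rightarrow> 'i \<Rightarrow> 'k::field"
  assumes "finite A" and I: "finite I"
    and "\<And>l. \<forall>x\<in>I. (\<Sum>a\<in>A. l a * J a x) = 0 \<Longrightarrow> \<forall>a\<in>A. l a = 0"
  shows "\<exists>B coef \<mu>. B \<subseteq> I \<and> card B + card A = card I \<and>
    (\<forall>b\<in>B. \<forall>b'\<in>B. coef b b' = delta b b') \<and>
    (\<forall>b\<in>B. \<forall>a\<in>A. (\<Sum>x\<in>I. coef b x * J a x) = 0) \<and>
    (\<forall>x\<in>I. \<forall>y\<in>I. delta x y = (\<Sum>b\<in>B. coef b x * delta b y) + (\<Sum>a\<in>A. \<mu> x a * J a y))"
  using assms(1,3)
proof (induct A rule: finite_induct)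
  case empty
  have "(\<Sum>b\<in>I. delta b x * delta b y) = (delta x y :: 'k)" if "x \<in> I" "y \<in> I" for x y
  proof -
    have "(\<Sum>b\<in>I. delta b x * delta b y) = (\<Sum>b\<in>I. if b = x then delta x y else (0::'k))"
      by (intro sum.cong) auto
    then show ?thesis using that I by simp
  qed
  then show ?case
    by (intro exI[of _ I] exI[of _ "\<lambda>b x. delta b x"] exI[of _ "\<lambda>_ _. 0"]) auto
next
  case (insert a A)
  have ind: "\<forall>a\<in>A. l a = 0" if "\<forall>x\<in>I. (\<Sum>a\<in>A. l a * J a x) = 0" for l
  proof -
    have "(\<Sum>b\<in>A. (l(a := 0)) b * J b x) = (\<Sum>b\<in>A. l b * J b x)" for x
      using insert(2) by (intro sum.cong) auto
    then have "\<forall>x\<in>I. (\<Sum>b\<in>insert a A. (l(a := 0)) b * J b x) = 0"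
      using that insert(1,2) by simp
    from insert(4)[OF this] show ?thesis using insert(2) by (auto split: if_splits)
  qed
  obtain B coef \<mu> where B: "B \<subseteq> I" "card B + card A = card I"
    and dual: "\<And>b b'. b \<in> B \<Longrightarrow> b' \<in> B \<Longrightarrow> coef b b' = delta b b'"
    and kill: "\<And>b a. b \<in> B \<Longrightarrow> a \<in> A \<Longrightarrow> (\<Sum>x\<in>I. coef b x * J a x) = 0"
    and gen: "\<And>x y. x \<in> I \<Longrightarrow> y \<in> I \<Longrightarrow>
      delta x y = (\<Sum>b\<in>B. coef b x * delta b y) + (\<Sum>a\<in>A. \<mu> x a * J a y)"
    using insert(3)[OF ind] by blast
  have fB: "finite B" using B(1) I finite_subset by blast
  define r where "r = (\<lambda>b. \<Sum>x\<in>I. coef b x * J a x)"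
  define \<nu> where "\<nu> = (\<lambda>c. \<Sum>x\<in>I. J a x * \<mu> x c)"
  have Ja: "J a y = (\<Sum>b\<in>B. r b * delta b y) + (\<Sum>c\<in>A. \<nu> c * J c y)" if y: "y \<in> I" for y
  proof -
    have "J a y = (\<Sum>x\<in>I. if x = y then J a x else 0)" using y I by simp
    also have "\<dots> = (\<Sum>x\<in>I. J a x * delta x y)" by (intro sum.cong) auto
    also have "\<dots> = (\<Sum>x\<in>I. J a x * ((\<Sum>b\<in>B. coef b x * delta b y) + (\<Sum>c\<in>A. \<mu> x c * J c y)))"
      using gen y by (intro sum.cong) auto
    also have "\<dots> = (\<Sum>x\<in>I. \<Sum>b\<in>B. J a x * (coef b x * delta b y)) +
        (\<Sum>x\<in>I. \<Sum>c\<in>A. J a x * (\<mu> x c * J c y))"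
      by (simp only: distrib_left sum.distrib sum_distrib_left)
    also have "(\<Sum>x\<in>I. \<Sum>b\<in>B. J a x * (coef b x * delta b y)) = (\<Sum>b\<in>B. r b * delta b y)"
      unfolding r_def by (subst sum.swap) (simp only: sum_distrib_right mult.assoc mult.left_commute)
    also have "(\<Sum>x\<in>I. \<Sum>c\<in>A. J a x * (\<mu> x c * J c y)) = (\<Sum>c\<in>A. \<nu> c * J c y)"
      unfolding \<nu>_def by (subst sum.swap) (simp only: sum_distrib_right mult.assoc)
    finally show ?thesis .
  qed
  have "\<exists>b\<in>B. r b \<noteq> 0"
  proof (rule ccontr)
    assume n: "\<not> ?thesis"
    define l where "l = (\<lambda>c. if c = a then - 1 else \<nu> c)"
    have "(\<Sum>c\<in>insert a A. l c * J c y) = 0" if "y \<in> I" for y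
    proof -
      have "(\<Sum>c\<in>A. l c * J c y) = (\<Sum>c\<in>A. \<nu> c * J c y)"
        using insert(2) by (intro sum.cong) (auto simp: l_def)
      also have "\<dots> = J a y" using Ja[OF that] n by simp
      finally show ?thesis using insert(1,2) by (simp add: l_def)
    qed
    then have "l a = 0" using insert(4)[of l] by simp
    then show False by (simp add: l_def)
  qed
  \<comment> \<open>solve the expansion of \<open>J a\<close> for the unit vector at the pivot and substitute\<close>
  then obtain b0 where b0: "b0 \<in> B" "r b0 \<noteq> 0" by blast
  define B' where "B' = B - {b0}"
  define coef' where "coef' = (\<lambda>b x. coef b x - r b / r b0 * coef b0 x)"
  define \<mu>' where "\<mu>' = (\<lambda>x c. if c = a then coef b0 x / r b0
    else \<mu> x c - coef b0 x / r b0 * \<nu> c)"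
  have split: "(\<Sum>b\<in>B. f b) = f b0 + (\<Sum>b\<in>B'. f b)" for f :: "'i \<Rightarrow> 'k"
    unfolding B'_def using fB b0(1) by (simp add: sum.remove)
  have r1: "B' \<subseteq> I" using B by (auto simp: B'_def)
  have r2: "card B' + card (insert a A) = card I"
  proof -
    have "card B = Suc (card B')" unfolding B'_def using card_Suc_Diff1[OF fB b0(1)] by simp
    then show ?thesis using B(2) insert(1,2) by simp
  qed
  have r3: "coef' b b' = delta b b'" if "b \<in> B'" "b' \<in> B'" for b b'
    using that dual b0(1) by (auto simp: B'_def coef'_def)
  have r4: "(\<Sum>x\<in>I. coef' b x * J c x) = 0" if b: "b \<in> B'" and c: "c \<in> insert a A" for b c
  proof -
    have "(\<Sum>x\<in>I. coef' b x * J c x) =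
        (\<Sum>x\<in>I. coef b x * J c x) - r b / r b0 * (\<Sum>x\<in>I. coef b0 x * J c x)"
      by (simp add: coef'_def left_diff_distrib sum_subtractf sum_distrib_left mult.assoc)
    also have "\<dots> = 0"
    proof (cases "c = a")
      case True
      then show ?thesis using b0(2)[unfolded r_def] by (simp add: r_def)
    next
      case False
      then show ?thesis using b c b0(1) by (simp add: kill B'_def)
    qed
    finally show ?thesis .
  qed
  have r5: "delta x y = (\<Sum>b\<in>B'. coef' b x * delta b y) + (\<Sum>c\<in>insert a A. \<mu>' x c * J c y)"
    if x: "x \<in> I" and y: "y \<in> I" for x y
  proof -
    let ?k = "coef b0 x / r b0"
    let ?D = "delta b0 y :: 'k" and ?R = "\<Sum>b\<in>B'. r b * delta b y" and ?N = "\<Sum>c\<in>A. \<nu> c * J c y"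
      and ?C = "\<Sum>b\<in>B'. coef b x * delta b y" and ?M = "\<Sum>c\<in>A. \<mu> x c * J c y"
    have 1: "J a y = r b0 * ?D + ?R + ?N" using Ja[OF y] by (simp only: split)
    have 2: "(delta x y :: 'k) = coef b0 x * ?D + ?C + ?M" using gen[OF x y] by (simp only: split)
    have 3: "(\<Sum>b\<in>B'. coef' b x * delta b y) = ?C - ?k * ?R"
      by (simp only: coef'_def left_diff_distrib sum_subtractf sum_distrib_left)
        (simp add: mult.assoc mult.left_commute)
    have 4: "(\<Sum>c\<in>A. \<mu>' x c * J c y) = ?M - ?k * ?N"
    proof -
      have "(\<Sum>c\<in>A. \<mu>' x c * J c y) = (\<Sum>c\<in>A. \<mu> x c * J c y - ?k * (\<nu> c * J c y))"
        using insert(2) by (intro sum.cong) (auto simp: \<mu>'_def algebra_simps)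
      then show ?thesis by (simp only: sum_subtractf sum_distrib_left)
    qed
    have "\<mu>' x a = ?k" by (simp add: \<mu>'_def)
    then have "(\<Sum>b\<in>B'. coef' b x * delta b y) + (\<Sum>c\<in>insert a A. \<mu>' x c * J c y) =
        ?C - ?k * ?R + (?k * J a y + (?M - ?k * ?N))"
      by (simp only: 3 4 sum.insert[OF insert(1,2)])
    also have "\<dots> = ?C + ?M + ?k * (r b0 * ?D)" unfolding 1 by (simp only: algebra_simps)
    also have "\<dots> = delta x y" unfolding 2 using b0(2) by simp
    finally show ?thesis by (rule HOL.sym)
  qed
  show ?case
    by (intro exI[of _ B'] exI[of _ coef'] exI[of _ \<mu>'] conjI ballI r1 r2 r3 r4 r5)
qed

lemma (in space) finsum_combination:
  assumes w: "\<And>y. y \<in> I \<Longrightarrow> w y \<in> carrier V"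
  shows "(\<Oplus>y\<in>I. (\<Sum>a\<in>A. l a * F a y) \<odot> w y) = (\<Oplus>a\<in>A. l a \<odot> (\<Oplus>y\<in>I. F a y \<odot> w y))"
proof (induct A rule: infinite_finite_induct)
  case (infinite A)
  then show ?case using w by (simp add: finsum_infinite finsum_all0)
next
  case empty
  then show ?case using w by (simp add: finsum_all0)
next
  case (insert a A)
  have c: "(\<Oplus>y\<in>I. f y \<odot> w y) \<in> carrier V" for f using w by (intro finsum_closed) auto
  have "(\<Oplus>y\<in>I. (\<Sum>b\<in>insert a A. l b * F b y) \<odot> w y) =
      (\<Oplus>y\<in>I. l a \<odot> (F a y \<odot> w y) \<oplus> (\<Sum>b\<in>A. l b * F b y) \<odot> w y)"
    using insert w by (intro finsum_cong') (auto simp: smult_plus smult_times)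
  also have "\<dots> = (\<Oplus>y\<in>I. l a \<odot> (F a y \<odot> w y)) \<oplus> (\<Oplus>y\<in>I. (\<Sum>b\<in>A. l b * F b y) \<odot> w y)"
    using w by (intro finsum_addf) auto
  also have "(\<Oplus>y\<in>I. l a \<odot> (F a y \<odot> w y)) = l a \<odot> (\<Oplus>y\<in>I. F a y \<odot> w y)"
    using w by (intro finsum_smult[symmetric]) auto
  also have "(\<Oplus>y\<in>I. (\<Sum>b\<in>A. l b * F b y) \<odot> w y) = (\<Oplus>a\<in>A. l a \<odot> (\<Oplus>y\<in>I. F a y \<odot> w y))"
    by (rule insert(3))
  also have "l a \<odot> (\<Oplus>y\<in>I. F a y \<odot> w y) \<oplus> \<dots> = (\<Oplus>a\<in>insert a A. l a \<odot> (\<Oplus>y\<in>I. F a y \<odot> w y))"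
    using insert c by (intro finsum_insert[symmetric]) auto
  finally show ?case .
qed

lemma (in space) finsum_delta:
  assumes "finite I" "x \<in> I" and w: "\<And>y. y \<in> I \<Longrightarrow> w y \<in> carrier V"
  shows "(\<Oplus>y\<in>I. delta x y \<odot> w y) = w x"
proof -
  have "(\<Oplus>y\<in>I. delta x y \<odot> w y) = (\<Oplus>y\<in>I. if x = y then w y else \<zero>)"
    using w by (intro finsum_cong') auto
  also have "\<dots> = w x" using add.finprod_singleton[OF assms(2,1), of w] w by auto
  finally show ?thesis .
qed

lemma three_vectors_dependent:
  fixes f g h :: "'q \<Rightarrow> 'k::field"
  assumes "finite Q" "card Q \<le> 2"
  shows "\<exists>\<alpha> \<beta> \<gamma>. (\<alpha>, \<beta>, \<gamma>) \<noteq> (0, 0, 0) \<and> (\<forall>q\<in>Q. \<alpha> * f q + \<beta> * g q + \<gamma> * h q = 0)"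
proof -
  have "\<exists>q1 q2. Q \<subseteq> {q1, q2}"
  proof -
    consider "card Q = 0" | "card Q = 1" | "card Q = 2" using assms(2) by linarith
    then show ?thesis using assms(1) by cases (auto simp: card_1_singleton_iff card_2_iff)
  qed
  then obtain q1 q2 where Q: "Q \<subseteq> {q1, q2}" by blast
  let ?D = "f q1 * g q2 - f q2 * g q1"
  have "\<exists>\<alpha> \<beta> \<gamma>. (\<alpha>, \<beta>, \<gamma>) \<noteq> (0, 0, 0) \<and> (\<forall>q\<in>{q1, q2}. \<alpha> * f q + \<beta> * g q + \<gamma> * h q = 0)"
  proof (cases "?D = 0")
    case False
    \<comment> \<open>the cross product of the two rows \<open>(f q, g q, h q)\<close>\<close>
    then show ?thesis
      by (intro exI[of _ "g q1 * h q2 - g q2 * h q1"] exI[of _ "h q1 * f q2 - h q2 * f q1"]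
        exI[of _ ?D]) (auto simp: algebra_simps)
  next
    case D: True
    consider "f q1 \<noteq> 0" | "f q2 \<noteq> 0" | "f q1 = 0" "f q2 = 0" by blast
    then show ?thesis
    proof cases
      case 1
      then show ?thesis using D
        by (intro exI[of _ "g q1"] exI[of _ "- f q1"] exI[of _ 0]) (auto simp: algebra_simps)
    next
      case 2
      then show ?thesis using D
        by (intro exI[of _ "g q2"] exI[of _ "- f q2"] exI[of _ 0]) (auto simp: algebra_simps)
    next
      case 3
      then show ?thesis by (intro exI[of _ 1] exI[of _ 0]) auto
    qed
  qed
  then show ?thesis using Q by blast
qed

definition pairs :: "nat \<Rightarrow> (nat \<times> nat) set" where
  "pairs d = {(i, j). i < j \<and> j < d}"

definition triples :: "nat \<Rightarrow> (nat \<times> nat \<times> nat) set" where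
  "triples d = {(i, j, k). i < j \<and> j < k \<and> k < d}"

lemma finite_pairs [simp]: "finite (pairs d)"
  by (rule finite_subset[of _ "{..<d} \<times> {..<d}"]) (auto simp: pairs_def)

lemma finite_triples [simp]: "finite (triples d)"
  by (rule finite_subset[of _ "{..<d} \<times> {..<d} \<times> {..<d}"]) (auto simp: triples_def)

lemma pairs_triples_0 [simp]: "pairs 0 = {}" "triples 0 = {}"
  by (auto simp: pairs_def triples_def)

lemma card_pairs: "2 * card (pairs d) + d = d * d"
proof (induct d)
  case (Suc d)
  have "pairs (Suc d) = pairs d \<union> {..<d} \<times> {d}" by (auto simp: pairs_def)
  moreover have "pairs d \<inter> {..<d} \<times> {d} = {}" by (auto simp: pairs_def)
  ultimately have "card (pairs (Suc d)) = card (pairs d) + d"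
    by (simp add: card_Un_disjoint card_cartesian_product)
  with Suc show ?case by simp
qed simp

lemma card_triples: "6 * card (triples d) + 3 * d * d = d * d * d + 2 * d"
proof (induct d)
  case (Suc d)
  let ?f = "\<lambda>(i, j). (i, j, d)"
  have "triples (Suc d) = triples d \<union> ?f ` pairs d"
    by (auto simp: triples_def pairs_def image_iff less_Suc_eq)
  moreover have "triples d \<inter> ?f ` pairs d = {}" by (auto simp: triples_def)
  moreover have "card (?f ` pairs d) = card (pairs d)"
    by (rule card_image) (auto simp: inj_on_def)
  ultimately have "card (triples (Suc d)) = card (triples d) + card (pairs d)"
    by (simp add: card_Un_disjoint)
  with Suc card_pairs[of d] show ?case by (simp add: algebra_simps)
qed simp

text \<open>If \<open>\<gamma> i j p\<close> are the coordinates of \<open>[e\<^sub>i, e\<^sub>j]\<close>, this is the coefficient of \<open>e\<^sub>i \<otimes> z\<^sub>p\<close> in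
  \<open>e\<^sub>a \<otimes> [e\<^sub>b, e\<^sub>c] + e\<^sub>b \<otimes> [e\<^sub>c, e\<^sub>a] + e\<^sub>c \<otimes> [e\<^sub>a, e\<^sub>b]\<close>.\<close>

definition jacobi_relation ::
  "(nat \<Rightarrow> nat \<Rightarrow> 'p \<Rightarrow> 'k::field) \<Rightarrow> nat \<times> nat \<times> nat \<Rightarrow> nat \<times> 'p \<Rightarrow> 'k" where
  "jacobi_relation \<gamma> = (\<lambda>(a, b, c) (i, p).
     delta a i * \<gamma> b c p + delta b i * \<gamma> c a p + delta c i * \<gamma> a b p)"

text \<open>Here \<open>\<mu>\<close> is the \<open>i\<close>-th row of the alternating function that extends \<open>l\<close> to all triples: the position
  of \<open>i\<close> relative to \<open>j < k\<close> decides which of the three terms of the relation contributes, and with which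
  sign.\<close>

lemma jacobi_relation_row:
  fixes l :: "nat \<times> nat \<times> nat \<Rightarrow> 'k::field" and \<gamma> :: "nat \<Rightarrow> nat \<Rightarrow> 'p \<Rightarrow> 'k"
  assumes anti: "\<And>i j. i < d \<Longrightarrow> j < d \<Longrightarrow> \<gamma> j i p = - \<gamma> i j p" and i: "i < d"
  defines "\<mu> \<equiv> \<lambda>(j, k). if i < j then l (i, j, k) else if j < i \<and> i < k then - l (j, i, k)
    else if k < i then l (j, k, i) else 0"
  shows "(\<Sum>t\<in>triples d. l t * jacobi_relation \<gamma> t (i, p)) =
    (\<Sum>q\<in>pairs d. \<mu> q * \<gamma> (fst q) (snd q) p)"
proof -
  let ?g = "\<lambda>q. \<gamma> (fst q) (snd q) p"
  let ?s1 = "\<lambda>q. if i < fst q then l (i, q) * ?g q else 0"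
  let ?s2 = "\<lambda>q. if fst q < i \<and> i < snd q then - l (fst q, i, snd q) * ?g q else 0"
  let ?s3 = "\<lambda>q. if snd q < i then l (fst q, snd q, i) * ?g q else 0"
  have 1: "(\<Sum>t\<in>triples d. if fst t = i then l t * \<gamma> (fst (snd t)) (snd (snd t)) p else 0) =
      (\<Sum>q\<in>pairs d. ?s1 q)"
    unfolding sum.inter_filter[OF finite_triples, symmetric] sum.inter_filter[OF finite_pairs, symmetric]
    by (rule sum.reindex_bij_witness[of _ "\<lambda>q. (i, q)" snd]) (auto simp: triples_def pairs_def)
  have 2: "(\<Sum>t\<in>triples d. if fst (snd t) = i then - l t * \<gamma> (fst t) (snd (snd t)) p else 0) =
      (\<Sum>q\<in>pairs d. ?s2 q)"
    unfolding sum.inter_filter[OF finite_triples, symmetric] sum.inter_filter[OF finite_pairs, symmetric]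
    by (rule sum.reindex_bij_witness[of _ "\<lambda>q. (fst q, i, snd q)" "\<lambda>t. (fst t, snd (snd t))"])
      (auto simp: triples_def pairs_def)
  have 3: "(\<Sum>t\<in>triples d. if snd (snd t) = i then l t * \<gamma> (fst t) (fst (snd t)) p else 0) =
      (\<Sum>q\<in>pairs d. ?s3 q)"
    unfolding sum.inter_filter[OF finite_triples, symmetric] sum.inter_filter[OF finite_pairs, symmetric]
    by (rule sum.reindex_bij_witness[of _ "\<lambda>q. (fst q, snd q, i)" "\<lambda>t. (fst t, fst (snd t))"])
      (use i in \<open>auto simp: triples_def pairs_def\<close>)
  have row_term: "l t * jacobi_relation \<gamma> t (i, p) =
      (if fst t = i then l t * \<gamma> (fst (snd t)) (snd (snd t)) p else 0) +
      (if fst (snd t) = i then - l t * \<gamma> (fst t) (snd (snd t)) p else 0) +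
      (if snd (snd t) = i then l t * \<gamma> (fst t) (fst (snd t)) p else 0)" if "t \<in> triples d" for t
  proof -
    obtain a b c where t: "t = (a, b, c)" by (cases t)
    then have "\<gamma> c a p = - \<gamma> a c p" using that by (intro anti) (auto simp: triples_def)
    with t show ?thesis by (simp add: jacobi_relation_def distrib_left)
  qed
  have "(\<Sum>t\<in>triples d. l t * jacobi_relation \<gamma> t (i, p)) =
      (\<Sum>t\<in>triples d. (if fst t = i then l t * \<gamma> (fst (snd t)) (snd (snd t)) p else 0) +
        (if fst (snd t) = i then - l t * \<gamma> (fst t) (snd (snd t)) p else 0) +
        (if snd (snd t) = i then l t * \<gamma> (fst t) (fst (snd t)) p else 0))"
    by (intro sum.cong HOL.refl row_term)
  also have "\<dots> = (\<Sum>q\<in>pairs d. ?s1 q + ?s2 q + ?s3 q)"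
    by (simp only: sum.distrib 1 2 3)
  also have "\<dots> = (\<Sum>q\<in>pairs d. \<mu> q * ?g q)"
    by (intro sum.cong) (auto simp: \<mu>_def pairs_def)
  finally show ?thesis .
qed

text \<open>Each row of a dependency among the Jacobi relations is a linear relation among the brackets
  \<open>[e\<^sub>j, e\<^sub>k]\<close>, so it is determined by its entries outside \<open>P\<close>, of which there are at most two. Hence the
  rows \<open>a\<close>, \<open>b\<close>, \<open>c\<close> are linearly dependent, and as the coefficients of the dependency are alternating,
  evaluating at \<open>(b, c)\<close>, \<open>(a, c)\<close> or \<open>(a, b)\<close> isolates the one at \<open>(a, b, c)\<close>.\<close>

lemma jacobi_relations_independent:
  fixes \<gamma> :: "nat \<Rightarrow> nat \<Rightarrow> nat \<times> nat \<Rightarrow> 'k::field"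
  assumes P: "P \<subseteq> pairs d" and Q: "card (pairs d - P) \<le> 2"
    and anti: "\<And>i j p. i < d \<Longrightarrow> j < d \<Longrightarrow> p \<in> P \<Longrightarrow> \<gamma> j i p = - \<gamma> i j p"
    and dual: "\<And>p q. p \<in> P \<Longrightarrow> q \<in> P \<Longrightarrow> \<gamma> (fst q) (snd q) p = delta p q"
    and l: "\<forall>x\<in>{..<d} \<times> P. (\<Sum>t\<in>triples d. l t * jacobi_relation \<gamma> t x) = 0"
  shows "\<forall>t\<in>triples d. l t = 0"
proof
  fix t assume "t \<in> triples d"
  then obtain a b c where t: "t = (a, b, c)" and abc: "a < b" "b < c" "c < d"
    by (auto simp: triples_def)
  define \<mu> where "\<mu> = (\<lambda>i (j, k). if i < j then l (i, j, k) else if j < i \<and> i < k then - l (j, i, k)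
    else if k < i then l (j, k, i) else 0)"
  have fP: "finite P" using P finite_subset finite_pairs by blast
  have row: "\<mu> i p = - (\<Sum>q\<in>pairs d - P. \<mu> i q * \<gamma> (fst q) (snd q) p)" if "i < d" and p: "p \<in> P" for i p
  proof -
    have "0 = (\<Sum>q\<in>pairs d. \<mu> i q * \<gamma> (fst q) (snd q) p)"
    proof -
      have "(\<Sum>t\<in>triples d. l t * jacobi_relation \<gamma> t (i, p)) = 0" using l that by blast
      moreover have "(\<Sum>t\<in>triples d. l t * jacobi_relation \<gamma> t (i, p)) =
          (\<Sum>q\<in>pairs d. \<mu> i q * \<gamma> (fst q) (snd q) p)"
        unfolding \<mu>_def by (rule jacobi_relation_row[OF _ that(1)]) (rule anti[OF _ _ p])
      ultimately show ?thesis by simp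
    qed
    also have "\<dots> = (\<Sum>q\<in>pairs d - P. \<mu> i q * \<gamma> (fst q) (snd q) p) +
        (\<Sum>q\<in>P. \<mu> i q * \<gamma> (fst q) (snd q) p)"
      using P by (intro sum.subset_diff) auto
    also have "(\<Sum>q\<in>P. \<mu> i q * \<gamma> (fst q) (snd q) p) = (\<Sum>q\<in>P. if p = q then \<mu> i q else 0)"
      using p by (intro sum.cong) (auto simp: dual)
    also have "\<dots> = \<mu> i p" using p fP by simp
    finally show ?thesis by (simp add: eq_neg_iff_add_eq_0 add.commute)
  qed
  obtain \<alpha> \<beta> \<gamma>' where nz: "(\<alpha>, \<beta>, \<gamma>') \<noteq> (0, 0, 0)"
    and dep: "\<And>q. q \<in> pairs d - P \<Longrightarrow> \<alpha> * \<mu> a q + \<beta> * \<mu> b q + \<gamma>' * \<mu> c q = 0"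
    using three_vectors_dependent[OF finite_Diff[OF finite_pairs] Q, of "\<mu> a" "\<mu> b" "\<mu> c"] by blast
  have dep': "\<alpha> * \<mu> a q + \<beta> * \<mu> b q + \<gamma>' * \<mu> c q = 0" if q: "q \<in> pairs d" for q
  proof (cases "q \<in> P")
    case True
    let ?g = "\<lambda>r. \<gamma> (fst r) (snd r) q"
    let ?S = "\<lambda>i. \<Sum>r\<in>pairs d - P. \<mu> i r * ?g r"
    have rows: "\<mu> a q = - ?S a" "\<mu> b q = - ?S b" "\<mu> c q = - ?S c"
      using abc True by (auto intro!: row)
    have "\<alpha> * ?S a + \<beta> * ?S b + \<gamma>' * ?S c =
        (\<Sum>r\<in>pairs d - P. \<alpha> * (\<mu> a r * ?g r) + \<beta> * (\<mu> b r * ?g r) + \<gamma>' * (\<mu> c r * ?g r))"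
      by (simp only: sum.distrib sum_distrib_left)
    also have "\<dots> = (\<Sum>r\<in>pairs d - P. (\<alpha> * \<mu> a r + \<beta> * \<mu> b r + \<gamma>' * \<mu> c r) * ?g r)"
      by (simp only: distrib_right mult.assoc)
    also have "\<dots> = 0" by (simp add: dep)
    finally have "- (\<alpha> * ?S a + \<beta> * ?S b + \<gamma>' * ?S c) = 0" by (simp only: minus_zero)
    then show ?thesis unfolding rows by (simp only: mult_minus_right minus_add_distrib)
  qed (use q dep in simp)
  have "\<alpha> * l t = 0" using dep'[of "(b, c)"] abc by (simp add: \<mu>_def pairs_def t)
  moreover have "\<beta> * l t = 0" using dep'[of "(a, c)"] abc by (simp add: \<mu>_def pairs_def t)
  moreover have "\<gamma>' * l t = 0" using dep'[of "(a, b)"] abc by (simp add: \<mu>_def pairs_def t)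
  ultimately show "l t = 0" using nz by auto
qed

section \<open>Coordinates on a Lie algebra of class two\<close>

text \<open>The forms \<open>\<xi> i\<close> and \<open>\<zeta> p\<close> are dual to the basis of \<open>L\<close> consisting of the \<open>e i\<close> and of the brackets
  \<open>[e i, e j]\<close> with \<open>(i, j) \<in> P\<close>, the latter being a basis of the derived algebra.\<close>

locale class_two_coordinates = class_two L
  for L :: "('k::field, 'v, 'm) lie_scheme" (structure) +
  fixes d :: nat and P :: "(nat \<times> nat) set" and e :: "nat \<Rightarrow> 'v"
    and \<xi> :: "nat \<Rightarrow> 'v \<Rightarrow> 'k" and \<zeta> :: "nat \<times> nat \<Rightarrow> 'v \<Rightarrow> 'k"
  assumes P_pairs: "P \<subseteq> pairs d"
    and e_closed: "i < d \<Longrightarrow> e i \<in> carrier L"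
    and xi_linear: "i < d \<Longrightarrow> linear_form L (\<xi> i)"
    and zeta_linear: "p \<in> P \<Longrightarrow> linear_form L (\<zeta> p)"
    and xi_e: "i < d \<Longrightarrow> j < d \<Longrightarrow> \<xi> i (e j) = delta i j"
    and xi_bracket: "i < d \<Longrightarrow> x \<in> carrier L \<Longrightarrow> y \<in> carrier L \<Longrightarrow> \<xi> i \<lblot>x, y\<rblot> = 0"
    and zeta_e: "p \<in> P \<Longrightarrow> i < d \<Longrightarrow> \<zeta> p (e i) = 0"
    and zeta_z: "p \<in> P \<Longrightarrow> q \<in> P \<Longrightarrow> \<zeta> p \<lblot>e (fst q), e (snd q)\<rblot> = delta p q"
    and derived_separated:
      "x \<in> lie_derived L \<Longrightarrow> (\<And>p. p \<in> P \<Longrightarrow> \<zeta> p x = 0) \<Longrightarrow> x = \<zero>"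
    and generated: "VectorSpace.subspace class_ring S L \<Longrightarrow> (\<And>i. i < d \<Longrightarrow> e i \<in> S) \<Longrightarrow>
      (\<And>p. p \<in> P \<Longrightarrow> \<lblot>e (fst p), e (snd p)\<rblot> \<in> S) \<Longrightarrow> carrier L \<subseteq> S"

context lie_algebra
begin

lemma derived_lie_ideal: "lie_algebra_ideal L (lie_derived L)"
  by unfold_locales
    (auto simp: lie_ideal_def derived_subspace intro: bracket_in_derived derived_closed)

end

context class_two
begin

lemma derived_central:
  assumes "z \<in> lie_derived L" "x \<in> carrier L"
  shows "\<lblot>z, x\<rblot> = \<zero>" "\<lblot>x, z\<rblot> = \<zero>"
proof -
  have "lie_derived L \<subseteq> {z \<in> carrier L. \<lblot>z, x\<rblot> = \<zero>}"
    by (rule derived_least) (use assms(2) in \<open>auto simp: subspace_iff bracket_add_left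
      bracket_smult_left bracket_bracket bracket_closed\<close>)
  then show 1: "\<lblot>z, x\<rblot> = \<zero>" using assms(1) by auto
  show "\<lblot>x, z\<rblot> = \<zero>"
    using bracket_anticomm[of z x] 1 assms(2) derived_closed[OF assms(1)] by simp
qed

text \<open>The \<open>e\<^sub>i\<close> represent a basis modulo the derived algebra. The derived algebra is central, hence
  spanned by the brackets \<open>[e\<^sub>i, e\<^sub>j]\<close> with \<open>i < j\<close>, and those indexed by \<open>P\<close> are chosen to be a basis.\<close>

lemma coordinates_exist:
  assumes m: "has_dim (L\<lparr>carrier := lie_derived L\<rparr>) m" and d: "has_dim (L /\<^sub>L lie_derived L) d"
  shows "\<exists>P e \<xi> \<zeta>. card P = m \<and> class_two_coordinates L d P e \<xi> \<zeta>"
proof -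
  let ?D = "lie_derived L"
  let ?V = "L\<lparr>carrier := ?D\<rparr>"
  interpret I: lie_algebra_ideal L ?D by (rule derived_lie_ideal)
  interpret Q: lie_algebra "L /\<^sub>L ?D" by (rule I.quotient_lie_algebra)
  interpret V: lie_algebra ?V by (rule derived_lie_algebra)
  obtain t c where tc: "coordinate_system (L /\<^sub>L ?D) {..<d} t c"
    using Q.has_dim_coordinates[OF d] by blast
  have "\<exists>x\<in>carrier L. t i = ?D +> x" if "i < d" for i
  proof -
    have "t i \<in> carrier (L /\<^sub>L ?D)" using tc that by (simp add: coordinate_system_def)
    then show ?thesis by (auto simp: I.quotient_carrier)
  qed
  then obtain e where e: "\<And>i. i < d \<Longrightarrow> e i \<in> carrier L" "\<And>i. i < d \<Longrightarrow> t i = ?D +> e i"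
    by metis
  define \<xi> where "\<xi> = (\<lambda>i x. c i (?D +> x))"
  have c: "linear_form (L /\<^sub>L ?D) (c i)" if "i < d" for i using tc that by (auto simp: coordinate_system_def)
  have mem: "?D +> x \<in> carrier (L /\<^sub>L ?D)" if "x \<in> carrier L" for x
    using that by (auto simp: I.quotient_carrier)
  have xi: "linear_form L (\<xi> i)" if i: "i < d" for i
    by (rule linear_formI)
      (auto simp: \<xi>_def mem linear_form_add[OF c[OF i]] linear_form_smult[OF c[OF i]]
        simp flip: I.quotient_add I.quotient_smult)
  have xi_e: "\<xi> i (e j) = delta i j" if "i < d" "j < d" for i j
  proof -
    have "c i (t j) = delta i j" using tc that by (simp add: coordinate_system_def)
    then show ?thesis using e(2)[OF that(2)] by (simp add: \<xi>_def)
  qed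
  have xi_D: "\<xi> i x = 0" if "i < d" "x \<in> ?D" for i x
  proof -
    have "?D +> x = \<zero>\<^bsub>L /\<^sub>L ?D\<^esub>"
      using that(2) derived_closed by (simp add: I.quotient_zero I.coset_zero_iff)
    then show ?thesis using Q.linear_form_zero[OF c[OF that(1)]] by (simp add: \<xi>_def)
  qed
  \<comment> \<open>\<open>res\<close> projects onto the derived algebra along the span of the \<open>e i\<close>; the forms \<open>\<zeta>\<close> are the\<close>
  \<comment> \<open>coordinates of the derived algebra composed with it\<close>
  define s where "s = (\<lambda>x. \<Oplus>i\<in>{..<d}. \<xi> i x \<odot> e i)"
  have s: "s x \<in> carrier L" for x unfolding s_def using e(1) by (intro finsum_closed) auto
  define res where "res = (\<lambda>x. x \<ominus> s x)"
  have res_closed: "res x \<in> carrier L" if "x \<in> carrier L" for x using s that by (simp add: res_def)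
  have res_D: "res x \<in> ?D" if x: "x \<in> carrier L" for x
  proof -
    have "\<xi> i (s x) = \<xi> i x" if i: "i < d" for i
    proof -
      have "\<xi> i (s x) = (\<Sum>j<d. \<xi> j x * \<xi> i (e j))"
        unfolding s_def by (rule linear_form_finsum[OF xi[OF i]]) (use e in auto)
      also have "\<dots> = (\<Sum>j<d. if i = j then \<xi> j x else 0)"
        using i by (intro sum.cong) (auto simp: xi_e)
      finally show ?thesis using i by simp
    qed
    then have "\<xi> i (res x) = 0" if "i < d" for i
      using that x s by (simp add: res_def linear_form_minus[OF xi])
    then have "?D +> res x = \<zero>\<^bsub>L /\<^sub>L ?D\<^esub>"
      using tc mem[OF res_closed[OF x]] unfolding coordinate_system_def \<xi>_def by blast
    then show ?thesis using I.coset_zero_iff[OF res_closed[OF x]] by (simp add: I.quotient_zero)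
  qed
  have gen0: "carrier L \<subseteq> S"
    if S: "VectorSpace.subspace class_ring S L" "\<And>i. i < d \<Longrightarrow> e i \<in> S" "?D \<subseteq> S" for S
  proof
    fix x assume x: "x \<in> carrier L"
    have "s x \<in> S" unfolding s_def
      using S(1,2) by (intro subspace_finsum[OF S(1)]) (auto simp: subspace_iff)
    moreover have "res x \<in> S" using res_D[OF x] S(3) by auto
    ultimately have "res x \<oplus> s x \<in> S" using S(1) by (auto simp: subspace_iff)
    then show "x \<in> S" using x s[of x] by (simp add: res_def a_minus_def M.a_assoc M.l_neg)
  qed
  let ?z = "\<lambda>q. \<lblot>e (fst q), e (snd q)\<rblot>"
  have z: "?z q \<in> ?D" if "q \<in> pairs d" for q
    using that by (intro bracket_in_derived e) (auto simp: pairs_def)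
  have Vsub: "VectorSpace.subspace class_ring S ?V \<longleftrightarrow>
      VectorSpace.subspace class_ring S L \<and> S \<subseteq> ?D" for S
    using derived_closed by (auto simp: V.subspace_iff subspace_iff)
  have gen1: "?D \<subseteq> S"
    if S: "VectorSpace.subspace class_ring S L" and zS: "\<And>q. q \<in> pairs d \<Longrightarrow> ?z q \<in> S" for S
  proof -
    note S' = S[unfolded subspace_iff]
    have 1: "\<lblot>e i, e j\<rblot> \<in> S" if "i < d" "j < d" for i j
    proof -
      consider "i < j" | "i = j" | "j < i" by linarith
      then show ?thesis
      proof cases
        case 1
        then show ?thesis using zS[of "(i, j)"] that by (simp add: pairs_def)
      next
        case 2
        then show ?thesis using S' that e by (simp add: bracket_self)
      next
        case 3
        then have "\<lblot>e j, e i\<rblot> \<in> S" using zS[of "(j, i)"] that by (simp add: pairs_def)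
        then show ?thesis
          using subspace_ominus[OF S] bracket_anticomm[of "e j" "e i"] that e by simp
      qed
    qed
    have sub_l: "VectorSpace.subspace class_ring {x \<in> carrier L. \<lblot>x, y\<rblot> \<in> S} L"
      if "y \<in> carrier L" for y
      using S' that by (auto simp: subspace_iff bracket_add_left bracket_smult_left)
    have sub_r: "VectorSpace.subspace class_ring {y \<in> carrier L. \<lblot>x, y\<rblot> \<in> S} L"
      if "x \<in> carrier L" for x
      using S' that by (auto simp: subspace_iff bracket_add_right bracket_smult_right)
    have 2: "\<lblot>x, e j\<rblot> \<in> S" if "x \<in> carrier L" "j < d" for x j
    proof -
      have "carrier L \<subseteq> {x \<in> carrier L. \<lblot>x, e j\<rblot> \<in> S}"
        by (rule gen0[OF sub_l]) (use that e 1 S' derived_central derived_closed in auto)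
      then show ?thesis using that by auto
    qed
    have "\<lblot>x, y\<rblot> \<in> S" if "x \<in> carrier L" "y \<in> carrier L" for x y
    proof -
      have "carrier L \<subseteq> {y \<in> carrier L. \<lblot>x, y\<rblot> \<in> S}"
        by (rule gen0[OF sub_r]) (use that e 2 S' derived_central derived_closed in auto)
      then show ?thesis using that by auto
    qed
    then show ?thesis by (rule derived_least[OF S])
  qed
  obtain P c' where P: "P \<subseteq> pairs d" "card P = m" and c': "coordinate_system ?V P ?z c'"
    using V.generating_family_contains_basis[OF m finite_pairs, of d ?z] z gen1 Vsub by auto
  have c'_linear: "linear_form ?V (c' p)" if "p \<in> P" for p
    using c' that by (auto simp: coordinate_system_def)
  define \<zeta> where "\<zeta> = (\<lambda>p x. c' p (res x))"
  have res_add: "res (x \<oplus> y) = res x \<oplus> res y" if "x \<in> carrier L" "y \<in> carrier L" for x y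
  proof -
    have "s (x \<oplus> y) = (\<Oplus>i\<in>{..<d}. \<xi> i x \<odot> e i \<oplus> \<xi> i y \<odot> e i)"
      unfolding s_def using that e
      by (intro finsum_cong') (auto simp: linear_form_add[OF xi] smult_plus)
    also have "\<dots> = s x \<oplus> s y" unfolding s_def using e by (intro finsum_addf) auto
    finally show ?thesis
      using that s[of x] s[of y] by (simp add: res_def a_minus_def M.minus_add M.a_ac)
  qed
  have res_smult: "res (a \<odot> x) = a \<odot> res x" if "x \<in> carrier L" for a x
  proof -
    have "s (a \<odot> x) = (\<Oplus>i\<in>{..<d}. a \<odot> (\<xi> i x \<odot> e i))"
      unfolding s_def using that e
      by (intro finsum_cong') (auto simp: linear_form_smult[OF xi] smult_times)
    also have "\<dots> = a \<odot> s x" unfolding s_def using e by (intro finsum_smult[symmetric]) auto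
    finally show ?thesis
      using that s[of x] by (simp add: res_def a_minus_def smult_oplus smult_ominus)
  qed
  have res_id: "res x = x" if "x \<in> ?D" for x
  proof -
    have "s x = \<zero>" unfolding s_def using e that by (intro finsum_all0) (simp add: xi_D)
    then show ?thesis using derived_closed[OF that] by (simp add: res_def a_minus_def)
  qed
  have res_e: "res (e j) = \<zero>" if j: "j < d" for j
  proof -
    have "s (e j) = (\<Oplus>i\<in>{..<d}. delta j i \<odot> e i)"
      unfolding s_def using e j by (intro finsum_cong') (auto simp: xi_e)
    also have "\<dots> = e j" using e j by (intro finsum_delta) auto
    finally show ?thesis using e j by (simp add: res_def)
  qed
  have "class_two_coordinates L d P e \<xi> \<zeta>"
  proof
    show "P \<subseteq> pairs d" by (rule P)
    show "e i \<in> carrier L" if "i < d" for i using that by (rule e)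
    show "linear_form L (\<xi> i)" if "i < d" for i using that by (rule xi)
    show "linear_form L (\<zeta> p)" if p: "p \<in> P" for p
      using linear_form_add[OF c'_linear[OF p]] linear_form_smult[OF c'_linear[OF p]]
      by (intro linear_formI) (simp_all add: \<zeta>_def res_add res_smult res_D)
    show "\<xi> i (e j) = delta i j" if "i < d" "j < d" for i j using that by (rule xi_e)
    show "\<xi> i \<lblot>x, y\<rblot> = 0" if "i < d" "x \<in> carrier L" "y \<in> carrier L" for i x y
      using that by (intro xi_D bracket_in_derived)
    show "\<zeta> p (e i) = 0" if "p \<in> P" "i < d" for p i
      using V.linear_form_zero[OF c'_linear[OF that(1)]] that by (simp add: \<zeta>_def res_e)
    show "\<zeta> p (?z q) = delta p q" if "p \<in> P" "q \<in> P" for p q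
    proof -
      have "q \<in> pairs d" using that P by auto
      then show ?thesis using c' that by (simp add: \<zeta>_def res_id z coordinate_system_def)
    qed
    show "x = \<zero>" if "x \<in> ?D" "\<And>p. p \<in> P \<Longrightarrow> \<zeta> p x = 0" for x
      using c' that by (auto simp: coordinate_system_def \<zeta>_def res_id)
    show "carrier L \<subseteq> S" if S: "VectorSpace.subspace class_ring S L" and eS: "\<And>i. i < d \<Longrightarrow> e i \<in> S"
      and zS: "\<And>p. p \<in> P \<Longrightarrow> ?z p \<in> S" for S
    proof -
      have "VectorSpace.subspace class_ring (S \<inter> ?D) ?V"
        using S derived_subspace unfolding Vsub by (auto simp: subspace_iff)
      then have "carrier ?V \<subseteq> S \<inter> ?D"
        by (rule V.coordinate_system_generates[OF c']) (use zS z P in auto)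
      then show ?thesis by (intro gen0 S eS) auto
    qed
  qed
  then show ?thesis using P(2) by blast
qed

end

lemma linear_form_const_mult: "linear_form V f \<Longrightarrow> linear_form V (\<lambda>x. c * f x)"
  by (auto simp: linear_form_def algebra_simps)

lemma linear_form_mult_const: "linear_form V f \<Longrightarrow> linear_form V (\<lambda>x. f x * c)"
  by (auto simp: linear_form_def algebra_simps)

lemma linear_form_plus: "linear_form V f \<Longrightarrow> linear_form V g \<Longrightarrow> linear_form V (\<lambda>x. f x + g x)"
  by (auto simp: linear_form_def algebra_simps)

lemma linear_form_diff: "linear_form V f \<Longrightarrow> linear_form V g \<Longrightarrow> linear_form V (\<lambda>x. f x - g x)"
  by (auto simp: linear_form_def algebra_simps)

lemma (in lie_algebra) linear_form_bracket:
  assumes "linear_form L f" "y \<in> carrier L"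
  shows "linear_form L (\<lambda>x. f \<lblot>x, y\<rblot>)" "linear_form L (\<lambda>x. f \<lblot>y, x\<rblot>)"
  using assms by (auto simp: linear_form_def bracket_add_left bracket_add_right bracket_smult_left
    bracket_smult_right bracket_closed)

context class_two_coordinates
begin

definition z :: "nat \<times> nat \<Rightarrow> 'v" where "z p = \<lblot>e (fst p), e (snd p)\<rblot>"

lemma pair_less: "p \<in> P \<Longrightarrow> fst p < d" "p \<in> P \<Longrightarrow> snd p < d"
  using P_pairs by (auto simp: pairs_def)

lemma finite_P [simp]: "finite P"
  using P_pairs finite_subset finite_pairs by blast

lemma z_derived: "p \<in> P \<Longrightarrow> z p \<in> lie_derived L"
  unfolding z_def by (intro bracket_in_derived e_closed pair_less)

lemma z_closed: "p \<in> P \<Longrightarrow> z p \<in> carrier L"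
  by (rule derived_closed[OF z_derived])

lemma derived_sum:
  assumes x: "x \<in> lie_derived L"
  shows "x = (\<Oplus>p\<in>P. \<zeta> p x \<odot> z p)"
proof -
  let ?y = "\<Oplus>p\<in>P. \<zeta> p x \<odot> z p"
  have y: "?y \<in> lie_derived L"
    using z_derived derived_subspace
    by (intro subspace_finsum[OF derived_subspace]) (auto simp: subspace_iff)
  have "x \<ominus> ?y = \<zero>"
  proof (rule derived_separated)
    show "x \<ominus> ?y \<in> lie_derived L" by (rule subspace_minus[OF derived_subspace x y])
    fix q assume q: "q \<in> P"
    have "\<zeta> q ?y = (\<Sum>p\<in>P. \<zeta> p x * \<zeta> q (z p))"
      by (rule linear_form_finsum[OF zeta_linear[OF q]]) (rule z_closed)
    also have "\<dots> = (\<Sum>p\<in>P. if q = p then \<zeta> p x else 0)"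
      using q zeta_z by (intro sum.cong) (auto simp: z_def)
    also have "\<dots> = \<zeta> q x" using q by simp
    finally show "\<zeta> q (x \<ominus> ?y) = 0"
      using linear_form_minus[OF zeta_linear[OF q]] derived_closed[OF x] derived_closed[OF y] by simp
  qed
  then show ?thesis using derived_closed[OF x] derived_closed[OF y] by simp
qed

end

section \<open>Bases of the tensor square, the exterior square and the kernel of the commutator map\<close>

context class_two_coordinates
begin

definition \<gamma> :: "nat \<Rightarrow> nat \<Rightarrow> nat \<times> nat \<Rightarrow> 'k" where
  "\<gamma> i j p = \<zeta> p \<lblot>e i, e j\<rblot>"

text \<open>The cyclic sum \<open>x \<otimes> [y, u] + y \<otimes> [u, x] + u \<otimes> [x, y]\<close> in coordinates, paired with \<open>f\<close>.\<close>

definition cyclic_form :: "(nat \<times> (nat \<times> nat) \<Rightarrow> 'k) \<Rightarrow> 'v \<Rightarrow> 'v \<Rightarrow> 'v \<Rightarrow> 'k" where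
  "cyclic_form f x y u = (\<Sum>q\<in>{..<d} \<times> P. f q *
     (\<xi> (fst q) x * \<zeta> (snd q) \<lblot>y, u\<rblot> + \<xi> (fst q) y * \<zeta> (snd q) \<lblot>u, x\<rblot> +
      \<xi> (fst q) u * \<zeta> (snd q) \<lblot>x, y\<rblot>))"

lemma zeta_anticomm:
  "p \<in> P \<Longrightarrow> x \<in> carrier L \<Longrightarrow> y \<in> carrier L \<Longrightarrow> \<zeta> p \<lblot>y, x\<rblot> = - \<zeta> p \<lblot>x, y\<rblot>"
  using bracket_anticomm[of x y] linear_form_ominus[OF zeta_linear] bracket_closed by simp

lemma zeta_bracket_self: "p \<in> P \<Longrightarrow> x \<in> carrier L \<Longrightarrow> \<zeta> p \<lblot>x, x\<rblot> = 0"
  using bracket_self linear_form_zero[OF zeta_linear] by simp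

lemma cyclic_form_rotate: "cyclic_form f x y u = cyclic_form f y u x"
  unfolding cyclic_form_def by (intro sum.cong) (auto simp: algebra_simps)

lemma cyclic_form_swap:
  assumes "x \<in> carrier L" "y \<in> carrier L" "u \<in> carrier L"
  shows "cyclic_form f y x u = - cyclic_form f x y u"
proof -
  have "cyclic_form f y x u = (\<Sum>q\<in>{..<d} \<times> P. - (f q *
     (\<xi> (fst q) x * \<zeta> (snd q) \<lblot>y, u\<rblot> + \<xi> (fst q) y * \<zeta> (snd q) \<lblot>u, x\<rblot> +
      \<xi> (fst q) u * \<zeta> (snd q) \<lblot>x, y\<rblot>)))"
    unfolding cyclic_form_def
  proof (rule sum.cong[OF HOL.refl])
    fix q assume "q \<in> {..<d} \<times> P"
    then have "snd q \<in> P" by auto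
    from zeta_anticomm[OF this, of u x] zeta_anticomm[OF this, of y u]
      zeta_anticomm[OF this, of x y] assms
    show "f q * (\<xi> (fst q) y * \<zeta> (snd q) \<lblot>x, u\<rblot> + \<xi> (fst q) x * \<zeta> (snd q) \<lblot>u, y\<rblot> +
        \<xi> (fst q) u * \<zeta> (snd q) \<lblot>y, x\<rblot>) =
      - (f q * (\<xi> (fst q) x * \<zeta> (snd q) \<lblot>y, u\<rblot> + \<xi> (fst q) y * \<zeta> (snd q) \<lblot>u, x\<rblot> +
        \<xi> (fst q) u * \<zeta> (snd q) \<lblot>x, y\<rblot>))"
      by (simp add: algebra_simps)
  qed
  then show ?thesis by (simp add: cyclic_form_def sum_negf)
qed

lemma cyclic_form_self:
  assumes "x \<in> carrier L" "u \<in> carrier L"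
  shows "cyclic_form f x x u = 0"
  unfolding cyclic_form_def
proof (rule sum.neutral, rule ballI)
  fix q assume "q \<in> {..<d} \<times> P"
  then have "snd q \<in> P" by auto
  from zeta_anticomm[OF this, of u x] zeta_bracket_self[OF this, of x] assms
  show "f q * (\<xi> (fst q) x * \<zeta> (snd q) \<lblot>x, u\<rblot> + \<xi> (fst q) x * \<zeta> (snd q) \<lblot>u, x\<rblot> +
      \<xi> (fst q) u * \<zeta> (snd q) \<lblot>x, x\<rblot>) = 0"
    by (simp add: algebra_simps)
qed

lemma cyclic_form_linear:
  assumes "y \<in> carrier L" "u \<in> carrier L"
  shows "linear_form L (\<lambda>x. cyclic_form f x y u)"
  unfolding cyclic_form_def
  by (rule linear_form_sum)
    (use assms in \<open>auto intro!: linear_form_plus linear_form_mult_const linear_form_const_mult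
      linear_form_bracket xi_linear zeta_linear\<close>)

lemma cyclic_form_derived:
  assumes "x \<in> carrier L" "x' \<in> carrier L" "y \<in> carrier L" "u \<in> carrier L"
  shows "cyclic_form f \<lblot>x, x'\<rblot> y u = 0"
  unfolding cyclic_form_def using assms
  by (intro sum.neutral ballI) (auto simp: xi_bracket bracket_bracket bracket_bracket_right
    linear_form_zero[OF zeta_linear])

text \<open>The cyclic form is trilinear and alternating and vanishes on derived elements, so its values on
  triples \<open>e a, e b, e c\<close> with \<open>a < b < c\<close> determine it, and these are pairings with Jacobi relations.\<close>

lemma cyclic_form_zero:
  assumes f: "\<And>t. t \<in> triples d \<Longrightarrow> (\<Sum>q\<in>{..<d} \<times> P. f q * jacobi_relation \<gamma> t q) = 0"
    and x: "x \<in> carrier L" and y: "y \<in> carrier L" and u: "u \<in> carrier L"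
  shows "cyclic_form f x y u = 0"
proof -
  let ?K = "\<lambda>a b c. cyclic_form f (e a) (e b) (e c)"
  have xi_e': "\<xi> i (e j) = delta j i" if "i < d" "j < d" for i j using xi_e[OF that] by auto
  have sorted: "?K a b c = 0" if "a < b" "b < c" "c < d" for a b c
  proof -
    have "?K a b c = (\<Sum>q\<in>{..<d} \<times> P. f q * jacobi_relation \<gamma> (a, b, c) q)"
      unfolding cyclic_form_def using that
      by (intro sum.cong) (auto simp: jacobi_relation_def \<gamma>_def xi_e')
    then show ?thesis using f[of "(a, b, c)"] that by (simp add: triples_def)
  qed
  have less: "?K a b c = 0" if "a < b" "b < d" "c < d" for a b c
  proof -
    have e3: "e a \<in> carrier L" "e b \<in> carrier L" "e c \<in> carrier L" using that e_closed by auto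
    consider "c < a" | "c = a" | "a < c" "c < b" | "c = b" | "b < c" by linarith
    then show ?thesis
    proof cases
      case 1
      have "?K a b c = ?K c a b" by (rule cyclic_form_rotate[symmetric])
      then show ?thesis using sorted[of c a b] 1 that by simp
    next
      case 2
      have "?K a b c = ?K c a b" by (rule cyclic_form_rotate[symmetric])
      then show ?thesis using cyclic_form_self e3 2 by simp
    next
      case 3
      have "?K a b c = - ?K b a c" using cyclic_form_swap[OF e3(2,1,3)] .
      also have "?K b a c = ?K a c b" by (rule cyclic_form_rotate)
      finally show ?thesis using sorted[of a c b] 3 that by simp
    next
      case 4
      have "?K a b c = ?K b c a" by (rule cyclic_form_rotate)
      then show ?thesis using cyclic_form_self e3 4 by simp
    next
      case 5
      then show ?thesis using sorted[of a b c] that by simp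
    qed
  qed
  have basis: "?K a b c = 0" if "a < d" "b < d" "c < d" for a b c
  proof -
    have e3: "e a \<in> carrier L" "e b \<in> carrier L" "e c \<in> carrier L" using that e_closed by auto
    consider "a < b" | "a = b" | "b < a" by linarith
    then show ?thesis
    proof cases
      case 3
      then show ?thesis using less[of b a c] that cyclic_form_swap[OF e3(2,1,3)] by simp
    next
      case 1
      then show ?thesis by (rule less[OF _ that(2,3)])
    next
      case 2
      then show ?thesis using cyclic_form_self[OF e3(1,3)] by simp
    qed
  qed
  have extend: "cyclic_form f x y u = 0"
    if "x \<in> carrier L" "y \<in> carrier L" "u \<in> carrier L" "\<And>i. i < d \<Longrightarrow> cyclic_form f (e i) y u = 0"
    for x y u
  proof -
    have "carrier L \<subseteq> {x \<in> carrier L. cyclic_form f x y u = 0}"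
    proof (rule generated)
      show "VectorSpace.subspace class_ring {x \<in> carrier L. cyclic_form f x y u = 0} L"
        by (rule linear_form_kernel_subspace[OF cyclic_form_linear[OF that(2,3)]])
          (simp add: linear_form_def)
      show "e i \<in> {x \<in> carrier L. cyclic_form f x y u = 0}" if "i < d" for i
        using that e_closed \<open>\<And>i. i < d \<Longrightarrow> cyclic_form f (e i) y u = 0\<close> by simp
      show "\<lblot>e (fst p), e (snd p)\<rblot> \<in> {x \<in> carrier L. cyclic_form f x y u = 0}" if p: "p \<in> P" for p
        using cyclic_form_derived[OF e_closed[OF pair_less(1)[OF p]] e_closed[OF pair_less(2)[OF p]]]
          bracket_closed[OF e_closed[OF pair_less(1)[OF p]] e_closed[OF pair_less(2)[OF p]]]
          \<open>y \<in> carrier L\<close> \<open>u \<in> carrier L\<close> by simp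
    qed
    then show ?thesis using that by auto
  qed
  have 1: "cyclic_form f x (e b) (e c) = 0" if "x \<in> carrier L" "b < d" "c < d" for x b c
    by (rule extend[OF that(1) e_closed[OF that(2)] e_closed[OF that(3)]])
      (rule basis[OF _ that(2,3)])
  have 2: "cyclic_form f y u (e a) = 0" if "y \<in> carrier L" "u \<in> carrier L" "a < d" for y u a
  proof (rule extend)
    show "cyclic_form f (e i) u (e a) = 0" if i: "i < d" for i
    proof -
      have "cyclic_form f (e i) u (e a) = cyclic_form f u (e a) (e i)" by (rule cyclic_form_rotate)
      then show ?thesis using 1 i \<open>a < d\<close> \<open>u \<in> carrier L\<close> by simp
    qed
  qed (fact that(1,2) | rule e_closed[OF that(3)])+
  show ?thesis
  proof (rule extend[OF x y u])
    show "cyclic_form f (e i) y u = 0" if "i < d" for i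
      using 2[OF y u that] cyclic_form_rotate[of f "e i" y u] by simp
  qed
qed

lemma tensor_finsum_right:
  assumes "x \<in> carrier L" and "\<And>p. p \<in> A \<Longrightarrow> w p \<in> carrier L"
  shows "tensor L x (\<Oplus>p\<in>A. c p \<odot> w p) = (\<Oplus>\<^bsub>T\<^esub>p\<in>A. c p \<odot>\<^bsub>T\<^esub> tensor L x (w p))"
  using assms(2)
proof (induct A rule: infinite_finite_induct)
  interpret T: lie_algebra T by (rule tensor_square_lie_algebra)
  {
    case (infinite A)
    then show ?case using assms(1) by (simp add: finsum_infinite T.finsum_infinite tensor_zero_right)
  next
    case empty
    then show ?case using assms(1) by (simp add: tensor_zero_right)
  next
    case (insert a A)
    have "(\<Oplus>p\<in>insert a A. c p \<odot> w p) = c a \<odot> w a \<oplus> (\<Oplus>p\<in>A. c p \<odot> w p)"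
      using insert by (intro finsum_insert) auto
    moreover have "(\<Oplus>p\<in>A. c p \<odot> w p) \<in> carrier L" using insert by (intro finsum_closed) auto
    moreover have "(\<Oplus>\<^bsub>T\<^esub>p\<in>insert a A. c p \<odot>\<^bsub>T\<^esub> tensor L x (w p)) =
        c a \<odot>\<^bsub>T\<^esub> tensor L x (w a) \<oplus>\<^bsub>T\<^esub> (\<Oplus>\<^bsub>T\<^esub>p\<in>A. c p \<odot>\<^bsub>T\<^esub> tensor L x (w p))"
      using insert assms(1) by (intro T.finsum_insert) (auto simp: tensor_closed)
    ultimately show ?case
      using insert assms(1) by (simp add: tensor_add_right tensor_smult_right)
  }
qed

abbreviation w :: "nat \<times> (nat \<times> nat) \<Rightarrow> ('k, 'v \<times> 'v) lie_term set set" where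
  "w q \<equiv> tensor L (e (fst q)) (z (snd q))"

lemma w_closed: "q \<in> {..<d} \<times> P \<Longrightarrow> w q \<in> carrier T"
  using e_closed z_closed by (auto simp: tensor_closed)

lemma tensor_e_bracket:
  assumes "a < d" "b < d" "c < d"
  shows "tensor L (e a) \<lblot>e b, e c\<rblot> = (\<Oplus>\<^bsub>T\<^esub>p\<in>P. \<gamma> b c p \<odot>\<^bsub>T\<^esub> w (a, p))"
proof -
  have "\<lblot>e b, e c\<rblot> = (\<Oplus>p\<in>P. \<gamma> b c p \<odot> z p)"
    using derived_sum[OF bracket_in_derived] assms e_closed by (simp add: \<gamma>_def)
  then show ?thesis using tensor_finsum_right[of "e a" P z "\<gamma> b c"] assms e_closed z_closed by simp
qed

text \<open>Collecting the terms by bilinearity turns the combination into the cyclic sum of the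
  \<open>e\<^sub>a \<otimes> [e\<^sub>b, e\<^sub>c]\<close>.\<close>

lemma jacobi_relation_tensor:
  assumes "t \<in> triples d"
  shows "(\<Oplus>\<^bsub>T\<^esub>q\<in>{..<d} \<times> P. jacobi_relation \<gamma> t q \<odot>\<^bsub>T\<^esub> w q) = \<zero>\<^bsub>T\<^esub>"
proof -
  interpret T: lie_algebra T by (rule tensor_square_lie_algebra)
  obtain a b c where t: "t = (a, b, c)" and abc: "a < d" "b < d" "c < d"
    using assms by (auto simp: triples_def)
  \<comment> \<open>each of the three terms of a relation only involves the row of one index\<close>
  have part: "(\<Oplus>\<^bsub>T\<^esub>q\<in>{..<d} \<times> P. (delta a (fst q) * f (snd q)) \<odot>\<^bsub>T\<^esub> w q) =
      (\<Oplus>\<^bsub>T\<^esub>p\<in>P. f p \<odot>\<^bsub>T\<^esub> w (a, p))" if a: "a < d" for a f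
  proof -
    have "(\<Oplus>\<^bsub>T\<^esub>q\<in>{..<d} \<times> P. (delta a (fst q) * f (snd q)) \<odot>\<^bsub>T\<^esub> w q) =
        (\<Oplus>\<^bsub>T\<^esub>q\<in>{..<d} \<times> P. (\<Sum>p\<in>P. f p * delta (a, p) q) \<odot>\<^bsub>T\<^esub> w q)"
    proof (rule T.finsum_cong'[OF HOL.refl])
      fix q assume q: "q \<in> {..<d} \<times> P"
      have "(\<Sum>p\<in>P. f p * delta (a, p) q) = (\<Sum>p\<in>P. if snd q = p then delta a (fst q) * f p else 0)"
        by (intro sum.cong HOL.refl) (cases q; auto)
      also have "\<dots> = delta a (fst q) * f (snd q)" using q by (auto simp: mem_Times_iff)
      finally show "(delta a (fst q) * f (snd q)) \<odot>\<^bsub>T\<^esub> w q =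
          (\<Sum>p\<in>P. f p * delta (a, p) q) \<odot>\<^bsub>T\<^esub> w q" by simp
    qed (use w_closed in auto)
    also have "\<dots> = (\<Oplus>\<^bsub>T\<^esub>p\<in>P. f p \<odot>\<^bsub>T\<^esub> (\<Oplus>\<^bsub>T\<^esub>q\<in>{..<d} \<times> P. delta (a, p) q \<odot>\<^bsub>T\<^esub> w q))"
      by (rule T.finsum_combination) (rule w_closed)
    also have "\<dots> = (\<Oplus>\<^bsub>T\<^esub>p\<in>P. f p \<odot>\<^bsub>T\<^esub> w (a, p))"
    proof (rule T.finsum_cong'[OF HOL.refl])
      fix p assume p: "p \<in> P"
      have "(\<Oplus>\<^bsub>T\<^esub>q\<in>{..<d} \<times> P. delta (a, p) q \<odot>\<^bsub>T\<^esub> w q) = w (a, p)"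
        by (rule T.finsum_delta) (use a p w_closed in auto)
      then show "f p \<odot>\<^bsub>T\<^esub> (\<Oplus>\<^bsub>T\<^esub>q\<in>{..<d} \<times> P. delta (a, p) q \<odot>\<^bsub>T\<^esub> w q) = f p \<odot>\<^bsub>T\<^esub> w (a, p)" by simp
    qed (use a w_closed in auto)
    finally show ?thesis .
  qed
  let ?g = "\<lambda>a b c q. (delta a (fst q) * \<gamma> b c (snd q)) \<odot>\<^bsub>T\<^esub> w q"
  have "(\<Oplus>\<^bsub>T\<^esub>q\<in>{..<d} \<times> P. jacobi_relation \<gamma> t q \<odot>\<^bsub>T\<^esub> w q) =
      (\<Oplus>\<^bsub>T\<^esub>q\<in>{..<d} \<times> P. ?g a b c q \<oplus>\<^bsub>T\<^esub> ?g b c a q \<oplus>\<^bsub>T\<^esub> ?g c a b q)"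
  proof (rule T.finsum_cong'[OF HOL.refl])
    fix q assume q: "q \<in> {..<d} \<times> P"
    have "jacobi_relation \<gamma> t q = delta a (fst q) * \<gamma> b c (snd q) + delta b (fst q) * \<gamma> c a (snd q) +
        delta c (fst q) * \<gamma> a b (snd q)"
      by (cases q) (simp only: jacobi_relation_def t case_prod_conv fst_conv snd_conv)
    then show "jacobi_relation \<gamma> t q \<odot>\<^bsub>T\<^esub> w q = ?g a b c q \<oplus>\<^bsub>T\<^esub> ?g b c a q \<oplus>\<^bsub>T\<^esub> ?g c a b q"
      by (simp only: T.smult_plus[OF w_closed[OF q]])
  next
    show "(\<lambda>q. ?g a b c q \<oplus>\<^bsub>T\<^esub> ?g b c a q \<oplus>\<^bsub>T\<^esub> ?g c a b q) \<in> {..<d} \<times> P \<rightarrow> carrier T"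
      by (intro funcsetI T.M.a_closed T.smult_in w_closed)
  qed
  also have "\<dots> = (\<Oplus>\<^bsub>T\<^esub>q\<in>{..<d} \<times> P. ?g a b c q) \<oplus>\<^bsub>T\<^esub> (\<Oplus>\<^bsub>T\<^esub>q\<in>{..<d} \<times> P. ?g b c a q) \<oplus>\<^bsub>T\<^esub>
      (\<Oplus>\<^bsub>T\<^esub>q\<in>{..<d} \<times> P. ?g c a b q)"
  proof -
    have g: "?g a b c \<in> {..<d} \<times> P \<rightarrow> carrier T" for a b c
      by (intro funcsetI T.smult_in w_closed)
    have g2: "(\<lambda>q. ?g a b c q \<oplus>\<^bsub>T\<^esub> ?g b c a q) \<in> {..<d} \<times> P \<rightarrow> carrier T"
      by (intro funcsetI T.M.a_closed T.smult_in w_closed)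
    show ?thesis by (simp only: T.finsum_addf[OF g2 g] T.finsum_addf[OF g g])
  qed
  also have "\<dots> = tensor L (e a) \<lblot>e b, e c\<rblot> \<oplus>\<^bsub>T\<^esub> tensor L (e b) \<lblot>e c, e a\<rblot> \<oplus>\<^bsub>T\<^esub>
      tensor L (e c) \<lblot>e a, e b\<rblot>"
    by (simp only: part abc tensor_e_bracket)
  also have "\<dots> = \<zero>\<^bsub>T\<^esub>" using abc e_closed by (intro tensor_jacobi) auto
  finally show ?thesis .
qed

end

text \<open>\<open>B\<close> selects the tensors \<open>e\<^sub>i \<otimes> z\<^sub>p\<close> that form a basis of their span, and \<open>coef b\<close> lists the coordinates
  at \<open>b\<close> of all of them. Annihilating the Jacobi relations is what makes \<open>coef b\<close> induce a form on the
  tensor square.\<close>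

locale class_two_basis = class_two_coordinates L d P e \<xi> \<zeta>
  for L :: "('k::field, 'v, 'm) lie_scheme" (structure) and d P e \<xi> \<zeta> +
  fixes B :: "(nat \<times> (nat \<times> nat)) set" and coef :: "nat \<times> (nat \<times> nat) \<Rightarrow> nat \<times> (nat \<times> nat) \<Rightarrow> 'k"
  assumes B_subset: "B \<subseteq> {..<d} \<times> P"
    and coef_dual: "b \<in> B \<Longrightarrow> b' \<in> B \<Longrightarrow> coef b b' = delta b b'"
    and coef_kills: "b \<in> B \<Longrightarrow> t \<in> triples d \<Longrightarrow>
      (\<Sum>q\<in>{..<d} \<times> P. coef b q * jacobi_relation \<gamma> t q) = 0"
    and w_spanned: "VectorSpace.subspace class_ring S T \<Longrightarrow> (\<And>b. b \<in> B \<Longrightarrow> w b \<in> S) \<Longrightarrow>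
      q \<in> {..<d} \<times> P \<Longrightarrow> w q \<in> S"

text \<open>Eliminating the Jacobi relations, which are independent and hold in the tensor square, yields \<open>B\<close>
  and its size.\<close>

lemma (in class_two_coordinates) basis_exists:
  assumes Q: "card (pairs d - P) \<le> 2"
  shows "\<exists>B coef. card B + card (triples d) = d * card P \<and> class_two_basis L d P e \<xi> \<zeta> B coef"
proof -
  interpret T: lie_algebra T by (rule tensor_square_lie_algebra)
  let ?I = "{..<d} \<times> P"
  have indep: "\<forall>t\<in>triples d. l t = 0"
    if "\<forall>q\<in>?I. (\<Sum>t\<in>triples d. l t * jacobi_relation \<gamma> t q) = 0" for l
  proof (rule jacobi_relations_independent[OF P_pairs Q _ _ that])
    show "\<gamma> j i p = - \<gamma> i j p" if "i < d" "j < d" "p \<in> P" for i j p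
      unfolding \<gamma>_def by (intro zeta_anticomm e_closed that)
    show "\<gamma> (fst q) (snd q) p = delta p q" if "p \<in> P" "q \<in> P" for p q
      unfolding \<gamma>_def using that by (rule zeta_z)
  qed
  have fin: "finite ?I" by simp
  have "\<exists>B coef \<mu>. B \<subseteq> ?I \<and> card B + card (triples d) = card ?I \<and>
    (\<forall>b\<in>B. \<forall>b'\<in>B. coef b b' = delta b b') \<and>
    (\<forall>b\<in>B. \<forall>t\<in>triples d. (\<Sum>q\<in>?I. coef b q * jacobi_relation \<gamma> t q) = 0) \<and>
    (\<forall>x\<in>?I. \<forall>y\<in>?I. delta x y =
      (\<Sum>b\<in>B. coef b x * delta b y) + (\<Sum>t\<in>triples d. \<mu> x t * jacobi_relation \<gamma> t y))"
    by (rule complement_of_independent[OF finite_triples fin]) (rule indep)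
  then obtain B coef \<mu> where B: "B \<subseteq> ?I" "card B + card (triples d) = card ?I"
    and dual: "\<forall>b\<in>B. \<forall>b'\<in>B. coef b b' = delta b b'"
    and kill: "\<forall>b\<in>B. \<forall>t\<in>triples d. (\<Sum>q\<in>?I. coef b q * jacobi_relation \<gamma> t q) = 0"
    and gen0: "\<forall>x\<in>?I. \<forall>y\<in>?I. delta x y =
      (\<Sum>b\<in>B. coef b x * delta b y) + (\<Sum>t\<in>triples d. \<mu> x t * jacobi_relation \<gamma> t y)"
    by (elim exE conjE) (rule that)
  note gen = gen0[rule_format]
  have "class_two_basis L d P e \<xi> \<zeta> B coef"
  proof
    fix S q
    assume S: "VectorSpace.subspace class_ring S T" and wS: "\<And>b. b \<in> B \<Longrightarrow> w b \<in> S" and q: "q \<in> ?I"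
    let ?f = "\<lambda>y. \<Sum>b\<in>B. coef b q * delta b y" and ?g = "\<lambda>y. \<Sum>t\<in>triples d. \<mu> q t * jacobi_relation \<gamma> t y"
    have "w q = (\<Oplus>\<^bsub>T\<^esub>y\<in>?I. delta q y \<odot>\<^bsub>T\<^esub> w y)"
      by (rule T.finsum_delta[symmetric]) (use q w_closed in auto)
    also have "\<dots> = (\<Oplus>\<^bsub>T\<^esub>y\<in>?I. ?f y \<odot>\<^bsub>T\<^esub> w y \<oplus>\<^bsub>T\<^esub> ?g y \<odot>\<^bsub>T\<^esub> w y)"
    proof (rule T.finsum_cong'[OF HOL.refl])
      fix y assume y: "y \<in> ?I"
      show "delta q y \<odot>\<^bsub>T\<^esub> w y = ?f y \<odot>\<^bsub>T\<^esub> w y \<oplus>\<^bsub>T\<^esub> ?g y \<odot>\<^bsub>T\<^esub> w y"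
        by (simp only: gen[OF q y] T.smult_plus[OF w_closed[OF y]])
    qed (intro funcsetI T.M.a_closed T.smult_in w_closed)
    also have "\<dots> = (\<Oplus>\<^bsub>T\<^esub>y\<in>?I. ?f y \<odot>\<^bsub>T\<^esub> w y) \<oplus>\<^bsub>T\<^esub> (\<Oplus>\<^bsub>T\<^esub>y\<in>?I. ?g y \<odot>\<^bsub>T\<^esub> w y)"
      by (intro T.finsum_addf funcsetI T.smult_in w_closed)
    also have "(\<Oplus>\<^bsub>T\<^esub>y\<in>?I. ?g y \<odot>\<^bsub>T\<^esub> w y) = \<zero>\<^bsub>T\<^esub>"
    proof -
      have "(\<Oplus>\<^bsub>T\<^esub>y\<in>?I. ?g y \<odot>\<^bsub>T\<^esub> w y) =
          (\<Oplus>\<^bsub>T\<^esub>t\<in>triples d. \<mu> q t \<odot>\<^bsub>T\<^esub> (\<Oplus>\<^bsub>T\<^esub>y\<in>?I. jacobi_relation \<gamma> t y \<odot>\<^bsub>T\<^esub> w y))"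
        by (rule T.finsum_combination) (rule w_closed)
      also have "\<dots> = \<zero>\<^bsub>T\<^esub>"
        by (rule T.finsum_all0) (simp only: jacobi_relation_tensor T.smult_zero)
      finally show ?thesis .
    qed
    also have "(\<Oplus>\<^bsub>T\<^esub>y\<in>?I. ?f y \<odot>\<^bsub>T\<^esub> w y) = (\<Oplus>\<^bsub>T\<^esub>b\<in>B. coef b q \<odot>\<^bsub>T\<^esub> w b)"
    proof -
      have "(\<Oplus>\<^bsub>T\<^esub>y\<in>?I. ?f y \<odot>\<^bsub>T\<^esub> w y) =
          (\<Oplus>\<^bsub>T\<^esub>b\<in>B. coef b q \<odot>\<^bsub>T\<^esub> (\<Oplus>\<^bsub>T\<^esub>y\<in>?I. delta b y \<odot>\<^bsub>T\<^esub> w y))"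
        by (rule T.finsum_combination) (rule w_closed)
      also have "\<dots> = (\<Oplus>\<^bsub>T\<^esub>b\<in>B. coef b q \<odot>\<^bsub>T\<^esub> w b)"
      proof (rule T.finsum_cong'[OF HOL.refl])
        fix b assume "b \<in> B"
        then have "(\<Oplus>\<^bsub>T\<^esub>y\<in>?I. delta b y \<odot>\<^bsub>T\<^esub> w y) = w b"
          using B(1) by (intro T.finsum_delta[OF fin] w_closed) auto
        then show "coef b q \<odot>\<^bsub>T\<^esub> (\<Oplus>\<^bsub>T\<^esub>y\<in>?I. delta b y \<odot>\<^bsub>T\<^esub> w y) = coef b q \<odot>\<^bsub>T\<^esub> w b" by simp
      qed (intro funcsetI T.smult_in w_closed subsetD[OF B(1)])
      finally show ?thesis .
    qed
    finally have "w q = (\<Oplus>\<^bsub>T\<^esub>b\<in>B. coef b q \<odot>\<^bsub>T\<^esub> w b) \<oplus>\<^bsub>T\<^esub> \<zero>\<^bsub>T\<^esub>" .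
    moreover have "(\<Oplus>\<^bsub>T\<^esub>b\<in>B. coef b q \<odot>\<^bsub>T\<^esub> w b) \<in> S"
      using S wS by (intro T.subspace_finsum[OF S]) (simp add: T.subspace_iff)
    ultimately show "w q \<in> S" using S by (simp add: T.subspace_iff)
  next
    show "B \<subseteq> ?I" by (rule B(1))
    show "coef b b' = delta b b'" if "b \<in> B" "b' \<in> B" for b b' using dual that by blast
    show "(\<Sum>q\<in>?I. coef b q * jacobi_relation \<gamma> t q) = 0" if "b \<in> B" "t \<in> triples d" for b t
      using kill that by blast
  qed
  then show ?thesis using B(2) by (auto simp: card_cartesian_product)
qed

context class_two_basis
begin

text \<open>The values on \<open>x \<otimes> y\<close> of the coordinate forms of the tensor square. Those belonging to \<open>B\<close> are
  antisymmetric because \<open>z \<otimes> x = - x \<otimes> z\<close> for derived \<open>z\<close>.\<close>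

definition tensor_form :: "(nat \<times> nat) + (nat \<times> (nat \<times> nat)) \<Rightarrow> 'v \<Rightarrow> 'v \<Rightarrow> 'k" where
  "tensor_form s x y = (case s of Inl (i, j) \<Rightarrow> \<xi> i x * \<xi> j y
     | Inr b \<Rightarrow> \<Sum>q\<in>{..<d} \<times> P. coef b q *
         (\<xi> (fst q) x * \<zeta> (snd q) y - \<xi> (fst q) y * \<zeta> (snd q) x))"

abbreviation index :: "((nat \<times> nat) + (nat \<times> (nat \<times> nat))) set" where
  "index \<equiv> ({..<d} \<times> {..<d}) <+> B"

definition basis_tensor ::
  "(nat \<times> nat) + (nat \<times> (nat \<times> nat)) \<Rightarrow> ('k, 'v \<times> 'v) lie_term set set" where
  "basis_tensor s = (case s of Inl (i, j) \<Rightarrow> tensor L (e i) (e j) | Inr b \<Rightarrow> w b)"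

lemma finite_B: "finite B"
  using B_subset by (rule finite_subset) auto

lemma basis_tensor_closed: "s \<in> index \<Longrightarrow> basis_tensor s \<in> carrier T"
  using B_subset w_closed e_closed by (auto simp: basis_tensor_def tensor_closed)

lemma tensor_form_linear:
  assumes s: "s \<in> index"
  shows "linear_form L (\<lambda>x. tensor_form s x y)" "linear_form L (tensor_form s x)"
proof -
  consider i j where "s = Inl (i, j)" "i < d" "j < d" | b where "s = Inr b" using s by auto
  then have "linear_form L (\<lambda>x. tensor_form s x y) \<and> linear_form L (tensor_form s x)"
  proof cases
    case 1
    then show ?thesis
      by (auto simp: tensor_form_def[abs_def]
        intro: linear_form_mult_const linear_form_const_mult xi_linear)
  next
    case 2
    have "linear_form L (\<lambda>x. \<Sum>q\<in>{..<d} \<times> P. coef b q *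
        (\<xi> (fst q) x * \<zeta> (snd q) y - \<xi> (fst q) y * \<zeta> (snd q) x))" for y
      by (rule linear_form_sum)
        (auto intro!: linear_form_diff linear_form_mult_const linear_form_const_mult
          xi_linear zeta_linear)
    moreover have "linear_form L (\<lambda>y. \<Sum>q\<in>{..<d} \<times> P. coef b q *
        (\<xi> (fst q) x * \<zeta> (snd q) y - \<xi> (fst q) y * \<zeta> (snd q) x))" for x
      by (rule linear_form_sum)
        (auto intro!: linear_form_diff linear_form_mult_const linear_form_const_mult
          xi_linear zeta_linear)
    ultimately show ?thesis using 2 by (simp add: tensor_form_def[abs_def])
  qed
  then show "linear_form L (\<lambda>x. tensor_form s x y)" "linear_form L (tensor_form s x)" by auto
qed

lemma tensor_form_bracket_bracket:
  assumes "s \<in> index" "x \<in> carrier L" "y \<in> carrier L" "x' \<in> carrier L" "y' \<in> carrier L"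
  shows "tensor_form s \<lblot>x, y\<rblot> \<lblot>x', y'\<rblot> = 0"
  using assms by (auto simp: tensor_form_def xi_bracket intro!: sum.neutral)

text \<open>Both bracket relations of the tensor square say that the cyclic sum vanishes.\<close>

lemma tensor_form_bracket_left:
  assumes s: "s \<in> index" and x: "x \<in> carrier L" and x': "x' \<in> carrier L" and y: "y \<in> carrier L"
  shows "tensor_form s \<lblot>x, x'\<rblot> y = tensor_form s x \<lblot>x', y\<rblot> - tensor_form s x' \<lblot>x, y\<rblot>"
proof -
  consider i j where "s = Inl (i, j)" "i < d" "j < d" | b where "s = Inr b" "b \<in> B" using s by auto
  then show ?thesis
  proof cases
    case 1
    then show ?thesis using x x' y by (simp add: tensor_form_def xi_bracket)
  next
    case 2
    have "tensor_form s \<lblot>x, x'\<rblot> y - (tensor_form s x \<lblot>x', y\<rblot> - tensor_form s x' \<lblot>x, y\<rblot>) =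
        - cyclic_form (coef b) x x' y"
      unfolding cyclic_form_def tensor_form_def 2 sum.case sum_subtractf[symmetric] sum_negf[symmetric]
    proof (rule sum.cong[OF HOL.refl])
      fix q assume "q \<in> {..<d} \<times> P"
      then have q: "fst q < d" "snd q \<in> P" by auto
      show "coef b q * (\<xi> (fst q) \<lblot>x, x'\<rblot> * \<zeta> (snd q) y - \<xi> (fst q) y * \<zeta> (snd q) \<lblot>x, x'\<rblot>) -
          (coef b q * (\<xi> (fst q) x * \<zeta> (snd q) \<lblot>x', y\<rblot> - \<xi> (fst q) \<lblot>x', y\<rblot> * \<zeta> (snd q) x) -
           coef b q * (\<xi> (fst q) x' * \<zeta> (snd q) \<lblot>x, y\<rblot> - \<xi> (fst q) \<lblot>x, y\<rblot> * \<zeta> (snd q) x')) =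
          - (coef b q * (\<xi> (fst q) x * \<zeta> (snd q) \<lblot>x', y\<rblot> + \<xi> (fst q) x' * \<zeta> (snd q) \<lblot>y, x\<rblot> +
            \<xi> (fst q) y * \<zeta> (snd q) \<lblot>x, x'\<rblot>))"
        using zeta_anticomm[OF q(2) x y] x x' y by (simp add: xi_bracket[OF q(1)] algebra_simps)
    qed
    also have "\<dots> = 0" using cyclic_form_zero[OF coef_kills[OF 2(2)] x x' y] by simp
    finally show ?thesis by simp
  qed
qed

lemma tensor_form_bracket_right:
  assumes s: "s \<in> index" and x: "x \<in> carrier L" and y: "y \<in> carrier L" and y': "y' \<in> carrier L"
  shows "tensor_form s x \<lblot>y, y'\<rblot> = tensor_form s \<lblot>y', x\<rblot> y - tensor_form s \<lblot>y, x\<rblot> y'"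
proof -
  consider i j where "s = Inl (i, j)" "i < d" "j < d" | b where "s = Inr b" "b \<in> B" using s by auto
  then show ?thesis
  proof cases
    case 1
    then show ?thesis using x y y' by (simp add: tensor_form_def xi_bracket)
  next
    case 2
    have "tensor_form s x \<lblot>y, y'\<rblot> - (tensor_form s \<lblot>y', x\<rblot> y - tensor_form s \<lblot>y, x\<rblot> y') =
        cyclic_form (coef b) x y y'"
      unfolding cyclic_form_def tensor_form_def 2 sum.case sum_subtractf[symmetric]
    proof (rule sum.cong[OF HOL.refl])
      fix q assume "q \<in> {..<d} \<times> P"
      then have q: "fst q < d" "snd q \<in> P" by auto
      show "coef b q * (\<xi> (fst q) x * \<zeta> (snd q) \<lblot>y, y'\<rblot> - \<xi> (fst q) \<lblot>y, y'\<rblot> * \<zeta> (snd q) x) -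
          (coef b q * (\<xi> (fst q) \<lblot>y', x\<rblot> * \<zeta> (snd q) y - \<xi> (fst q) y * \<zeta> (snd q) \<lblot>y', x\<rblot>) -
           coef b q * (\<xi> (fst q) \<lblot>y, x\<rblot> * \<zeta> (snd q) y' - \<xi> (fst q) y' * \<zeta> (snd q) \<lblot>y, x\<rblot>)) =
          coef b q * (\<xi> (fst q) x * \<zeta> (snd q) \<lblot>y, y'\<rblot> + \<xi> (fst q) y * \<zeta> (snd q) \<lblot>y', x\<rblot> +
            \<xi> (fst q) y' * \<zeta> (snd q) \<lblot>x, y\<rblot>)"
        using zeta_anticomm[OF q(2) x y] x y y' by (simp add: xi_bracket[OF q(1)] algebra_simps)
    qed
    also have "\<dots> = 0" by (rule cyclic_form_zero[OF coef_kills[OF 2(2)] x y y'])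
    finally show ?thesis by simp
  qed
qed

lemma form_exists:
  assumes s: "s \<in> index"
  shows "\<exists>f\<in>lie_hom T scalar_lie. \<forall>x\<in>carrier L. \<forall>y\<in>carrier L. f (tensor L x y) = tensor_form s x y"
proof (rule tensor_square_universal[OF scalar_lie_algebra])
  note lf = tensor_form_linear[OF s]
  show "tensor_form s (x \<oplus> x') y = tensor_form s x y \<oplus>\<^bsub>scalar_lie\<^esub> tensor_form s x' y"
    if "x \<in> carrier L" "x' \<in> carrier L" for x x' y
    using linear_form_add[OF lf(1) that] by simp
  show "tensor_form s x (y \<oplus> y') = tensor_form s x y \<oplus>\<^bsub>scalar_lie\<^esub> tensor_form s x y'"
    if "y \<in> carrier L" "y' \<in> carrier L" for x y y'
    using linear_form_add[OF lf(2) that] by simp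
  show "tensor_form s (c \<odot> x) y = c \<odot>\<^bsub>scalar_lie\<^esub> tensor_form s x y" if "x \<in> carrier L" for c x y
    using linear_form_smult[OF lf(1) that] by simp
  show "tensor_form s x (c \<odot> y) = c \<odot>\<^bsub>scalar_lie\<^esub> tensor_form s x y" if "y \<in> carrier L" for c x y
    using linear_form_smult[OF lf(2) that] by simp
  show "tensor_form s \<lblot>x, x'\<rblot> y =
      tensor_form s x \<lblot>x', y\<rblot> \<ominus>\<^bsub>scalar_lie\<^esub> tensor_form s x' \<lblot>x, y\<rblot>"
    if "x \<in> carrier L" "x' \<in> carrier L" "y \<in> carrier L" for x x' y
    unfolding scalar_lie_a_inv(2) by (rule tensor_form_bracket_left[OF s that])
  show "tensor_form s x \<lblot>y, y'\<rblot> =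
      tensor_form s \<lblot>y', x\<rblot> y \<ominus>\<^bsub>scalar_lie\<^esub> tensor_form s \<lblot>y, x\<rblot> y'"
    if "x \<in> carrier L" "y \<in> carrier L" "y' \<in> carrier L" for x y y'
    unfolding scalar_lie_a_inv(2) by (rule tensor_form_bracket_right[OF s that])
qed (simp_all add: tensor_form_bracket_bracket[OF s])

definition form :: "(nat \<times> nat) + (nat \<times> (nat \<times> nat)) \<Rightarrow> ('k, 'v \<times> 'v) lie_term set set \<Rightarrow> 'k" where
  "form s = (SOME f. f \<in> lie_hom T scalar_lie \<and>
     (\<forall>x\<in>carrier L. \<forall>y\<in>carrier L. f (tensor L x y) = tensor_form s x y))"

lemma form:
  assumes "s \<in> index"
  shows form_hom: "form s \<in> lie_hom T scalar_lie"
    and form_tensor: "\<And>x y. x \<in> carrier L \<Longrightarrow> y \<in> carrier L \<Longrightarrow> form s (tensor L x y) = tensor_form s x y"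
proof -
  let ?P = "\<lambda>f. f \<in> lie_hom T scalar_lie \<and>
     (\<forall>x\<in>carrier L. \<forall>y\<in>carrier L. f (tensor L x y) = tensor_form s x y)"
  have "\<exists>f. ?P f" using form_exists[OF assms] by blast
  then have "?P (form s)" unfolding form_def by (rule someI_ex)
  then show "form s \<in> lie_hom T scalar_lie"
    "\<And>x y. x \<in> carrier L \<Longrightarrow> y \<in> carrier L \<Longrightarrow> form s (tensor L x y) = tensor_form s x y" by auto
qed

lemma form_linear: "s \<in> index \<Longrightarrow> linear_form T (form s)"
  using form_hom by (simp add: lie_hom_scalar_iff)

lemma xi_z: "i < d \<Longrightarrow> p \<in> P \<Longrightarrow> \<xi> i (z p) = 0"
  unfolding z_def by (intro xi_bracket e_closed pair_less)

lemma form_dual: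
  assumes s: "s \<in> index" and s': "s' \<in> index"
  shows "form s (basis_tensor s') = delta s s'"
proof -
  have eP: "fst q < d" "snd q \<in> P" if "q \<in> B" for q using that B_subset by auto
  consider i' j' where "s' = Inl (i', j')" "i' < d" "j' < d" | b' where "s' = Inr b'" "b' \<in> B"
    using s' by auto
  then show ?thesis
  proof cases
    case s': 1
    have "form s (basis_tensor s') = tensor_form s (e i') (e j')"
      using s' form_tensor[OF s] e_closed by (simp add: basis_tensor_def)
    also have "\<dots> = delta s s'"
      using s s' by (auto simp: tensor_form_def xi_e zeta_e intro!: sum.neutral split: if_splits)
    finally show ?thesis .
  next
    case s': 2
    have 1: "form s (basis_tensor s') = tensor_form s (e (fst b')) (z (snd b'))"
      using s' form_tensor[OF s] e_closed z_closed eP by (simp add: basis_tensor_def)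
    consider i j where "s = Inl (i, j)" "i < d" "j < d" | b where "s = Inr b" "b \<in> B" using s by auto
    then show ?thesis
    proof cases
      case s: 1
      then show ?thesis using 1 s' eP by (simp add: tensor_form_def xi_z)
    next
      case s: 2
      have "tensor_form s (e (fst b')) (z (snd b')) =
          (\<Sum>q\<in>{..<d} \<times> P. if b' = q then coef b q else 0)"
        unfolding tensor_form_def s sum.case
      proof (rule sum.cong[OF HOL.refl])
        fix q assume "q \<in> {..<d} \<times> P"
        then have q: "fst q < d" "snd q \<in> P" by auto
        have "\<zeta> (snd q) (z (snd b')) = delta (snd q) (snd b')"
          unfolding z_def by (rule zeta_z[OF q(2) eP(2)[OF s'(2)]])
        then show "coef b q * (\<xi> (fst q) (e (fst b')) * \<zeta> (snd q) (z (snd b')) -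
            \<xi> (fst q) (z (snd b')) * \<zeta> (snd q) (e (fst b'))) = (if b' = q then coef b q else 0)"
          using q eP[OF s'(2)] by (auto simp: xi_e xi_z prod_eq_iff)
      qed
      also have "\<dots> = coef b b'" using s'(2) B_subset by (auto simp: sum.delta')
      also have "\<dots> = delta s s'" using coef_dual[OF s(2) s'(2)] s s' by simp
      finally show ?thesis using 1 by simp
    qed
  qed
qed

text \<open>As \<open>z\<^sub>p \<otimes> x = - x \<otimes> z\<^sub>p\<close> and \<open>z\<^sub>p \<otimes> z\<^sub>q = 0\<close>, the tensors \<open>e\<^sub>i \<otimes> e\<^sub>j\<close> and \<open>e\<^sub>i \<otimes> z\<^sub>p\<close> span.\<close>

lemma basis_tensors_span:
  assumes S: "VectorSpace.subspace class_ring S T" and BS: "\<And>s. s \<in> index \<Longrightarrow> basis_tensor s \<in> S"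
  shows "carrier T \<subseteq> S"
proof -
  interpret T: lie_algebra T by (rule tensor_square_lie_algebra)
  note S' = S[unfolded T.subspace_iff]
  have sub_l: "VectorSpace.subspace class_ring {x \<in> carrier L. tensor L x y \<in> S} L"
    if "y \<in> carrier L" for y
    using S' that by (simp add: subspace_iff tensor_add_left tensor_smult_left tensor_zero_left)
  have sub_r: "VectorSpace.subspace class_ring {y \<in> carrier L. tensor L x y \<in> S} L"
    if "x \<in> carrier L" for x
    using S' that by (simp add: subspace_iff tensor_add_right tensor_smult_right tensor_zero_right)
  have wS: "w q \<in> S" if "q \<in> {..<d} \<times> P" for q
  proof (rule w_spanned[OF S _ that])
    show "w b \<in> S" if "b \<in> B" for b using BS[OF InrI[OF that]] by (simp add: basis_tensor_def)
  qed
  have 1: "tensor L (e i) y \<in> S" if i: "i < d" and y: "y \<in> carrier L" for i y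
  proof -
    have "carrier L \<subseteq> {y \<in> carrier L. tensor L (e i) y \<in> S}"
    proof (rule generated[OF sub_r[OF e_closed[OF i]]])
      show "e j \<in> {y \<in> carrier L. tensor L (e i) y \<in> S}" if "j < d" for j
        using BS[OF InlI[of "(i, j)"]] i that e_closed by (simp add: basis_tensor_def)
      show "\<lblot>e (fst p), e (snd p)\<rblot> \<in> {y \<in> carrier L. tensor L (e i) y \<in> S}" if "p \<in> P" for p
        using wS[of "(i, p)"] i that z_closed[OF that] by (simp add: z_def)
    qed
    then show ?thesis using y by auto
  qed
  have 2: "tensor L (z p) y \<in> S" if p: "p \<in> P" and y: "y \<in> carrier L" for p y
  proof -
    have "carrier L \<subseteq> {y \<in> carrier L. tensor L (z p) y \<in> S}"
    proof (rule generated[OF sub_r[OF z_closed[OF p]]])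
      show "e j \<in> {y \<in> carrier L. tensor L (z p) y \<in> S}" if j: "j < d" for j
      proof -
        have "tensor L (z p) (e j) = \<ominus>\<^bsub>T\<^esub> tensor L (e j) (z p)"
          unfolding z_def by (intro tensor_bracket_swap e_closed pair_less[OF p] j)
        then show ?thesis
          using T.subspace_ominus[OF S 1[OF j z_closed[OF p]]] e_closed[OF j] by simp
      qed
      show "\<lblot>e (fst q), e (snd q)\<rblot> \<in> {y \<in> carrier L. tensor L (z p) y \<in> S}" if q: "q \<in> P" for q
      proof -
        have "tensor L (z p) \<lblot>e (fst q), e (snd q)\<rblot> = \<zero>\<^bsub>T\<^esub>"
          unfolding z_def by (intro tensor_bracket_bracket e_closed pair_less[OF p] pair_less[OF q])
        then show ?thesis using S' z_closed[OF q] by (simp add: z_def)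
      qed
    qed
    then show ?thesis using y by auto
  qed
  show ?thesis
  proof (rule tensor_square_spanned[OF S])
    fix x y assume xy: "x \<in> carrier L" "y \<in> carrier L"
    have "carrier L \<subseteq> {x \<in> carrier L. tensor L x y \<in> S}"
    proof (rule generated[OF sub_l[OF xy(2)]])
      show "e i \<in> {x \<in> carrier L. tensor L x y \<in> S}" if "i < d" for i
        using 1[OF that xy(2)] e_closed[OF that] by simp
      show "\<lblot>e (fst p), e (snd p)\<rblot> \<in> {x \<in> carrier L. tensor L x y \<in> S}" if "p \<in> P" for p
        using 2[OF that xy(2)] z_closed[OF that] by (simp add: z_def)
    qed
    then show "tensor L x y \<in> S" using xy by auto
  qed
qed

lemma tensor_square_coordinates: "coordinate_system T index basis_tensor form"
proof -
  interpret T: lie_algebra T by (rule tensor_square_lie_algebra)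
  show ?thesis
    by (rule T.coordinate_systemI_generates)
      (use finite_B basis_tensor_closed form_linear form_dual basis_tensors_span in auto)
qed

lemma tensor_square_isomorphic: "T \<cong>\<^sub>L abelian_lie (d * d + card B)"
proof -
  interpret T: lie_algebra T by (rule tensor_square_lie_algebra)
  have "card index = d * d + card B" using finite_B by (simp add: card_Plus card_cartesian_product)
  then show ?thesis
    using T.isomorphic_abelian_lie[OF tensor_square_coordinates tensor_square_abelian] by simp
qed

end

context class_two_basis
begin

abbreviation diagonal_ideal :: "('k, 'v \<times> 'v) lie_term set set set" where
  "diagonal_ideal \<equiv> ideal_generated T {tensor L x x | x. x \<in> carrier L}"

abbreviation E :: "('k, ('k, 'v \<times> 'v) lie_term set set set) lie" where
  "E \<equiv> T /\<^sub>L diagonal_ideal"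

abbreviation exterior_index :: "((nat \<times> nat) + (nat \<times> (nat \<times> nat))) set" where
  "exterior_index \<equiv> pairs d <+> B"

text \<open>The form dual to \<open>e\<^sub>i \<and> e\<^sub>j\<close> is the antisymmetrised form of the tensor square; the forms
  indexed by \<open>B\<close> are alternating already.\<close>

definition alternating_form ::
  "(nat \<times> nat) + (nat \<times> (nat \<times> nat)) \<Rightarrow> ('k, 'v \<times> 'v) lie_term set set \<Rightarrow> 'k" where
  "alternating_form s u = (case s of Inl (i, j) \<Rightarrow> form (Inl (i, j)) u - form (Inl (j, i)) u
     | Inr b \<Rightarrow> form s u)"

lemma exterior_index_subset: "exterior_index \<subseteq> index"
  by (auto simp: pairs_def)

lemma diagonal_subset: "{tensor L x x | x. x \<in> carrier L} \<subseteq> carrier T"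
  by (auto simp: tensor_closed)

lemma alternating_form_hom:
  assumes s: "s \<in> exterior_index"
  shows "alternating_form s \<in> lie_hom T scalar_lie"
proof -
  interpret T: lie_algebra T by (rule tensor_square_lie_algebra)
  consider i j where "s = Inl (i, j)" "i < d" "j < d" | b where "s = Inr b" "b \<in> B"
    using s by (auto simp: pairs_def)
  then show ?thesis
  proof cases
    case 1
    have 2: "Inl (i, j) \<in> index" "Inl (j, i) \<in> index" using 1 by auto
    have "linear_form T (\<lambda>u. form (Inl (i, j)) u - form (Inl (j, i)) u)"
      by (intro linear_form_diff form_linear 2)
    then show ?thesis
      using form_hom[OF 2(1)] form_hom[OF 2(2)]
      by (simp add: lie_hom_scalar_iff alternating_form_def[abs_def] 1)
  next
    case 2
    then show ?thesis using form_hom[of s] by (auto simp: alternating_form_def[abs_def])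
  qed
qed

lemma alternating_form_diagonal:
  assumes s: "s \<in> exterior_index" and x: "x \<in> carrier L"
  shows "alternating_form s (tensor L x x) = 0"
proof -
  consider i j where "s = Inl (i, j)" "i < d" "j < d" | b where "s = Inr b" "b \<in> B"
    using s by (auto simp: pairs_def)
  then show ?thesis
  proof cases
    case 1
    then show ?thesis using form_tensor[of "Inl (i, j)" x x] form_tensor[of "Inl (j, i)" x x] x
      by (simp add: alternating_form_def tensor_form_def InlI)
  next
    case 2
    then show ?thesis using form_tensor[of s x x] x
      by (auto simp: alternating_form_def tensor_form_def)
  qed
qed

text \<open>The images of the \<open>e\<^sub>i \<otimes> e\<^sub>j\<close> with \<open>i \<ge> j\<close> are redundant, since \<open>x \<and> x = 0\<close> and
  \<open>y \<and> x = - x \<and> y\<close>.\<close>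

lemma exterior_square_coordinates:
  "\<exists>t c. coordinate_system (exterior_square L) exterior_index t c"
proof -
  interpret T: lie_algebra T by (rule tensor_square_lie_algebra)
  interpret J: lie_algebra_ideal T diagonal_ideal
    by (intro lie_algebra_ideal.intro lie_algebra_ideal_axioms.intro T.lie_algebra_axioms
      lie_ideal_ideal_generated(1) diagonal_subset)
  have E: "exterior_square L = E" by (simp add: exterior_square_def)
  interpret E: lie_algebra E by (rule J.quotient_lie_algebra)
  let ?p = "\<lambda>u. diagonal_ideal +>\<^bsub>T\<^esub> u"
  note p = lie_homD[OF J.quotient_hom]
  have ex: "\<exists>f. f \<in> lie_hom E scalar_lie \<and>
      (\<forall>u\<in>carrier T. f (?p u) = alternating_form s u)" if s: "s \<in> exterior_index" for s
  proof -
    have "alternating_form s a = \<zero>\<^bsub>scalar_lie\<^esub>" if "a \<in> {tensor L x x | x. x \<in> carrier L}" for a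
      using that alternating_form_diagonal[OF s] by auto
    from ideal_generated_universal[OF T.lie_algebra_axioms scalar_lie_algebra diagonal_subset
        alternating_form_hom[OF s] this]
    show ?thesis by blast
  qed
  define c where "c = (\<lambda>s. SOME f. f \<in> lie_hom E scalar_lie \<and>
      (\<forall>u\<in>carrier T. f (?p u) = alternating_form s u))"
  have c_ex: "c s \<in> lie_hom E scalar_lie \<and>
      (\<forall>u\<in>carrier T. c s (?p u) = alternating_form s u)" if "s \<in> exterior_index" for s
    unfolding c_def by (rule someI_ex[OF ex[OF that]])
  have c: "linear_form E (c s)" if "s \<in> exterior_index" for s
    using c_ex[OF that] by (simp add: lie_hom_scalar_iff)
  have c_p: "c s (?p u) = alternating_form s u" if "s \<in> exterior_index" "u \<in> carrier T" for s u
    using c_ex[OF that(1)] that(2) by blast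
  have diag: "?p (tensor L x x) = \<zero>\<^bsub>E\<^esub>" if "x \<in> carrier L" for x
  proof -
    have "tensor L x x \<in> diagonal_ideal"
      using lie_ideal_ideal_generated(2)[OF T.lie_algebra_axioms diagonal_subset] that by blast
    then show ?thesis using that by (simp add: J.quotient_zero J.coset_zero_iff tensor_closed)
  qed
  have anti: "?p (tensor L y x) = \<ominus>\<^bsub>E\<^esub> ?p (tensor L x y)"
    if x: "x \<in> carrier L" and y: "y \<in> carrier L" for x y
  proof -
    note cl = tensor_closed[OF x x] tensor_closed[OF x y] tensor_closed[OF y x] tensor_closed[OF y y]
    have "\<zero>\<^bsub>E\<^esub> = ?p (tensor L (x \<oplus> y) (x \<oplus> y))"
      using diag[of "x \<oplus> y"] x y by simp
    also have "tensor L (x \<oplus> y) (x \<oplus> y) =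
        (tensor L x x \<oplus>\<^bsub>T\<^esub> tensor L y x) \<oplus>\<^bsub>T\<^esub> (tensor L x y \<oplus>\<^bsub>T\<^esub> tensor L y y)"
      using x y by (simp add: tensor_add_left tensor_add_right)
    also have "?p \<dots> = ?p (tensor L y x) \<oplus>\<^bsub>E\<^esub> ?p (tensor L x y)"
      using cl p(1)[OF cl(2)] p(1)[OF cl(3)] by (simp add: p(2) diag[OF x] diag[OF y])
    finally have "?p (tensor L y x) \<oplus>\<^bsub>E\<^esub> ?p (tensor L x y) =
        \<zero>\<^bsub>E\<^esub>"
      by (rule HOL.sym)
    then show ?thesis using E.M.minus_equality[OF _ p(1)[OF cl(2)] p(1)[OF cl(3)]] by simp
  qed
  have "coordinate_system E exterior_index (\<lambda>s. ?p (basis_tensor s)) c"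
  proof (rule E.coordinate_systemI_generates)
    show "finite exterior_index" using finite_B by simp
    show "?p (basis_tensor s) \<in> carrier E" if "s \<in> exterior_index" for s
      using that exterior_index_subset by (intro p(1) basis_tensor_closed) auto
    show "linear_form E (c s)" if "s \<in> exterior_index" for s
      using that by (rule c)
    show "c s (?p (basis_tensor s')) = delta s s'"
      if s: "s \<in> exterior_index" and s': "s' \<in> exterior_index" for s s'
    proof -
      have s'i: "s' \<in> index" using s' exterior_index_subset by auto
      have "c s (?p (basis_tensor s')) = alternating_form s (basis_tensor s')"
        by (rule c_p[OF s basis_tensor_closed[OF s'i]])
      also have "\<dots> = delta s s'"
      proof -
        consider i j where "s = Inl (i, j)" "i < j" "j < d" | b where "s = Inr b" "b \<in> B"
          using s by (auto simp: pairs_def)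
        then show ?thesis
        proof cases
          case 1
          then have "Inl (i, j) \<in> index" "Inl (j, i) \<in> index" by auto
          moreover have "Inl (j, i) \<noteq> s'" using s' 1 by (auto simp: pairs_def)
          ultimately show ?thesis using 1 s'i by (simp add: alternating_form_def form_dual)
        next
          case 2
          then have "s \<in> index" by auto
          from form_dual[OF this s'i] show ?thesis using 2 by (simp add: alternating_form_def)
        qed
      qed
      finally show ?thesis .
    qed
    fix S assume S: "VectorSpace.subspace class_ring S E"
      and BS: "\<And>s. s \<in> exterior_index \<Longrightarrow> ?p (basis_tensor s) \<in> S"
    note S' = S[unfolded E.subspace_iff]
    let ?S = "{u \<in> carrier T. ?p u \<in> S}"
    have "?p \<zero>\<^bsub>T\<^esub> = \<zero>\<^bsub>E\<^esub>"
      by (rule lie_hom_linear(1)[OF T.lie_algebra_axioms E.lie_algebra_axioms J.quotient_hom])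
    then have sub: "VectorSpace.subspace class_ring ?S T"
      unfolding T.subspace_iff using S' by (simp add: p)
    have "carrier T \<subseteq> ?S"
    proof (rule basis_tensors_span[OF sub])
      fix s assume s: "s \<in> index"
      have "?p (basis_tensor s) \<in> S"
      proof -
        consider "s \<in> exterior_index" | i where "s = Inl (i, i)" "i < d"
          | i j where "s = Inl (i, j)" "j < i" "i < d"
        proof -
          consider i j where "s = Inl (i, j)" "i < d" "j < d" | "s \<in> exterior_index"
            using s by auto
          then show ?thesis
          proof cases
            case 1
            then consider "i < j" | "i = j" | "j < i" by linarith
            then show ?thesis using that 1 by cases (auto simp: pairs_def)
          qed (rule that(1))
        qed
        then show ?thesis
        proof cases
          case 2
          then show ?thesis using diag[OF e_closed] S' by (simp add: basis_tensor_def)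
        next
          case 3
          then have "?p (basis_tensor (Inl (j, i))) \<in> S" by (intro BS) (auto simp: pairs_def)
          then show ?thesis
            using 3 anti[of "e j" "e i"] e_closed E.subspace_ominus[OF S]
            by (simp add: basis_tensor_def)
        qed (rule BS)
      qed
      then show "basis_tensor s \<in> ?S" using basis_tensor_closed[OF s] by simp
    qed
    then show "carrier E \<subseteq> S" by (auto simp: J.quotient_carrier)
  qed
  then show ?thesis unfolding E by blast
qed

lemma exterior_square_isomorphic: "exterior_square L \<cong>\<^sub>L abelian_lie (card (pairs d) + card B)"
proof -
  interpret T: lie_algebra T by (rule tensor_square_lie_algebra)
  interpret J: lie_algebra_ideal T diagonal_ideal
    by (intro lie_algebra_ideal.intro lie_algebra_ideal_axioms.intro T.lie_algebra_axioms
      lie_ideal_ideal_generated(1) diagonal_subset)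
  have E: "exterior_square L = E" by (simp add: exterior_square_def)
  interpret E: lie_algebra E by (rule J.quotient_lie_algebra)
  obtain t c where tc: "coordinate_system E exterior_index t c"
    using exterior_square_coordinates unfolding E by blast
  have "\<lblot>u, v\<rblot>\<^bsub>E\<^esub> = \<zero>\<^bsub>E\<^esub>"
    if uv: "u \<in> carrier E" "v \<in> carrier E" for u v
  proof -
    obtain u' v' where uv': "u' \<in> carrier T" "v' \<in> carrier T" "u = diagonal_ideal +>\<^bsub>T\<^esub> u'"
      "v = diagonal_ideal +>\<^bsub>T\<^esub> v'"
      using uv by (auto simp: J.quotient_carrier)
    then show ?thesis
      by (simp add: J.quotient_bracket tensor_square_abelian J.quotient_zero J.coset_zero_iff)
  qed
  from E.isomorphic_abelian_lie[OF tc this] show ?thesis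
    unfolding E using finite_B by (simp add: card_Plus)
qed

text \<open>The commutator map in coordinates. Since \<open>\<gamma>\<close> is the identity matrix on \<open>P\<close>, on the kernel this
  expresses the coordinates indexed by \<open>P\<close> by those of the other pairs.\<close>

lemma zeta_commutator_map:
  assumes p: "p \<in> P" and u: "u \<in> carrier T"
  shows "\<zeta> p (commutator_map L u) = (\<Sum>q\<in>{..<d} \<times> {..<d}. \<gamma> (fst q) (snd q) p * form (Inl q) u)"
proof -
  interpret T: lie_algebra T by (rule tensor_square_lie_algebra)
  note k = lie_homD[OF commutator_map_hom]
  have kc: "commutator_map L u \<in> carrier L" if "u \<in> carrier T" for u
    using k(1)[OF that] derived_closed by simp
  let ?r = "\<lambda>u. \<Sum>q\<in>{..<d} \<times> {..<d}. \<gamma> (fst q) (snd q) p * form (Inl q) u"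
  let ?S = "{u \<in> carrier T. \<zeta> p (commutator_map L u) = ?r u}"
  have "linear_form T (\<lambda>u. \<zeta> p (commutator_map L u))"
    by (rule linear_formI)
      (simp_all add: k kc linear_form_add[OF zeta_linear[OF p]] linear_form_smult[OF zeta_linear[OF p]])
  moreover have "linear_form T ?r" by (intro linear_form_sum form_linear InlI)
  ultimately have sub: "VectorSpace.subspace class_ring ?S T" by (rule T.linear_form_kernel_subspace)
  have "carrier T \<subseteq> ?S"
  proof (rule basis_tensors_span[OF sub])
    fix s assume s: "s \<in> index"
    have r: "?r (basis_tensor s) =
        (\<Sum>q\<in>{..<d} \<times> {..<d}. if Inl q = s then \<gamma> (fst q) (snd q) p else 0)"
    proof (rule sum.cong[OF HOL.refl])
      fix q assume q: "q \<in> {..<d} \<times> {..<d}"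
      show "\<gamma> (fst q) (snd q) p * form (Inl q) (basis_tensor s) =
          (if Inl q = s then \<gamma> (fst q) (snd q) p else 0)"
        by (simp add: form_dual[OF InlI[OF q] s])
    qed
    consider i j where "s = Inl (i, j)" "i < d" "j < d" | b where "s = Inr b" "b \<in> B" using s by auto
    then have "\<zeta> p (commutator_map L (basis_tensor s)) = ?r (basis_tensor s)"
    proof cases
      case 1
      then have "?r (basis_tensor s) = \<gamma> i j p" unfolding r by (simp add: sum.delta)
      then show ?thesis using 1 e_closed by (simp add: basis_tensor_def commutator_map_tensor \<gamma>_def)
    next
      case 2
      then have b: "fst b < d" "snd b \<in> P" using B_subset by auto
      have "\<lblot>e (fst b), z (snd b)\<rblot> = \<zero>" by (rule derived_central(2)[OF z_derived[OF b(2)] e_closed[OF b(1)]])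
      then show ?thesis unfolding r using 2 b e_closed z_closed
        by (simp add: basis_tensor_def commutator_map_tensor linear_form_zero[OF zeta_linear[OF p]])
    qed
    then show "basis_tensor s \<in> ?S" using basis_tensor_closed[OF s] by simp
  qed
  then show ?thesis using u by auto
qed

lemma commutator_map_zero_iff:
  assumes u: "u \<in> carrier T"
  shows "commutator_map L u = \<zero> \<longleftrightarrow> (\<forall>p\<in>P. \<zeta> p (commutator_map L u) = 0)"
proof -
  have "commutator_map L u \<in> lie_derived L" using lie_homD(1)[OF commutator_map_hom u] by simp
  then show ?thesis
    using derived_separated[of "commutator_map L u"] linear_form_zero[OF zeta_linear] by metis
qed

abbreviation kernel_index :: "((nat \<times> nat) + (nat \<times> (nat \<times> nat))) set" where
  "kernel_index \<equiv> ({..<d} \<times> {..<d} - P) <+> B"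

text \<open>Subtracting from \<open>e\<^sub>i \<otimes> e\<^sub>j\<close> the combination of the tensors indexed by \<open>P\<close> with the same commutator
  gives an element of the kernel without changing its coordinates outside \<open>P\<close>.\<close>

definition kernel_basis ::
  "(nat \<times> nat) + (nat \<times> (nat \<times> nat)) \<Rightarrow> ('k, 'v \<times> 'v) lie_term set set" where
  "kernel_basis s = (case s of
     Inl (i, j) \<Rightarrow> basis_tensor s \<ominus>\<^bsub>T\<^esub> (\<Oplus>\<^bsub>T\<^esub>p\<in>P. \<gamma> i j p \<odot>\<^bsub>T\<^esub> basis_tensor (Inl p))
   | Inr b \<Rightarrow> basis_tensor s)"

lemma P_index: "p \<in> P \<Longrightarrow> Inl p \<in> index"
  using pair_less[of p] by (cases p) auto

lemma kernel_index_subset: "s \<in> kernel_index \<Longrightarrow> s \<in> index"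
  by auto

lemma kernel_basis_closed: "s \<in> kernel_index \<Longrightarrow> kernel_basis s \<in> carrier T"
proof -
  interpret T: lie_algebra T by (rule tensor_square_lie_algebra)
  assume s: "s \<in> kernel_index"
  have "(\<Oplus>\<^bsub>T\<^esub>p\<in>P. \<gamma> i j p \<odot>\<^bsub>T\<^esub> basis_tensor (Inl p)) \<in> carrier T" for i j
    by (intro T.finsum_closed funcsetI T.smult_in basis_tensor_closed P_index)
  then show "kernel_basis s \<in> carrier T"
    using basis_tensor_closed[OF kernel_index_subset[OF s]]
    by (cases s) (simp_all add: kernel_basis_def split_def)
qed

lemma form_kernel_basis:
  assumes f: "s \<in> index" and s': "s' \<in> kernel_index"
  shows "form s (kernel_basis s') = delta s s' -
    (case s of Inl p \<Rightarrow> (case s' of Inl (i, j) \<Rightarrow> if p \<in> P then \<gamma> i j p else 0 | Inr b \<Rightarrow> 0) | Inr b \<Rightarrow> 0)"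
proof -
  interpret T: lie_algebra T by (rule tensor_square_lie_algebra)
  note lf = form_linear[OF f]
  consider i j where "s' = Inl (i, j)" | b where "s' = Inr b" by (cases s') auto
  then show ?thesis
  proof cases
    case 1
    let ?y = "\<Oplus>\<^bsub>T\<^esub>p\<in>P. \<gamma> i j p \<odot>\<^bsub>T\<^esub> basis_tensor (Inl p)"
    have y: "?y \<in> carrier T"
      by (intro T.finsum_closed funcsetI T.smult_in basis_tensor_closed P_index)
    have "form s ?y = (\<Sum>p\<in>P. \<gamma> i j p * form s (basis_tensor (Inl p)))"
      by (rule T.linear_form_finsum[OF lf]) (rule basis_tensor_closed[OF P_index])
    also have "\<dots> = (\<Sum>p\<in>P. if s = Inl p then \<gamma> i j p else 0)"
      by (intro sum.cong HOL.refl) (simp add: form_dual[OF f P_index])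
    also have "\<dots> = (case s of Inl p \<Rightarrow> if p \<in> P then \<gamma> i j p else 0 | Inr b \<Rightarrow> 0)"
      by (cases s) (auto simp: sum.delta)
    finally show ?thesis
      using 1 T.linear_form_minus[OF lf basis_tensor_closed[OF kernel_index_subset[OF s']] y]
        form_dual[OF f kernel_index_subset[OF s']]
      by (simp add: kernel_basis_def split: sum.split)
  next
    case 2
    then show ?thesis
      using form_dual[OF f kernel_index_subset[OF s']]
      by (simp add: kernel_basis_def split: sum.split)
  qed
qed

lemma kernel_basis_in_kernel:
  assumes s: "s \<in> kernel_index"
  shows "commutator_map L (kernel_basis s) = \<zero>"
  unfolding commutator_map_zero_iff[OF kernel_basis_closed[OF s]]
proof
  fix p assume p: "p \<in> P"
  let ?g = "\<lambda>q. \<gamma> (fst q) (snd q) p"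
  have 1: "\<zeta> p (commutator_map L (kernel_basis s)) =
      (\<Sum>q\<in>{..<d} \<times> {..<d}. ?g q * form (Inl q) (kernel_basis s))"
    by (rule zeta_commutator_map[OF p kernel_basis_closed[OF s]])
  consider i j where "s = Inl (i, j)" "i < d" "j < d" | b where "s = Inr b" using s by auto
  then show "\<zeta> p (commutator_map L (kernel_basis s)) = 0"
  proof cases
    case 2
    have "form (Inl q) (kernel_basis s) = 0" if q: "q \<in> {..<d} \<times> {..<d}" for q
      using form_kernel_basis[OF InlI[OF q] s] 2 by simp
    then show ?thesis unfolding 1 by (intro sum.neutral ballI) simp
  next
    case s': 1
    have "(\<Sum>q\<in>{..<d} \<times> {..<d}. ?g q * form (Inl q) (kernel_basis s)) =
        (\<Sum>q\<in>{..<d} \<times> {..<d}. (if q = (i, j) then ?g q else 0) -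
          (if q \<in> P then ?g q * \<gamma> i j q else 0))"
    proof (rule sum.cong[OF HOL.refl])
      fix q assume q: "q \<in> {..<d} \<times> {..<d}"
      have f: "form (Inl q) (kernel_basis s) = delta q (i, j) - (if q \<in> P then \<gamma> i j q else 0)"
        using form_kernel_basis[OF InlI[OF q] s] s'(1) by simp
      show "?g q * form (Inl q) (kernel_basis s) =
          (if q = (i, j) then ?g q else 0) - (if q \<in> P then ?g q * \<gamma> i j q else 0)"
        unfolding f by (simp add: right_diff_distrib)
    qed
    also have "\<dots> = \<gamma> i j p - (\<Sum>q\<in>{..<d} \<times> {..<d}. if q \<in> P then ?g q * \<gamma> i j q else 0)"
      using s' by (simp add: sum_subtractf)
    also have "(\<Sum>q\<in>{..<d} \<times> {..<d}. if q \<in> P then ?g q * \<gamma> i j q else 0) = (\<Sum>q\<in>P. ?g q * \<gamma> i j q)"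
      by (rule sum.mono_neutral_cong_right) (use pair_less in \<open>auto simp: mem_Times_iff\<close>)
    also have "\<dots> = (\<Sum>q\<in>P. if p = q then \<gamma> i j q else 0)"
      by (intro sum.cong HOL.refl) (simp add: \<gamma>_def zeta_z[OF p])
    also have "\<dots> = \<gamma> i j p" using p by simp
    finally show ?thesis unfolding 1 by simp
  qed
qed

lemma J2_isomorphic: "J2 L \<cong>\<^sub>L abelian_lie (d * d - card P + card B)"
proof -
  interpret T: lie_algebra T by (rule tensor_square_lie_algebra)
  let ?K = "{u \<in> carrier T. commutator_map L u = \<zero>}"
  have J2: "J2 L = T\<lparr>carrier := ?K\<rparr>" by (simp add: J2_def)
  note k = lie_homD[OF commutator_map_hom]
  have k0: "commutator_map L \<zero>\<^bsub>T\<^esub> = \<zero>"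
    using lie_hom_linear(1)[OF T.lie_algebra_axioms derived_lie_algebra commutator_map_hom] by simp
  have sub: "VectorSpace.subspace class_ring ?K T"
    unfolding T.subspace_iff using k k0 by simp
  interpret K: lie_algebra "T\<lparr>carrier := ?K\<rparr>"
    by (rule T.subalgebra[OF sub]) (simp add: tensor_square_abelian k0)
  have coords: "coordinate_system (T\<lparr>carrier := ?K\<rparr>) kernel_index kernel_basis form"
    unfolding coordinate_system_def
  proof (intro conjI ballI impI)
    show "finite kernel_index" using finite_B by simp
    show "kernel_basis s \<in> carrier (T\<lparr>carrier := ?K\<rparr>)" if "s \<in> kernel_index" for s
      using kernel_basis_closed[OF that] kernel_basis_in_kernel[OF that] by simp
    show "linear_form (T\<lparr>carrier := ?K\<rparr>) (form s)" if "s \<in> kernel_index" for s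
      using form_linear[OF kernel_index_subset[OF that]] by (simp add: linear_form_def)
    show "form s (kernel_basis s') = delta s s'" if s: "s \<in> kernel_index" and s': "s' \<in> kernel_index" for s s'
    proof -
      note f = form_kernel_basis[OF kernel_index_subset[OF s] s']
      consider q where "s = Inl q" "q \<notin> P" | b where "s = Inr b" using s by auto
      then show ?thesis
      proof cases
        case 1
        then show ?thesis unfolding f by (cases s') (simp_all add: split_def)
      next
        case 2
        then show ?thesis unfolding f by simp
      qed
    qed
    fix u assume u: "u \<in> carrier (T\<lparr>carrier := ?K\<rparr>)" and z: "\<forall>s\<in>kernel_index. form s u = 0"
    have uT: "u \<in> carrier T" and uK: "commutator_map L u = \<zero>" using u by auto
    have "form (Inl p) u = 0" if p: "p \<in> P" for p
    proof -
      have "0 = \<zeta> p (commutator_map L u)"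
        using linear_form_zero[OF zeta_linear[OF p]] uK by simp
      also have "\<dots> = (\<Sum>q\<in>{..<d} \<times> {..<d}. \<gamma> (fst q) (snd q) p * form (Inl q) u)"
        by (rule zeta_commutator_map[OF p uT])
      also have "\<dots> = (\<Sum>q\<in>P. \<gamma> (fst q) (snd q) p * form (Inl q) u)"
      proof (rule sum.mono_neutral_right)
        show "P \<subseteq> {..<d} \<times> {..<d}" using pair_less by (auto simp: mem_Times_iff)
        show "\<forall>q\<in>{..<d} \<times> {..<d} - P. \<gamma> (fst q) (snd q) p * form (Inl q) u = 0"
          using z by (auto intro!: InlI)
      qed simp
      also have "\<dots> = (\<Sum>q\<in>P. if p = q then form (Inl q) u else 0)"
        by (intro sum.cong HOL.refl) (simp add: \<gamma>_def zeta_z[OF p])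
      also have "\<dots> = form (Inl p) u" using p by simp
      finally show ?thesis by simp
    qed
    then have zero: "form s u = 0" if s: "s \<in> index" for s
    proof (cases "s \<in> kernel_index")
      case False
      then obtain p where "s = Inl p" "p \<in> P" using s by auto
      then show ?thesis using \<open>\<And>p. p \<in> P \<Longrightarrow> form (Inl p) u = 0\<close> by simp
    qed (use z in blast)
    have "\<forall>x\<in>carrier T. (\<forall>s\<in>index. form s x = 0) \<longrightarrow> x = \<zero>\<^bsub>T\<^esub>"
      using tensor_square_coordinates unfolding coordinate_system_def by (elim conjE)
    with uT zero have "u = \<zero>\<^bsub>T\<^esub>" by simp
    then show "u = \<zero>\<^bsub>T\<lparr>carrier := ?K\<rparr>\<^esub>" by simp
  qed
  have card: "card kernel_index = d * d - card P + card B"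
  proof -
    have "P \<subseteq> {..<d} \<times> {..<d}" using pair_less by (auto simp: mem_Times_iff)
    then show ?thesis
      using finite_B by (simp add: card_Plus card_Diff_subset card_cartesian_product)
  qed
  have "\<lblot>u, v\<rblot>\<^bsub>T\<lparr>carrier := ?K\<rparr>\<^esub> = \<zero>\<^bsub>T\<lparr>carrier := ?K\<rparr>\<^esub>"
    if "u \<in> carrier (T\<lparr>carrier := ?K\<rparr>)" "v \<in> carrier (T\<lparr>carrier := ?K\<rparr>)" for u v
    using that by (simp add: tensor_square_abelian)
  from K.isomorphic_abelian_lie[OF coords this] show ?thesis unfolding J2 card .
qed

end

section \<open>The dimensions for generalized Heisenberg algebras\<close>

lemma heisenberg_class_two:
  assumes "generalized_heisenberg L m"
  shows "class_two L"
proof -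
  interpret lie_algebra L using assms by (simp add: generalized_heisenberg_def)
  show ?thesis
  proof
    show "\<lblot>\<lblot>x, y\<rblot>\<^bsub>L\<^esub>, u\<rblot>\<^bsub>L\<^esub> = \<zero>\<^bsub>L\<^esub>" if "x \<in> carrier L" "y \<in> carrier L" "u \<in> carrier L" for x y u
      using bracket_in_derived[OF that(1,2)] assms that(3)
      by (simp add: generalized_heisenberg_def lie_centre_def)
  qed
qed

text \<open>The number \<open>b\<close> is the dimension of the span of the tensors \<open>e\<^sub>i \<otimes> z\<^sub>p\<close>. The theorem consists of the
  cases \<open>r = 1\<close> and \<open>r = 2\<close>.\<close>

lemma heisenberg_dimensions:
  assumes H: "generalized_heisenberg L m" and d: "generator_number L d"
    and rank: "card (pairs d) = m + r" and r: "r \<le> 2"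
  shows "\<exists>b. b + card (triples d) = d * m \<and>
    exterior_square L \<cong>\<^sub>L abelian_lie (card (pairs d) + b) \<and>
    tensor_square L \<cong>\<^sub>L abelian_lie (d * d + b) \<and>
    J2 L \<cong>\<^sub>L abelian_lie (d * d - m + b)"
proof -
  interpret class_two L using H by (rule heisenberg_class_two)
  have "has_dim (L\<lparr>carrier := lie_derived L\<rparr>) m" using H unfolding generalized_heisenberg_def by blast
  moreover have "has_dim (L /\<^sub>L lie_derived L) d" using d by (simp add: generator_number_def)
  ultimately obtain P e \<xi> \<zeta> where P: "card P = m" "class_two_coordinates L d P e \<xi> \<zeta>"
    using coordinates_exist by blast
  interpret class_two_coordinates L d P e \<xi> \<zeta> by (rule P)
  have "card (pairs d - P) = r"
    using card_Diff_subset[OF finite_P P_pairs] P(1) rank by simp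
  then obtain B coef where B: "card B + card (triples d) = d * m"
      "class_two_basis L d P e \<xi> \<zeta> B coef"
    using basis_exists r P(1) by auto
  interpret class_two_basis L d P e \<xi> \<zeta> B coef by (rule B)
  show ?thesis
    by (intro exI[of _ "card B"] conjI B(1) exterior_square_isomorphic tensor_square_isomorphic
      J2_isomorphic[unfolded P(1)])
qed

theorem theorem2p7:
  fixes L :: "('k::field, 'v) lie" and d m :: nat
  assumes "generalized_heisenberg L m" and "generator_number L d"
  shows "(real m = 1/2 * real d * (real d - 1) - 1 \<longrightarrow>
      (\<exists>n. real n = 1/6 * (real d - 1) * (2 * real d ^ 2 + 5 * real d - 6) - 1
         \<and> exterior_square L \<cong>\<^sub>L abelian_lie n) \<and>
      (\<exists>n. real n = 1/3 * real d * (real d ^ 2 + 3 * real d - 4)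
         \<and> tensor_square L \<cong>\<^sub>L abelian_lie n) \<and>
      (\<exists>n. real n = 1/6 * real d * (2 * real d ^ 2 + 3 * real d - 5) + 1
         \<and> J2 L \<cong>\<^sub>L abelian_lie n))
    \<and> (real m = 1/2 * real d * (real d - 1) - 2 \<longrightarrow>
      (\<exists>n. real n = 1/6 * (real d - 1) * (2 * real d ^ 2 + 5 * real d - 12) - 2
         \<and> exterior_square L \<cong>\<^sub>L abelian_lie n) \<and>
      (\<exists>n. real n = 1/3 * real d * (real d ^ 2 + 3 * real d - 7)
         \<and> tensor_square L \<cong>\<^sub>L abelian_lie n) \<and>
      (\<exists>n. real n = 1/6 * real d * (2 * real d ^ 2 + 3 * real d - 11) + 2
         \<and> J2 L \<cong>\<^sub>L abelian_lie n))"
proof -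
  define D N Q M where "D = real d" and "N = real (card (pairs d))"
    and "Q = real (card (triples d))" and "M = real m"
  have N: "N = (D * D - D) / 2"
    using arg_cong[OF card_pairs[of d], of real] by (simp add: D_def N_def)
  have Q: "Q = (D * D * D - 3 * D * D + 2 * D) / 6"
    using arg_cong[OF card_triples[of d], of real] by (simp add: D_def Q_def)
  have dims: "(\<exists>n. real n = N + (D * M - Q) \<and> exterior_square L \<cong>\<^sub>L abelian_lie n) \<and>
      (\<exists>n. real n = D * D + (D * M - Q) \<and> tensor_square L \<cong>\<^sub>L abelian_lie n) \<and>
      (\<exists>n. real n = D * D - M + (D * M - Q) \<and> J2 L \<cong>\<^sub>L abelian_lie n)"
    if rank: "M = N - real r" and r: "r \<le> 2" for r
  proof -
    have "real (card (pairs d)) = real (m + r)" using rank by (simp add: M_def N_def)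
    then have mr: "card (pairs d) = m + r" by (simp only: of_nat_eq_iff)
    from heisenberg_dimensions[OF assms this r] obtain b where b: "b + card (triples d) = d * m"
      "exterior_square L \<cong>\<^sub>L abelian_lie (card (pairs d) + b)"
      "tensor_square L \<cong>\<^sub>L abelian_lie (d * d + b)" "J2 L \<cong>\<^sub>L abelian_lie (d * d - m + b)"
      by blast
    have rb: "real b = D * M - Q"
      using arg_cong[OF b(1), of real] by (simp add: D_def M_def Q_def)
    have "m \<le> d * d" using card_pairs[of d] mr by linarith
    then have dm: "real (d * d - m) = D * D - M" by (simp add: of_nat_diff D_def M_def)
    have "real (card (pairs d) + b) = N + (D * M - Q)" by (simp only: of_nat_add rb N_def)
    moreover have "real (d * d + b) = D * D + (D * M - Q)"
      by (simp only: of_nat_add of_nat_mult rb D_def)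
    moreover have "real (d * d - m + b) = D * D - M + (D * M - Q)"
      by (simp only: of_nat_add[of "d * d - m"] dm rb)
    ultimately show ?thesis using b(2-4) by (intro conjI) (rule exI, erule conjI, assumption)+
  qed
  show ?thesis unfolding M_def[symmetric] D_def[symmetric]
  proof (rule conjI; rule impI)
    assume m: "M = 1/2 * D * (D - 1) - 1"
    have rank: "M = N - real 1" unfolding N m by (simp add: field_simps)
    have eqs: "N + (D * M - Q) = 1/6 * (D - 1) * (2 * D ^ 2 + 5 * D - 6) - 1"
      "D * D + (D * M - Q) = 1/3 * D * (D ^ 2 + 3 * D - 4)"
      "D * D - M + (D * M - Q) = 1/6 * D * (2 * D ^ 2 + 3 * D - 5) + 1"
      unfolding N Q m by (simp_all add: field_simps power2_eq_square)
    show "(\<exists>n. real n = 1/6 * (D - 1) * (2 * D ^ 2 + 5 * D - 6) - 1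
         \<and> exterior_square L \<cong>\<^sub>L abelian_lie n) \<and>
      (\<exists>n. real n = 1/3 * D * (D ^ 2 + 3 * D - 4) \<and> tensor_square L \<cong>\<^sub>L abelian_lie n) \<and>
      (\<exists>n. real n = 1/6 * D * (2 * D ^ 2 + 3 * D - 5) + 1 \<and> J2 L \<cong>\<^sub>L abelian_lie n)"
      unfolding eqs[symmetric] by (rule dims[OF rank]) simp
  next
    assume m: "M = 1/2 * D * (D - 1) - 2"
    have rank: "M = N - real 2" unfolding N m by (simp add: field_simps)
    have eqs: "N + (D * M - Q) = 1/6 * (D - 1) * (2 * D ^ 2 + 5 * D - 12) - 2"
      "D * D + (D * M - Q) = 1/3 * D * (D ^ 2 + 3 * D - 7)"
      "D * D - M + (D * M - Q) = 1/6 * D * (2 * D ^ 2 + 3 * D - 11) + 2"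
      unfolding N Q m by (simp_all add: field_simps power2_eq_square)
    show "(\<exists>n. real n = 1/6 * (D - 1) * (2 * D ^ 2 + 5 * D - 12) - 2
         \<and> exterior_square L \<cong>\<^sub>L abelian_lie n) \<and>
      (\<exists>n. real n = 1/3 * D * (D ^ 2 + 3 * D - 7) \<and> tensor_square L \<cong>\<^sub>L abelian_lie n) \<and>
      (\<exists>n. real n = 1/6 * D * (2 * D ^ 2 + 3 * D - 11) + 2 \<and> J2 L \<cong>\<^sub>L abelian_lie n)"
      unfolding eqs[symmetric] by (rule dims[OF rank]) simp
  qed
qed

end
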